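(* Let $\mathcal{A}$ with domain $D(\mathcal{A})$ be the operator on $X$ defined in the context. Then: (1) the resolvent set $\rho(\mathcal{A})$ contains the set $$\Psi=\{r\in\mathbb{C} : \mathrm{Re}(r)>0\}\cup\{r=ia : a\in\mathbb{R},\ a\neq 0\};$$ (2) the resolvent operator $\mathcal{R}(r,\mathcal{A})=(rI-\mathcal{A})^{-1}$ is compact for every $r\in\rho(\mathcal{A})$; (3) zero is a simple eigenvalue of $\mathcal{A}$ and is the only real eigenvalue of $\mathcal{A}$.
   Context: Let $0<L<\infty$, $\lambda_1>0$, $\lambda_2>0$. For $i=1,2$ let $\mu_i(x)\ge 0$, $x\in[0,L]$, be repair rates satisfying: $\int_0^l\mu_i(x)\,dx<\infty$ for every $0<l<L$; $\int_0^L\mu_i(x)\,dx=\infty$; and there is a positive integer $N$ such that $\lim_{x\to L}\mu_i(x)(L-x)^N<\infty$ for $i=1,2$. Let $X=\mathbb{R}\times L^1(0,L)\times L^1(0,L)$ with norm $\|(p_0,p_1,p_2)\|_X=|p_0|+\|p_1\|_{L^1(0,L)}+\|p_2\|_{L^1(0,L)}$; for spectral statements $X$ and operators on it are replaced by their complexifications. The operator $\mathcal{A}:D(\mathcal{A})\subset X\to X$ acts on $\vec p=(p_0,p_1,p_2)^T$ by $$\mathcal{A}\vec p=\begin{pmatrix}-(\lambda_1+\lambda_2)p_0+\int_0^L\mu_1(x)p_1(x)\,dx+\int_0^L\mu_2(x)p_2(x)\,dx\\ -p_1'(x)-(\mu_1(x)+\lambda_2)p_1(x)\\ -p_2'(x)-\mu_2(x)p_2(x)\end{pmatrix},$$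 with domain $$D(\mathcal{A})=\Big\{\vec p\in X:\ p_i\in W^{1,1}(0,L),\ \mu_ip_i\in L^1(0,L),\ i=1,2,\ \ p_1(0)=\lambda_1p_0,\ \ p_2(0)=\lambda_2p_0+\lambda_2\int_0^Lp_1(x)\,dx\Big\}.$$ *)

theory Defs
  imports "HOL-Analysis.Analysis"
begin

section \<open>Unbounded operators on complex normed spaces\<close>

class complex_normed_vector = real_normed_vector +
  fixes scaleC :: "complex \<Rightarrow> 'a \<Rightarrow> 'a" (infixr "*\<^sub>C" 75)
  assumes scaleC_add_right: "a *\<^sub>C (x + y) = a *\<^sub>C x + a *\<^sub>C y"
    and scaleC_add_left: "(a + b) *\<^sub>C x = a *\<^sub>C x + b *\<^sub>C x"
    and scaleC_scaleC: "a *\<^sub>C b *\<^sub>C x = (a * b) *\<^sub>C x"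
    and scaleC_of_real: "complex_of_real s *\<^sub>C x = s *\<^sub>R x"
    and norm_scaleC: "norm (a *\<^sub>C x) = norm a * norm x"

text \<open>
  An operator on a subspace \<open>V\<close> of the ambient type is given by its domain \<open>D \<subseteq> V\<close> and by a
  function \<open>A\<close> of which only the values on \<open>D\<close> matter.
\<close>

definition resolvent ::
  "'a::complex_normed_vector set \<Rightarrow> ('a \<Rightarrow> 'a) \<Rightarrow> complex \<Rightarrow> 'a \<Rightarrow> 'a" where
  "resolvent D A r = inv_into D (\<lambda>p. r *\<^sub>C p - A p)"

definition resolvent_set ::
  "'a::complex_normed_vector set \<Rightarrow> 'a set \<Rightarrow> ('a \<Rightarrow> 'a) \<Rightarrow> complex set" where
  "resolvent_set V D A =
     {r. bij_betw (\<lambda>p. r *\<^sub>C p - A p) D V \<and>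
         (\<exists>C. \<forall>y\<in>V. norm (resolvent D A r y) \<le> C * norm y)}"

definition compact_operator_on ::
  "'a::real_normed_vector set \<Rightarrow> ('a \<Rightarrow> 'a) \<Rightarrow> bool" where
  "compact_operator_on V T \<longleftrightarrow>
     (\<forall>S. S \<subseteq> V \<and> bounded S \<longrightarrow> (\<exists>K. compact K \<and> K \<subseteq> V \<and> T ` S \<subseteq> K))"

definition is_eigenvalue ::
  "'a::complex_normed_vector set \<Rightarrow> ('a \<Rightarrow> 'a) \<Rightarrow> complex \<Rightarrow> bool" where
  "is_eigenvalue D A r \<longleftrightarrow> (\<exists>p\<in>D. p \<noteq> 0 \<and> A p = r *\<^sub>C p)"

text \<open>The kernel of \<open>(rI - A)\<^sup>n\<close>, with the natural domain of that power.\<close>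

primrec ker_power ::
  "'a::complex_normed_vector set \<Rightarrow> ('a \<Rightarrow> 'a) \<Rightarrow> complex \<Rightarrow> nat \<Rightarrow> 'a set" where
  "ker_power D A r 0 = {0}"
| "ker_power D A r (Suc n) = {p \<in> D. r *\<^sub>C p - A p \<in> ker_power D A r n}"

text \<open>
  Simplicity is algebraic: the generalized eigenspace is one-dimensional. It implies that
  the eigenspace is one-dimensional.
\<close>

definition is_simple_eigenvalue ::
  "'a::complex_normed_vector set \<Rightarrow> ('a \<Rightarrow> 'a) \<Rightarrow> complex \<Rightarrow> bool" where
  "is_simple_eigenvalue D A r \<longleftrightarrow>
     is_eigenvalue D A r \<and>
     (\<exists>p. p \<noteq> 0 \<and> (\<Union>n. ker_power D A r n) = range (\<lambda>c. c *\<^sub>C p))"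


section \<open>The space \<open>L\<^sup>1\<close>\<close>

text \<open>Complex-valued Lebesgue integrable functions on the real line modulo equality a.e.\<close>

definition l1_rel :: "(real \<Rightarrow> complex) \<Rightarrow> (real \<Rightarrow> complex) \<Rightarrow> bool" where
  "l1_rel f g \<longleftrightarrow>
     integrable lebesgue f \<and> integrable lebesgue g \<and> (AE x in lebesgue. f x = g x)"

quotient_type l1 = "real \<Rightarrow> complex" / partial: l1_rel
proof (rule part_equivpI)
  show "\<exists>f. l1_rel f f"
    by (rule exI[of _ "\<lambda>x. 0"]) (simp add: l1_rel_def)
  show "symp l1_rel"
    by (rule sympI) (auto simp: l1_rel_def)
  show "transp l1_rel"
    by (rule transpI) (auto simp: l1_rel_def)
qed

instantiation l1 :: real_vector
begin

lift_definition zero_l1 :: l1 is "\<lambda>x. 0"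
  by (simp add: l1_rel_def)

lift_definition plus_l1 :: "l1 \<Rightarrow> l1 \<Rightarrow> l1" is "\<lambda>f g x. f x + g x"
  by (auto simp: l1_rel_def)

lift_definition minus_l1 :: "l1 \<Rightarrow> l1 \<Rightarrow> l1" is "\<lambda>f g x. f x - g x"
  by (auto simp: l1_rel_def)

lift_definition uminus_l1 :: "l1 \<Rightarrow> l1" is "\<lambda>f x. - f x"
  by (auto simp: l1_rel_def)

lift_definition scaleR_l1 :: "real \<Rightarrow> l1 \<Rightarrow> l1" is "\<lambda>c f x. c *\<^sub>R f x"
  by (auto simp: l1_rel_def)

instance
  by standard (transfer; auto simp: l1_rel_def algebra_simps)+

end

instantiation l1 :: complex_normed_vector
begin

lift_definition norm_l1 :: "l1 \<Rightarrow> real" is "\<lambda>f. LINT x|lebesgue. norm (f x)"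
  by (auto simp: l1_rel_def intro!: integral_cong_AE)

lift_definition scaleC_l1 :: "complex \<Rightarrow> l1 \<Rightarrow> l1" is "\<lambda>c f x. c * f x"
  by (auto simp: l1_rel_def)

definition dist_l1 :: "l1 \<Rightarrow> l1 \<Rightarrow> real" where
  "dist_l1 f g = norm (f - g)"

definition sgn_l1 :: "l1 \<Rightarrow> l1" where
  "sgn_l1 f = f /\<^sub>R norm f"

definition uniformity_l1 :: "(l1 \<times> l1) filter" where
  "uniformity_l1 = (INF e\<in>{0<..}. principal {(f, g). dist f g < e})"

definition open_l1 :: "l1 set \<Rightarrow> bool" where
  "open_l1 U \<longleftrightarrow> (\<forall>f\<in>U. eventually (\<lambda>(f', g). f' = f \<longrightarrow> g \<in> U) uniformity)"

instance
proof
  fix f g :: l1 and s :: real and a b :: complex and U :: "l1 set"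
  show "dist f g = norm (f - g)" by (rule dist_l1_def)
  show "sgn f = f /\<^sub>R norm f" by (rule sgn_l1_def)
  show "(uniformity :: (l1 \<times> l1) filter) = (INF e\<in>{0<..}. principal {(f, g). dist f g < e})"
    by (rule uniformity_l1_def)
  show "open U \<longleftrightarrow> (\<forall>f\<in>U. \<forall>\<^sub>F (f', g) in uniformity. f' = f \<longrightarrow> g \<in> U)"
    by (rule open_l1_def)
  show "norm f = 0 \<longleftrightarrow> f = 0"
    by transfer (auto simp: l1_rel_def integral_nonneg_eq_0_iff_AE)
  show "norm (f + g) \<le> norm f + norm g"
  proof transfer
    fix f g assume "l1_rel f f" "l1_rel g g"
    then have *: "integrable lebesgue f" "integrable lebesgue g"
      by (auto simp: l1_rel_def)
    have "(LINT x|lebesgue. norm (f x + g x)) \<le> (LINT x|lebesgue. norm (f x) + norm (g x))"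
      using * by (intro integral_mono) (auto intro: norm_triangle_ineq)
    also have "\<dots> = (LINT x|lebesgue. norm (f x)) + (LINT x|lebesgue. norm (g x))"
      using * by (intro Bochner_Integration.integral_add) auto
    finally show "(LINT x|lebesgue. norm (f x + g x))
        \<le> (LINT x|lebesgue. norm (f x)) + (LINT x|lebesgue. norm (g x))" .
  qed
  show "norm (s *\<^sub>R f) = \<bar>s\<bar> * norm f"
    by transfer simp
  show "a *\<^sub>C (f + g) = a *\<^sub>C f + a *\<^sub>C g"
    by transfer (auto simp: l1_rel_def algebra_simps)
  show "(a + b) *\<^sub>C f = a *\<^sub>C f + b *\<^sub>C f"
    by transfer (auto simp: l1_rel_def algebra_simps)
  show "a *\<^sub>C b *\<^sub>C f = (a * b) *\<^sub>C f"
    by transfer (auto simp: l1_rel_def algebra_simps)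
  show "complex_of_real s *\<^sub>C f = s *\<^sub>R f"
    by transfer (auto simp: l1_rel_def scaleR_conv_of_real)
  show "norm (a *\<^sub>C f) = norm a * norm f"
    by transfer (simp add: norm_mult)
qed

end

text \<open>
  \<open>L\<^sup>1(0,L)\<close> is identified isometrically with the closed subspace of those classes in
  \<open>L\<^sup>1(\<real>)\<close> that vanish a.e. outside \<open>(0,L)\<close>; \<open>rep_l1 u\<close> is some representative of the class \<open>u\<close>.
\<close>

definition L1 :: "real \<Rightarrow> l1 set" where
  "L1 L = {u. AE x in lebesgue. x \<notin> {0<..<L} \<longrightarrow> rep_l1 u x = 0}"

definition to_L1 :: "real \<Rightarrow> (real \<Rightarrow> complex) \<Rightarrow> l1" where
  "to_L1 L f = abs_l1 (\<lambda>x. indicator {0<..<L} x *\<^sub>R f x)"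


section \<open>The Sobolev space \<open>W\<^sup>1\<^sup>,\<^sup>1(0,L)\<close>\<close>

definition test_function :: "real \<Rightarrow> (real \<Rightarrow> real) \<Rightarrow> bool" where
  "test_function L \<phi> \<longleftrightarrow>
     \<phi> C1_differentiable_on UNIV \<and>
     (\<exists>K. compact K \<and> K \<subseteq> {0<..<L} \<and> (\<forall>x. x \<notin> K \<longrightarrow> \<phi> x = 0))"

definition is_weak_deriv :: "real \<Rightarrow> l1 \<Rightarrow> l1 \<Rightarrow> bool" where
  "is_weak_deriv L u v \<longleftrightarrow>
     (\<forall>\<phi>. test_function L \<phi> \<longrightarrow>
        (LINT x:{0<..<L}|lebesgue. deriv \<phi> x *\<^sub>R rep_l1 u x) =
        - (LINT x:{0<..<L}|lebesgue. \<phi> x *\<^sub>R rep_l1 v x))"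

definition W11 :: "real \<Rightarrow> l1 set" where
  "W11 L = {u \<in> L1 L. \<exists>v\<in>L1 L. is_weak_deriv L u v}"

definition weak_deriv :: "real \<Rightarrow> l1 \<Rightarrow> l1" where
  "weak_deriv L u = (THE v. v \<in> L1 L \<and> is_weak_deriv L u v)"

text \<open>\<open>u(0)\<close> for \<open>u \<in> W\<^sup>1\<^sup>,\<^sup>1(0,L)\<close> is the value at \<open>0\<close> of the representative continuous on \<open>[0,L]\<close>.\<close>

definition trace0 :: "real \<Rightarrow> l1 \<Rightarrow> complex" where
  "trace0 L u = (THE c. \<exists>g. continuous_on {0..L} g \<and>
     (AE x in lebesgue. x \<in> {0<..<L} \<longrightarrow> rep_l1 u x = g x) \<and> g 0 = c)"


section \<open>The state space and the operator\<close>

text \<open>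
  Complex triples with the sum norm (the norm of the library's product type is Euclidean).
\<close>

datatype state = State (comp0: complex) (comp1: l1) (comp2: l1)

instantiation state :: real_vector
begin

definition zero_state :: state where
  "0 = State 0 0 0"

definition plus_state :: "state \<Rightarrow> state \<Rightarrow> state" where
  "p + q = State (comp0 p + comp0 q) (comp1 p + comp1 q) (comp2 p + comp2 q)"

definition minus_state :: "state \<Rightarrow> state \<Rightarrow> state" where
  "p - q = State (comp0 p - comp0 q) (comp1 p - comp1 q) (comp2 p - comp2 q)"

definition uminus_state :: "state \<Rightarrow> state" where
  "- p = State (- comp0 p) (- comp1 p) (- comp2 p)"

definition scaleR_state :: "real \<Rightarrow> state \<Rightarrow> state" where
  "s *\<^sub>R p = State (s *\<^sub>R comp0 p) (s *\<^sub>R comp1 p) (s *\<^sub>R comp2 p)"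

instance
proof
  fix p q w :: state and s t :: real
  show "p + q + w = p + (q + w)" "p + q = q + p" "0 + p = p" "- p + p = 0" "p - q = p + - q"
    by (simp_all add: plus_state_def zero_state_def uminus_state_def minus_state_def add_ac)
  show "s *\<^sub>R (p + q) = s *\<^sub>R p + s *\<^sub>R q" "(s + t) *\<^sub>R p = s *\<^sub>R p + t *\<^sub>R p"
    "s *\<^sub>R t *\<^sub>R p = (s * t) *\<^sub>R p" "1 *\<^sub>R p = p"
    by (simp_all add: plus_state_def scaleR_state_def algebra_simps)
qed

end

instantiation state :: complex_normed_vector
begin

definition scaleC_state :: "complex \<Rightarrow> state \<Rightarrow> state" where
  "a *\<^sub>C p = State (a * comp0 p) (a *\<^sub>C comp1 p) (a *\<^sub>C comp2 p)"

definition norm_state :: "state \<Rightarrow> real" where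
  "norm p = norm (comp0 p) + norm (comp1 p) + norm (comp2 p)"

definition dist_state :: "state \<Rightarrow> state \<Rightarrow> real" where
  "dist_state p q = norm (p - q)"

definition sgn_state :: "state \<Rightarrow> state" where
  "sgn_state p = p /\<^sub>R norm p"

definition uniformity_state :: "(state \<times> state) filter" where
  "uniformity_state = (INF e\<in>{0<..}. principal {(p, q). dist p q < e})"

definition open_state :: "state set \<Rightarrow> bool" where
  "open_state U \<longleftrightarrow> (\<forall>p\<in>U. eventually (\<lambda>(p', q). p' = p \<longrightarrow> q \<in> U) uniformity)"

instance
proof
  fix p q :: state and s :: real and a b :: complex and U :: "state set"
  show "dist p q = norm (p - q)" by (rule dist_state_def)
  show "sgn p = p /\<^sub>R norm p" by (rule sgn_state_def)
  show "(uniformity :: (state \<times> state) filter) = (INF e\<in>{0<..}. principal {(p, q). dist p q < e})"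
    by (rule uniformity_state_def)
  show "open U \<longleftrightarrow> (\<forall>p\<in>U. \<forall>\<^sub>F (p', q) in uniformity. p' = p \<longrightarrow> q \<in> U)"
    by (rule open_state_def)
  show "norm p = 0 \<longleftrightarrow> p = 0"
    by (cases p) (simp add: norm_state_def zero_state_def add_nonneg_eq_0_iff)
  show "norm (p + q) \<le> norm p + norm q"
    using norm_triangle_ineq[of "comp0 p" "comp0 q"] norm_triangle_ineq[of "comp1 p" "comp1 q"]
      norm_triangle_ineq[of "comp2 p" "comp2 q"]
    by (simp add: norm_state_def plus_state_def)
  show "norm (s *\<^sub>R p) = \<bar>s\<bar> * norm p"
    by (simp add: norm_state_def scaleR_state_def algebra_simps)
  show "a *\<^sub>C (p + q) = a *\<^sub>C p + a *\<^sub>C q" "(a + b) *\<^sub>C p = a *\<^sub>C p + b *\<^sub>C p"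
    "a *\<^sub>C b *\<^sub>C p = (a * b) *\<^sub>C p"
    by (simp_all add: plus_state_def scaleC_state_def scaleC_add_right scaleC_add_left
        scaleC_scaleC algebra_simps)
  show "complex_of_real s *\<^sub>C p = s *\<^sub>R p"
    by (simp add: scaleC_state_def scaleR_state_def scaleC_of_real scaleR_conv_of_real)
  show "norm (a *\<^sub>C p) = norm a * norm p"
    by (simp add: norm_state_def scaleC_state_def norm_scaleC norm_mult algebra_simps)
qed

end

definition X_space :: "real \<Rightarrow> state set" where
  "X_space L = {p. comp1 p \<in> L1 L \<and> comp2 p \<in> L1 L}"

definition A_dom ::
  "real \<Rightarrow> real \<Rightarrow> real \<Rightarrow> (real \<Rightarrow> real) \<Rightarrow> (real \<Rightarrow> real) \<Rightarrow> state set" where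
  "A_dom L lam1 lam2 \<mu>1 \<mu>2 =
     {p \<in> X_space L.
        comp1 p \<in> W11 L \<and> comp2 p \<in> W11 L \<and>
        set_integrable lebesgue {0<..<L} (\<lambda>x. \<mu>1 x *\<^sub>R rep_l1 (comp1 p) x) \<and>
        set_integrable lebesgue {0<..<L} (\<lambda>x. \<mu>2 x *\<^sub>R rep_l1 (comp2 p) x) \<and>
        trace0 L (comp1 p) = of_real lam1 * comp0 p \<and>
        trace0 L (comp2 p) = of_real lam2 * comp0 p
          + of_real lam2 * (LINT x:{0<..<L}|lebesgue. rep_l1 (comp1 p) x)}"

definition A_op ::
  "real \<Rightarrow> real \<Rightarrow> real \<Rightarrow> (real \<Rightarrow> real) \<Rightarrow> (real \<Rightarrow> real) \<Rightarrow> state \<Rightarrow> state" where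
  "A_op L lam1 lam2 \<mu>1 \<mu>2 p =
     State
       (- of_real (lam1 + lam2) * comp0 p
          + (LINT x:{0<..<L}|lebesgue. \<mu>1 x *\<^sub>R rep_l1 (comp1 p) x)
          + (LINT x:{0<..<L}|lebesgue. \<mu>2 x *\<^sub>R rep_l1 (comp2 p) x))
       (- weak_deriv L (comp1 p) - to_L1 L (\<lambda>x. (\<mu>1 x + lam2) *\<^sub>R rep_l1 (comp1 p) x))
       (- weak_deriv L (comp2 p) - to_L1 L (\<lambda>x. \<mu>2 x *\<^sub>R rep_l1 (comp2 p) x))"

end

theory Submission
  imports Defs
begin

text \<open>
  Each transport equation \<open>p' + (s + \<mu>) p = y\<close>, \<open>p(0) = c\<close>, has a unique solution with
  \<open>\<mu> p \<in> L\<^sup>1\<close>, given by variation of constants. It vanishes at \<open>L\<close>, because \<open>\<integral> \<mu> = \<infinity>\<close>; hence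
  \<open>\<integral> \<mu> p + s \<integral> p = c + \<integral> y\<close>. With these identities the equation for \<open>p\<^sub>0\<close> in \<open>r p - A p = y\<close> becomes
  conservation of mass, \<open>r (p\<^sub>0 + \<integral> p\<^sub>1 + \<integral> p\<^sub>2) = y\<^sub>0 + \<integral> y\<^sub>1 + \<integral> y\<^sub>2\<close>, and \<open>p\<^sub>0 + \<integral> p\<^sub>1 + \<integral> p\<^sub>2\<close> is
  affine in \<open>p\<^sub>0\<close> with slope \<open>(1 + \<lambda>\<^sub>1 H\<^sub>1(r + \<lambda>\<^sub>2)) (1 + \<lambda>\<^sub>2 H\<^sub>2(r))\<close>, where
  \<open>H\<^sub>i(s) = \<integral> exp (- s x - \<integral>\<^sub>0\<^sup>x \<mu>\<^sub>i) dx\<close>. Neither factor vanishes if \<open>r\<close> is real, or if \<open>Re r \<ge> 0\<close> and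
  \<open>r \<noteq> 0\<close>; this gives the resolvent set and the real eigenvalues. For \<open>r = 0\<close> the kernel is spanned
  by a state of positive mass, whereas the range of \<open>A\<close> consists of states of mass zero, so \<open>0\<close> is simple.
  Every \<open>p\<close> in the domain satisfies an a priori bound of \<open>p\<^sub>i'\<close> in \<open>L\<^sup>1\<close> by the graph norm, and bounded
  sets of \<open>W\<^sup>1\<^sup>,\<^sup>1(0,L)\<close> are precompact in \<open>L\<^sup>1(0,L)\<close>.
\<close>

text \<open>The obstacle sits at \<open>L\<close>: \<mu> is not integrable on \<open>[0,L]\<close>,
  so the integrating factor exists only below \<open>L\<close>, and \<open>\<mu> p\<close>
  multiplies a non-integrable factor with a vanishing one. Everything is therefore first done on
  \<open>[0,l]\<close> with \<open>l < L\<close>, and control up to \<open>L\<close> comes from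
  comparison with the real equation \<open>w' + \<mu> w = |y|\<close>, \<open>w(0) = |c|\<close>,
  whose own mass balance bounds \<open>w\<close> and the integral of \<open>\<mu> w\<close> by the
  data. The complex solution is dominated by \<open>K w\<close>, where \<open>K\<close> bounds
  \<open>|exp (- s x)|\<close> on \<open>[0,L]\<close>; for \<open>Re s \<ge> 0\<close> this allows
  \<open>K = 1\<close>, which is precise enough to exclude zeros of the two factors on the imaginary
  axis away from \<open>0\<close>. For other \<open>s\<close> a crude \<open>K\<close> suffices,
  because compactness needs only some bound.\<close>

section \<open>Indefinite Lebesgue integrals\<close>

text \<open>Fubini is needed for the Lebesgue measure itself, whose measurable functions represent
  the classes in \<open>l1\<close>. Completion leaves the measure of Borel sets unchanged, so a
  cover for \<open>lborel\<close> serves again.\<close>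

lemma sigma_finite_lebesgue: "sigma_finite_measure (lebesgue :: 'a::euclidean_space measure)"
proof
  obtain A :: "'a set set" where A: "countable A" "A \<subseteq> sets lborel" "\<Union>A = space lborel"
    "\<forall>a\<in>A. emeasure lborel a \<noteq> \<infinity>"
    using lborel.sigma_finite_countable by blast
  show "\<exists>A :: 'a set set. countable A \<and> A \<subseteq> sets lebesgue \<and> \<Union>A = space lebesgue \<and>
      (\<forall>a\<in>A. emeasure lebesgue a \<noteq> \<infinity>)"
    using A by (intro exI[of _ A]) (auto simp: emeasure_completion sets_completionI_sets subset_iff)
qed

interpretation lebesgue: sigma_finite_measure lebesgue
  by (rule sigma_finite_lebesgue)

interpretation lebesgue_pair: pair_sigma_finite lebesgue lebesgue ..

text \<open>Absolute continuity of \<open>F\<close> on \<open>[0,b]\<close> with derivative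
  \<open>f\<close>, encoded by the integral formula so that differentiation almost everywhere never
  occurs. \<open>F\<close> is pinned down at every point, \<open>f\<close> only up to null sets
  (\<open>primitive_on_cong\<close>).\<close>

definition primitive_on :: "real \<Rightarrow> (real \<Rightarrow> 'a::euclidean_space) \<Rightarrow> (real \<Rightarrow> 'a) \<Rightarrow> bool" where
  "primitive_on b F f \<longleftrightarrow>
     f absolutely_integrable_on {0..b} \<and> (\<forall>x\<in>{0..b}. F x = F 0 + integral {0..x} f)"

lemma primitive_on_integrable: "primitive_on b F f \<Longrightarrow> f absolutely_integrable_on {0..b}"
  and primitive_on_eq: "primitive_on b F f \<Longrightarrow> x \<in> {0..b} \<Longrightarrow> F x = F 0 + integral {0..x} f"
  unfolding primitive_on_def by blast+

lemma primitive_onI: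
  assumes "f absolutely_integrable_on {0..b}" "\<And>x. x \<in> {0..b} \<Longrightarrow> F x = F 0 + integral {0..x} f"
  shows "primitive_on b F f"
  using assms unfolding primitive_on_def by blast

lemma primitive_on_integral:
  assumes "f absolutely_integrable_on {0..b}"
  shows "primitive_on b (\<lambda>x. c + integral {0..x} f) f"
  using assms by (intro primitive_onI) simp_all

lemma primitive_on_subinterval:
  assumes "primitive_on b F f" "l \<le> b"
  shows "primitive_on l F f"
proof (rule primitive_onI)
  show "f absolutely_integrable_on {0..l}"
    using primitive_on_integrable[OF assms(1)] by (rule absolutely_integrable_on_subinterval) (use assms(2) in simp)
  show "F x = F 0 + integral {0..x} f" if "x \<in> {0..l}" for x
    by (rule primitive_on_eq[OF assms(1)]) (use that assms(2) in simp)
qed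

lemma primitive_on_continuous:
  assumes "primitive_on b F f"
  shows "continuous_on {0..b} F"
proof -
  have "continuous_on {0..b} (\<lambda>x. F 0 + integral {0..x} f)"
    using primitive_on_integrable[OF assms] set_lebesgue_integral_eq_integral(1)
    by (intro continuous_intros indefinite_integral_continuous_1) auto
  then show ?thesis
    by (rule continuous_on_eq) (simp add: primitive_on_eq[OF assms, symmetric])
qed

section \<open>Product and chain rules for indefinite integrals\<close>

lemma absolutely_integrable_continuous_mult:
  fixes F f :: "real \<Rightarrow> 'a::{euclidean_space,real_normed_field}"
  assumes "continuous_on {a..b} F" "f absolutely_integrable_on {a..b}"
  shows "(\<lambda>x. F x * f x) absolutely_integrable_on {a..b}"
proof (rule absolutely_integrable_bounded_measurable_product[where h = "(*)"])
  show "bilinear ((*) :: 'a \<Rightarrow> 'a \<Rightarrow> 'a)"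
    by (simp add: bilinear_conv_bounded_bilinear bounded_bilinear_mult)
  show "bounded (F ` {a..b})"
    using assms(1) compact_continuous_image compact_imp_bounded by blast
  show "F \<in> borel_measurable (lebesgue_on {a..b})"
    using assms(1) by (rule continuous_imp_measurable_on_sets_lebesgue) simp
qed (use assms(2) in simp_all)

lemma absolutely_integrable_continuous_mult_left:
  fixes F f :: "real \<Rightarrow> 'a::{euclidean_space,real_normed_field}"
  assumes "continuous_on {a..b} F" "f absolutely_integrable_on {a..b}"
  shows "(\<lambda>x. f x * F x) absolutely_integrable_on {a..b}"
  using absolutely_integrable_continuous_mult[OF assms] by (simp add: mult.commute)

text \<open>Fubini on the square \<open>[0,b]\<^sup>2\<close>, cut along the diagonal.\<close>

lemma integral_by_parts_absolutely_integrable: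
  fixes f g :: "real \<Rightarrow> 'a::{euclidean_space,real_normed_field}"
  assumes f: "f absolutely_integrable_on {0..b}" and g: "g absolutely_integrable_on {0..b}"
  shows "integral {0..b} f * integral {0..b} g =
    integral {0..b} (\<lambda>x. f x * integral {0..x} g + integral {0..x} f * g x)"
proof -
  define f' where "f' x = indicator {0..b} x *\<^sub>R f x" for x
  define g' where "g' x = indicator {0..b} x *\<^sub>R g x" for x
  have f'[measurable]: "integrable lebesgue f'" and g'[measurable]: "integrable lebesgue g'"
    using f g by (simp_all add: set_integrable_def f'_def[abs_def] g'_def[abs_def])
  have int: "integral {0..x} h = (LINT t|lebesgue. indicator {0..x} t *\<^sub>R h t)"
    if "h absolutely_integrable_on {0..b}" "x \<le> b" for x and h :: "real \<Rightarrow> 'a"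
    using set_lebesgue_integral_eq_integral(2)[OF absolutely_integrable_on_subinterval[OF that(1), where a = 0 and b = x]] that(2)
    by (simp add: set_lebesgue_integral_def)
  have contf: "continuous_on {0..b} (\<lambda>x. integral {0..x} f)"
    and contg: "continuous_on {0..b} (\<lambda>x. integral {0..x} g)"
    using f g set_lebesgue_integral_eq_integral(1) indefinite_integral_continuous_1 by blast+
  define P where "P = (\<lambda>p. f' (fst p) * g' (snd p))"
  have P: "integrable (lebesgue \<Otimes>\<^sub>M lebesgue) P"
  proof (rule lebesgue_pair.Fubini_integrable)
    show "P \<in> borel_measurable (lebesgue \<Otimes>\<^sub>M lebesgue)"
      unfolding P_def by measurable
  qed (use f' g' in \<open>auto simp: P_def norm_mult\<close>)
  \<comment> \<open>The half of the plane below the diagonal, measurable because both coordinates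
    are Borel measurable. Integrating \<open>P\<close> over it in one order, and over its complement
    in the other, yields the two summands.\<close>
  define T :: "(real \<times> real) set" where "T = {p \<in> space (lebesgue \<Otimes>\<^sub>M lebesgue). snd p \<le> fst p}"
  have id_m: "(\<lambda>x. x) \<in> lebesgue \<rightarrow>\<^sub>M (borel :: real measure)"
    by (simp add: measurable_completion)
  have fst_m: "fst \<in> lebesgue \<Otimes>\<^sub>M lebesgue \<rightarrow>\<^sub>M (borel :: real measure)"
    and snd_m: "snd \<in> lebesgue \<Otimes>\<^sub>M lebesgue \<rightarrow>\<^sub>M (borel :: real measure)"
    by (rule measurable_compose[OF measurable_fst id_m], rule measurable_compose[OF measurable_snd id_m])
  have T: "T \<in> sets (lebesgue \<Otimes>\<^sub>M lebesgue)"
    unfolding T_def using borel_measurable_le[OF snd_m fst_m] by simp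
  have T_ind: "indicator T (t, u) = indicat_real {..t} u" for t u
    by (auto simp: T_def space_pair_measure split: split_indicator)
  have P1: "integrable (lebesgue \<Otimes>\<^sub>M lebesgue) (\<lambda>p. indicator T p *\<^sub>R P p)"
    by (rule integrable_mult_indicator[OF T P])
  have P2: "integrable (lebesgue \<Otimes>\<^sub>M lebesgue) (\<lambda>p. P p - indicator T p *\<^sub>R P p)"
    by (rule Bochner_Integration.integrable_diff[OF P P1])
  have A: "integral\<^sup>L (lebesgue \<Otimes>\<^sub>M lebesgue) P =
      (LINT t|lebesgue. f' t) * (LINT u|lebesgue. g' u)"
    using lebesgue_pair.integral_fst'[OF P] by (simp add: P_def)
  have B: "integral\<^sup>L (lebesgue \<Otimes>\<^sub>M lebesgue) (\<lambda>p. indicator T p *\<^sub>R P p) =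
      integral {0..b} (\<lambda>t. f t * integral {0..t} g)"
  proof -
    have "integral\<^sup>L (lebesgue \<Otimes>\<^sub>M lebesgue) (\<lambda>p. indicator T p *\<^sub>R P p) =
        (LINT t|lebesgue. LINT u|lebesgue. indicator {..t} u *\<^sub>R (f' t * g' u))"
      using lebesgue_pair.integral_fst'[OF P1] by (simp add: P_def T_ind)
    also have "\<dots> = (LINT t|lebesgue. indicator {0..b} t *\<^sub>R (f t * integral {0..t} g))"
    proof (rule Bochner_Integration.integral_cong[OF refl])
      fix t :: real
      show "(LINT u|lebesgue. indicator {..t} u *\<^sub>R (f' t * g' u)) =
          indicator {0..b} t *\<^sub>R (f t * integral {0..t} g)"
      proof (cases "t \<in> {0..b}")
        case True
        have "(LINT u|lebesgue. indicator {..t} u *\<^sub>R (f' t * g' u)) =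
            (LINT u|lebesgue. f t * (indicator {0..t} u *\<^sub>R g u))"
          using True by (intro Bochner_Integration.integral_cong[OF refl])
            (auto simp: f'_def g'_def split: split_indicator)
        also have "\<dots> = f t * integral {0..t} g"
          using int[OF g, of t] True by (simp only: integral_mult_right_zero) simp
        finally show ?thesis using True by simp
      qed (simp add: f'_def)
    qed
    also have "\<dots> = integral {0..b} (\<lambda>t. f t * integral {0..t} g)"
    proof -
      have "(\<lambda>t. f t * integral {0..t} g) absolutely_integrable_on {0..b}"
        by (rule absolutely_integrable_continuous_mult_left[OF contg f])
      from int[OF this, of b] show ?thesis by simp
    qed
    finally show ?thesis .
  qed
  have C: "integral\<^sup>L (lebesgue \<Otimes>\<^sub>M lebesgue) (\<lambda>p. P p - indicator T p *\<^sub>R P p) =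
      integral {0..b} (\<lambda>u. integral {0..u} f * g u)"
  proof -
    have eq: "(\<lambda>p. P p - indicator T p *\<^sub>R P p) =
        (\<lambda>(t, u). f' t * g' u - indicator {u..} t *\<^sub>R (f' t * g' u))"
      by (auto simp: fun_eq_iff P_def T_ind split: split_indicator)
    have "integral\<^sup>L (lebesgue \<Otimes>\<^sub>M lebesgue) (\<lambda>p. P p - indicator T p *\<^sub>R P p) =
        (LINT u|lebesgue. LINT t|lebesgue. f' t * g' u - indicator {u..} t *\<^sub>R (f' t * g' u))"
      unfolding eq by (rule lebesgue_pair.integral_snd[OF P2[unfolded eq], symmetric])
    also have "\<dots> = (LINT u|lebesgue. indicator {0..b} u *\<^sub>R (integral {0..u} f * g u))"
    proof (rule Bochner_Integration.integral_cong[OF refl])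
      fix u :: real
      show "(LINT t|lebesgue. f' t * g' u - indicator {u..} t *\<^sub>R (f' t * g' u)) =
          indicator {0..b} u *\<^sub>R (integral {0..u} f * g u)"
      proof (cases "u \<in> {0..b}")
        case True
        have fu: "set_integrable lebesgue {0..u} f"
          using absolutely_integrable_on_subinterval[OF f, where a = 0 and b = u] True by auto
        \<comment> \<open>The complement of \<open>T\<close> gives \<open>t < u\<close>, whereas
          \<open>integral {0..u}\<close> includes \<open>t = u\<close>: a null set.\<close>
        have ae: "AE t in lebesgue. t \<noteq> u"
          by (rule AE_completion) (rule AE_lborel_singleton)
        have "(\<lambda>t. (indicator {0..u} t *\<^sub>R f t) * g u) \<in> borel_measurable lebesgue"
          using fu by (intro borel_measurable_times borel_measurable_const)
            (simp add: set_integrable_def borel_measurable_integrable)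
        moreover have "(\<lambda>t. f' t * g' u - indicator {u..} t *\<^sub>R (f' t * g' u)) \<in> borel_measurable lebesgue"
          using borel_measurable_integrable[OF f']
          by (intro borel_measurable_diff borel_measurable_scaleR borel_measurable_indicator
              borel_measurable_times borel_measurable_const) auto
        moreover have "AE t in lebesgue. f' t * g' u - indicator {u..} t *\<^sub>R (f' t * g' u) =
            (indicator {0..u} t *\<^sub>R f t) * g u"
          using ae
        proof eventually_elim
          case (elim t)
          then show ?case
            using True by (cases "t < u") (simp_all add: f'_def g'_def indicator_def)
        qed
        ultimately have "(LINT t|lebesgue. f' t * g' u - indicator {u..} t *\<^sub>R (f' t * g' u)) =
            (LINT t|lebesgue. (indicator {0..u} t *\<^sub>R f t) * g u)"
          by (intro integral_cong_AE)
        also have "\<dots> = integral {0..u} f * g u"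
          using int[OF f, of u] True by (simp only: integral_mult_left_zero) simp
        finally show ?thesis using True by simp
      qed (simp add: g'_def)
    qed
    also have "\<dots> = integral {0..b} (\<lambda>t. integral {0..t} f * g t)"
    proof -
      have "(\<lambda>t. integral {0..t} f * g t) absolutely_integrable_on {0..b}"
        by (rule absolutely_integrable_continuous_mult[OF contf g])
      from int[OF this, of b] show ?thesis by simp
    qed
    finally show ?thesis .
  qed
  have "integral {0..b} f * integral {0..b} g = integral\<^sup>L (lebesgue \<Otimes>\<^sub>M lebesgue) P"
    using A int[OF f, of b] int[OF g, of b] by (simp add: f'_def g'_def)
  also have "\<dots> = integral\<^sup>L (lebesgue \<Otimes>\<^sub>M lebesgue) (\<lambda>p. indicator T p *\<^sub>R P p) +
      integral\<^sup>L (lebesgue \<Otimes>\<^sub>M lebesgue) (\<lambda>p. P p - indicator T p *\<^sub>R P p)"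
    using P P1 by simp
  also have "\<dots> = integral {0..b} (\<lambda>x. f x * integral {0..x} g + integral {0..x} f * g x)"
    unfolding B C
    by (intro integral_add[symmetric] set_lebesgue_integral_eq_integral(1)
        absolutely_integrable_continuous_mult[OF contf g] absolutely_integrable_continuous_mult_left[OF contg f])
  finally show ?thesis .
qed

text \<open>After splitting off the constants \<open>F 0\<close> and \<open>G 0\<close>, which enter
  linearly, what remains is a product of two integrals, covered by the Fubini identity
  above.\<close>

lemma primitive_on_mult:
  fixes F G f g :: "real \<Rightarrow> 'a::{euclidean_space,real_normed_field}"
  assumes F: "primitive_on b F f" and G: "primitive_on b G g"
  shows "primitive_on b (\<lambda>x. F x * G x) (\<lambda>x. f x * G x + F x * g x)"
proof (rule primitive_onI)
  note contF = primitive_on_continuous[OF F] and contG = primitive_on_continuous[OF G]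
  note f = primitive_on_integrable[OF F] and g = primitive_on_integrable[OF G]
  have fG: "(\<lambda>x. f x * G x) absolutely_integrable_on {0..b}"
    by (rule absolutely_integrable_continuous_mult_left[OF contG f])
  have Fg: "(\<lambda>x. F x * g x) absolutely_integrable_on {0..b}"
    by (rule absolutely_integrable_continuous_mult[OF contF g])
  show "(\<lambda>x. f x * G x + F x * g x) absolutely_integrable_on {0..b}"
    using fG Fg by (rule set_integral_add(1))
  fix x assume x: "x \<in> {0..b}"
  have fx: "f absolutely_integrable_on {0..x}" and gx: "g absolutely_integrable_on {0..x}"
    using primitive_on_integrable[OF primitive_on_subinterval[OF F, of x]]
      primitive_on_integrable[OF primitive_on_subinterval[OF G, of x]] x by auto
  have contf: "continuous_on {0..x} (\<lambda>x. integral {0..x} f)"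
    and contg: "continuous_on {0..x} (\<lambda>x. integral {0..x} g)"
    using fx gx set_lebesgue_integral_eq_integral(1) indefinite_integral_continuous_1 by blast+
  note integrable = set_lebesgue_integral_eq_integral(1)
  have A: "(\<lambda>t. f t * integral {0..t} g) integrable_on {0..x}"
    by (rule integrable[OF absolutely_integrable_continuous_mult_left[OF contg fx]])
  have B: "(\<lambda>t. integral {0..t} f * g t) integrable_on {0..x}"
    by (rule integrable[OF absolutely_integrable_continuous_mult[OF contf gx]])
  have C: "(\<lambda>t. f t * G 0) integrable_on {0..x}" "(\<lambda>t. F 0 * g t) integrable_on {0..x}"
    using integrable[OF fx] integrable[OF gx] by (auto intro: integrable_on_mult_left integrable_on_mult_right)
  have "integral {0..x} (\<lambda>t. f t * G t + F t * g t) =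
      integral {0..x} (\<lambda>t. (f t * G 0 + F 0 * g t) + (f t * integral {0..t} g + integral {0..t} f * g t))"
  proof (rule integral_cong)
    fix t assume "t \<in> {0..x}"
    then have "t \<in> {0..b}" using x by auto
    from primitive_on_eq[OF F this] primitive_on_eq[OF G this]
    have "F t = F 0 + integral {0..t} f" "G t = G 0 + integral {0..t} g" .
    then show "f t * G t + F t * g t =
        (f t * G 0 + F 0 * g t) + (f t * integral {0..t} g + integral {0..t} f * g t)"
      by (simp only: distrib_left distrib_right add_ac)
  qed
  also have "\<dots> = integral {0..x} f * G 0 + F 0 * integral {0..x} g + integral {0..x} f * integral {0..x} g"
    unfolding integral_by_parts_absolutely_integrable[OF fx gx]
    using A B C by (simp add: integral_add integrable_add)
  also have "\<dots> = (F 0 + integral {0..x} f) * (G 0 + integral {0..x} g) - F 0 * G 0"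
    by (simp add: algebra_simps)
  also have "\<dots> = F x * G x - F 0 * G 0"
    by (simp only: primitive_on_eq[OF F x, symmetric] primitive_on_eq[OF G x, symmetric])
  finally show "F x * G x = F 0 * G 0 + integral {0..x} (\<lambda>x. f x * G x + F x * g x)"
    by simp
qed

lemma primitive_on_add:
  assumes F: "primitive_on b F f" and G: "primitive_on b G g"
  shows "primitive_on b (\<lambda>x. F x + G x) (\<lambda>x. f x + g x)"
proof (rule primitive_onI)
  show "(\<lambda>x. f x + g x) absolutely_integrable_on {0..b}"
    using primitive_on_integrable[OF F] primitive_on_integrable[OF G] by (rule set_integral_add(1))
  fix x assume x: "x \<in> {0..b}"
  have "f integrable_on {0..x}" "g integrable_on {0..x}"
    using primitive_on_integrable[OF primitive_on_subinterval[OF F, of x]]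
      primitive_on_integrable[OF primitive_on_subinterval[OF G, of x]] x
    by (auto intro: set_lebesgue_integral_eq_integral(1))
  then show "F x + G x = F 0 + G 0 + integral {0..x} (\<lambda>x. f x + g x)"
    by (subst primitive_on_eq[OF F x], subst primitive_on_eq[OF G x]) (simp add: integral_add)
qed

lemma primitive_on_const: "primitive_on b (\<lambda>x. c) (\<lambda>x. 0)"
  by (rule primitive_onI) (simp_all add: set_integrable_def)

lemma primitive_on_cmult:
  fixes F f :: "real \<Rightarrow> 'a::{euclidean_space,real_normed_field}"
  assumes "primitive_on b F f"
  shows "primitive_on b (\<lambda>x. c * F x) (\<lambda>x. c * f x)"
  using primitive_on_mult[OF primitive_on_const assms, of c] by simp

lemma primitive_on_cong:
  assumes F: "primitive_on b F f" and "\<And>x. x \<in> {0..b} \<Longrightarrow> F x = G x"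
    and N: "negligible N" "\<And>x. x \<in> {0..b} - N \<Longrightarrow> f x = g x"
  shows "primitive_on b G g"
proof (rule primitive_onI)
  show "g absolutely_integrable_on {0..b}"
    by (rule absolutely_integrable_spike[OF primitive_on_integrable[OF F] N(1)]) (simp add: N(2))
  fix x assume x: "x \<in> {0..b}"
  have "integral {0..x} f = integral {0..x} g"
    by (rule integral_spike[OF N(1)]) (use N(2) x in auto)
  then show "G x = G 0 + integral {0..x} g"
    using primitive_on_eq[OF F x] assms(2)[OF x] assms(2)[of 0] x by auto
qed

lemma primitive_on_power:
  fixes F f :: "real \<Rightarrow> 'a::{euclidean_space,real_normed_field}"
  assumes F: "primitive_on b F f"
  shows "primitive_on b (\<lambda>x. F x ^ Suc n) (\<lambda>x. of_nat (Suc n) * F x ^ n * f x)"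
proof (induction n)
  case 0
  then show ?case using F by simp
next
  case (Suc n)
  show ?case
    by (rule primitive_on_cong[OF primitive_on_mult[OF F Suc] _ negligible_empty])
      (simp_all add: algebra_simps)
qed

text \<open>The chain rule for \<open>exp\<close> through its power series: by
  \<open>primitive_on_power\<close> the term \<open>F ^ n / fact n * f\<close> integrates to an
  increment of \<open>F ^ Suc n / fact (Suc n)\<close>. Sum and integral are interchanged by means
  of the summable majorants \<open>B ^ n / fact n * norm f\<close>, where \<open>B\<close> bounds
  the continuous \<open>F\<close>.\<close>

lemma primitive_on_exp:
  fixes F f :: "real \<Rightarrow> 'a::{euclidean_space,real_normed_field}"
  assumes F: "primitive_on b F f"
  shows "primitive_on b (\<lambda>x. exp (F x)) (\<lambda>x. exp (F x) * f x)"
proof (rule primitive_onI)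
  note contF = primitive_on_continuous[OF F] and f = primitive_on_integrable[OF F]
  show "(\<lambda>x. exp (F x) * f x) absolutely_integrable_on {0..b}"
    by (intro absolutely_integrable_continuous_mult continuous_on_exp contF f)
  fix x assume x: "x \<in> {0..b}"
  then have x': "{0..x} \<subseteq> {0..b}" by auto
  obtain B where B: "\<And>t. t \<in> {0..b} \<Longrightarrow> norm (F t) \<le> B"
    using compact_imp_bounded[OF compact_continuous_image[OF contF]]
    by (fastforce simp: bounded_iff)
  have fx: "f absolutely_integrable_on {0..x}"
    using f x' by (rule absolutely_integrable_on_subinterval)
  define h where "h n t = indicator {0..x} t *\<^sub>R (F t ^ n / fact n * f t)" for n t
  have abs: "(\<lambda>t. F t ^ n / fact n * f t) absolutely_integrable_on {0..x}" for n
    using continuous_on_subset[OF contF x'] fx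
    by (intro absolutely_integrable_continuous_mult continuous_intros) auto
  have h_int: "integrable lebesgue (h n)" for n
    using abs[of n] by (simp add: set_integrable_def h_def[abs_def])
  have h_norm: "norm (h n t) \<le> B ^ n / fact n * norm (indicator {0..x} t *\<^sub>R f t)" for n t
  proof (cases "t \<in> {0..x}")
    case True
    then have "norm (F t) ^ n \<le> B ^ n"
      using B[of t] x by (intro power_mono) auto
    then show ?thesis
      using True by (auto simp: h_def norm_mult norm_divide norm_power intro!: mult_right_mono divide_right_mono)
  qed (simp add: h_def)
  have sum_B: "summable (\<lambda>n. B ^ n / fact n * c)" for c
    using summable_exp_generic[of B] by (intro summable_mult2) (simp add: divide_inverse mult.commute scaleR_conv_of_real)
  have "(\<lambda>n. integral\<^sup>L lebesgue (h n)) sums (LINT t|lebesgue. (\<Sum>n. h n t))"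
  proof (rule sums_integral[OF h_int])
    show "AE t in lebesgue. summable (\<lambda>n. norm (h n t))"
      using h_norm by (intro AE_I2 summable_comparison_test'[OF sum_B]) auto
    show "summable (\<lambda>n. LINT t|lebesgue. norm (h n t))"
    proof (rule summable_comparison_test'[OF sum_B])
      fix n
      have "(LINT t|lebesgue. norm (h n t)) \<le> (LINT t|lebesgue. B ^ n / fact n * norm (indicator {0..x} t *\<^sub>R f t))"
        using h_int fx h_norm
        by (intro integral_mono integrable_norm integrable_mult_right) (auto simp: set_integrable_def)
      also have "\<dots> = B ^ n / fact n * (LINT t|lebesgue. norm (indicator {0..x} t *\<^sub>R f t))"
        by (rule integral_mult_right_zero)
      finally show "norm (LINT t|lebesgue. norm (h n t)) \<le>
          B ^ n / fact n * (LINT t|lebesgue. norm (indicator {0..x} t *\<^sub>R f t))" by simp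
    qed
  qed
  moreover have "integral\<^sup>L lebesgue (h n) = (F x ^ Suc n - F 0 ^ Suc n) / fact (Suc n)" for n
  proof -
    have "integral\<^sup>L lebesgue (h n) = integral {0..x} (\<lambda>t. F t ^ n / fact n * f t)"
      using set_lebesgue_integral_eq_integral(2)[OF abs[of n]]
      by (simp only: h_def[abs_def] set_lebesgue_integral_def)
    also have "\<dots> = integral {0..x} (\<lambda>t. (1 / fact (Suc n)) * (of_nat (Suc n) * F t ^ n * f t))"
    proof (rule integral_cong)
      fix t
      have "a / k * c = 1 / (m * k) * (m * a * c)" if "m \<noteq> 0" for a k m c :: 'a
        using that by (cases "k = 0") (simp_all add: field_simps)
      from this[of "of_nat (Suc n)"]
      show "F t ^ n / fact n * f t = (1 / fact (Suc n)) * (of_nat (Suc n) * F t ^ n * f t)"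
        unfolding fact_Suc using of_nat_neq_0 by blast
    qed
    also have "\<dots> = (1 / fact (Suc n)) * integral {0..x} (\<lambda>t. of_nat (Suc n) * F t ^ n * f t)"
      by (rule integral_mult_right)
    also have "integral {0..x} (\<lambda>t. of_nat (Suc n) * F t ^ n * f t) = F x ^ Suc n - F 0 ^ Suc n"
      using primitive_on_eq[OF primitive_on_power[OF F, of n] x] by (metis add_diff_cancel_left')
    finally show ?thesis by simp
  qed
  moreover have "(LINT t|lebesgue. (\<Sum>n. h n t)) = integral {0..x} (\<lambda>t. exp (F t) * f t)"
  proof -
    have "(\<Sum>n. h n t) = indicator {0..x} t *\<^sub>R (exp (F t) * f t)" for t
    proof -
      have "(\<lambda>n. F t ^ n / fact n) sums exp (F t)"
        using exp_converges[of "F t"] by (simp add: divide_inverse scaleR_conv_of_real mult.commute)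
      then have "(\<lambda>n. indicator {0..x} t *\<^sub>R (F t ^ n / fact n * f t)) sums
          (indicator {0..x} t *\<^sub>R (exp (F t) * f t))"
        by (intro sums_scaleR_right sums_mult2)
      then show ?thesis unfolding h_def by (rule sums_unique[symmetric])
    qed
    moreover have "(\<lambda>t. exp (F t) * f t) absolutely_integrable_on {0..x}"
      using continuous_on_subset[OF contF x'] fx
      by (intro absolutely_integrable_continuous_mult continuous_intros) auto
    ultimately show ?thesis
      using set_lebesgue_integral_eq_integral(2) by (simp add: set_lebesgue_integral_def)
  qed
  moreover have "(\<lambda>n. (F x ^ Suc n - F 0 ^ Suc n) / fact (Suc n)) sums (exp (F x) - exp (F 0))"
  proof -
    have "(\<lambda>n. F x ^ n / fact n - F 0 ^ n / fact n) sums (exp (F x) - exp (F 0))"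
      using exp_converges[of "F x"] exp_converges[of "F 0"]
      by (intro sums_diff) (simp_all add: divide_inverse scaleR_conv_of_real mult.commute)
    \<comment> \<open>The term at index \<open>0\<close> is \<open>1 - 1 = 0\<close>, so shifting
      the index does not change the sum.\<close>
    then show ?thesis
      using sums_Suc_iff[of "\<lambda>n. F x ^ n / fact n - F 0 ^ n / fact n"]
      by (simp add: diff_divide_distrib del: power_Suc fact_Suc)
  qed
  ultimately have "exp (F x) - exp (F 0) = integral {0..x} (\<lambda>t. exp (F t) * f t)"
    using sums_unique2 by (simp only:)
  then show "exp (F x) = exp (F 0) + integral {0..x} (\<lambda>x. exp (F x) * f x)"
    by (simp add: algebra_simps)
qed

lemma primitive_on_C1:
  fixes \<phi> \<psi> :: "real \<Rightarrow> 'a::euclidean_space"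
  assumes "\<And>x. (\<phi> has_vector_derivative \<psi> x) (at x)" "continuous_on {0..b} \<psi>"
  shows "primitive_on b \<phi> \<psi>"
proof (rule primitive_onI)
  show "\<psi> absolutely_integrable_on {0..b}"
    using assms(2) by (rule absolutely_integrable_continuous_real)
  fix x assume "x \<in> {0..b}"
  then have "0 \<le> x" by simp
  then have "(\<psi> has_integral (\<phi> x - \<phi> 0)) {0..x}"
    by (rule fundamental_theorem_of_calculus) (rule has_vector_derivative_at_within[OF assms(1)])
  from integral_unique[OF this] show "\<phi> x = \<phi> 0 + integral {0..x} \<psi>" by simp
qed

section \<open>The transport equation with a repair rate\<close>

text \<open>The cut-off point is \<open>0\<close> for \<open>k = 0\<close> and increases to
  \<open>L\<close> without reaching it. Hence the limit loses the value at \<open>L\<close>, a null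
  set in the integrals that follow.\<close>

lemma truncations_tendsto:
  fixes f :: "real \<Rightarrow> 'a::real_normed_vector"
  assumes "0 < L" "x \<in> {0..L}"
  shows "(\<lambda>k. if x \<in> {0..L - L / real (Suc k)} then f x else 0) \<longlonglongrightarrow> (if x \<in> {0..<L} then f x else 0)"
proof (cases "x < L")
  case True
  have "(\<lambda>k. L - L / real (Suc k)) \<longlonglongrightarrow> L - 0"
    by (intro tendsto_diff tendsto_const LIMSEQ_Suc[OF lim_const_over_n])
  then have "eventually (\<lambda>k. x < L - L / real (Suc k)) sequentially"
    using True by (intro order_tendstoD) auto
  then have "eventually (\<lambda>k. (if x \<in> {0..L - L / real (Suc k)} then f x else 0) = (if x \<in> {0..<L} then f x else 0)) sequentially"
    by eventually_elim (use assms True in auto)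
  then show ?thesis by (rule tendsto_eventually)
next
  case False
  have "x \<notin> {0..L - L / real (Suc k)}" for k
  proof -
    have "0 < L / real (Suc k)" using assms by simp
    then show ?thesis using False by (simp only: atLeastAtMost_iff) linarith
  qed
  then show ?thesis using False by (simp only: if_False) simp
qed

text \<open>Monotone convergence along the truncations. It produces the first integrable function up
  to \<open>L\<close>, which then serves as majorant in
  \<open>dominated_imp_integrable\<close>.\<close>

lemma nonneg_bounded_integrals_imp_integrable:
  fixes f :: "real \<Rightarrow> real"
  assumes "0 < L" and nonneg: "\<And>x. x \<in> {0..L} \<Longrightarrow> 0 \<le> f x"
    and f: "\<And>l. 0 \<le> l \<Longrightarrow> l < L \<Longrightarrow> f absolutely_integrable_on {0..l}"
    and bound: "\<And>l. 0 \<le> l \<Longrightarrow> l < L \<Longrightarrow> integral {0..l} f \<le> R"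
  shows "f absolutely_integrable_on {0..L}" "integral {0..L} f \<le> R"
proof -
  define l where "l k = L - L / real (Suc k)" for k
  have l: "0 \<le> l k" "l k < L" "l k \<le> l (Suc k)" for k
    using \<open>0 < L\<close> by (auto simp: l_def field_simps)
  define F where "F k x = (if x \<in> {0..l k} then f x else 0)" for k x
  define G where "G x = (if x \<in> {0..<L} then f x else 0)" for x
  have inter: "min (l k) L = l k" for k
    using l(2)[of k] by simp
  have int: "F k integrable_on {0..L}" "integral {0..L} (F k) = integral {0..l k} f" for k
    using set_lebesgue_integral_eq_integral(1)[OF f[OF l(1,2)[of k]]]
    by (simp_all add: F_def[abs_def] integrable_restrict_Int integral_restrict_Int inter del: atLeastAtMost_iff)
  have "G integrable_on {0..L} \<and> (\<lambda>k. integral {0..L} (F k)) \<longlonglongrightarrow> integral {0..L} G"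
  proof (rule monotone_convergence_increasing)
    show "F k integrable_on {0..L}" for k by (rule int)
    show "F k x \<le> F (Suc k) x" if "x \<in> {0..L}" for k x
      using nonneg[OF that] l(3)[of k] by (auto simp: F_def)
    show "(\<lambda>k. F k x) \<longlonglongrightarrow> G x" if "x \<in> {0..L}" for x
      using truncations_tendsto[OF \<open>0 < L\<close> that, of f] by (simp add: F_def G_def l_def)
    have "0 \<le> integral {0..l k} f" for k
      using l[of k] nonneg by (intro integral_nonneg set_lebesgue_integral_eq_integral(1) f) auto
    then show "bounded (range (\<lambda>k. integral {0..L} (F k)))"
      using bound[OF l(1,2)] by (auto simp: bounded_iff int abs_of_nonneg intro!: exI[of _ R])
  qed
  note lim = this
  have spike: "f x = G x" if "x \<in> {0..L} - {L}" for x
    using that by (auto simp: G_def)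
  have "f integrable_on {0..L}"
    by (rule integrable_spike[OF conjunct1[OF lim] negligible_sing spike])
  then show "f absolutely_integrable_on {0..L}"
    using nonneg by (intro nonnegative_absolutely_integrable_1) auto
  have "integral {0..L} G \<le> R"
    using lim bound[OF l(1,2)] by (intro LIMSEQ_le_const2[of "\<lambda>k. integral {0..L} (F k)"]) (auto simp: int)
  moreover have "integral {0..L} f = integral {0..L} G"
    by (rule integral_spike[OF negligible_sing spike[symmetric]])
  ultimately show "integral {0..L} f \<le> R" by simp
qed

text \<open>The counterpart by dominated convergence, for functions without a sign; the same
  majorant gives absolute integrability of the limit.\<close>

lemma dominated_imp_integrable:
  fixes f :: "real \<Rightarrow> 'a::euclidean_space"
  assumes "0 < L"
    and f: "\<And>l. 0 \<le> l \<Longrightarrow> l < L \<Longrightarrow> f absolutely_integrable_on {0..l}"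
    and h: "h absolutely_integrable_on {0..L}"
    and le: "\<And>x. x \<in> {0..<L} \<Longrightarrow> norm (f x) \<le> h x"
  shows "f absolutely_integrable_on {0..L}"
proof -
  define l where "l k = L - L / real (Suc k)" for k
  have l: "0 \<le> l k" "l k < L" for k
    using \<open>0 < L\<close> by (auto simp: l_def field_simps)
  define F where "F k x = (if x \<in> {0..l k} then f x else 0)" for k x
  define G where "G x = (if x \<in> {0..<L} then f x else 0)" for x
  have inter: "min (l k) L = l k" for k
    using l(2)[of k] by simp
  have h': "(\<lambda>x. norm (h x)) integrable_on {0..L}"
    using h absolutely_integrable_on_def by blast
  have "G integrable_on {0..L}"
  proof (rule dominated_convergence(1)[where h = "\<lambda>x. norm (h x)" and f = F])
    show "F k integrable_on {0..L}" for k
      using set_lebesgue_integral_eq_integral(1)[OF f[OF l[of k]]]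
      by (simp add: F_def[abs_def] integrable_restrict_Int inter del: atLeastAtMost_iff)
    show "norm (F k x) \<le> norm (h x)" if "x \<in> {0..L}" for k x
      using le[of x] l(2)[of k] by (auto simp: F_def intro: order_trans)
    show "(\<lambda>k. F k x) \<longlonglongrightarrow> G x" if "x \<in> {0..L}" for x
      using truncations_tendsto[OF \<open>0 < L\<close> that, of f] by (simp add: F_def G_def l_def)
  qed (rule h')
  moreover have "norm (G x) \<le> norm (h x)" for x
    using le[of x] by (auto simp: G_def)
  ultimately have "G absolutely_integrable_on {0..L}"
    using h' by (intro absolutely_integrable_integrable_bound[where g = "\<lambda>x. norm (h x)"]) auto
  then show ?thesis
    by (rule absolutely_integrable_spike[OF _ negligible_sing[of L]]) (auto simp: G_def)
qed

text \<open>One rate at a time, since both components obey the same kind of equation. For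
  nonnegative \<open>\<mu>\<close> the last assumption expresses that its integral over
  \<open>[0,L]\<close> is infinite.\<close>

locale repair_rate =
  fixes L :: real and \<mu> :: "real \<Rightarrow> real"
  assumes L_pos: "0 < L"
    and nonneg: "x \<in> {0..L} \<Longrightarrow> 0 \<le> \<mu> x"
    and locally_integrable: "0 < l \<Longrightarrow> l < L \<Longrightarrow> \<mu> absolutely_integrable_on {0..l}"
    and not_integrable: "\<not> \<mu> absolutely_integrable_on {0..L}"
begin

section \<open>Variation of constants below \<open>L\<close>\<close>

lemma \<mu>_integrable: "l < L \<Longrightarrow> \<mu> absolutely_integrable_on {0..l}"
proof (rule absolutely_integrable_on_subinterval)
  assume "l < L"
  \<comment> \<open>\<open>L / 2\<close> is there for \<open>l \<le> 0\<close>, where the locale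
    assumption is silent.\<close>
  then show "\<mu> absolutely_integrable_on {0..max l (L / 2)}"
    using L_pos by (intro locally_integrable) auto
qed auto

text \<open>\<open>s x + \<integral>\<^sub>0\<^sup>x \<mu>\<close>, the exponent of the integrating factor of \<open>p' + (s + \<mu>) p = y\<close>.\<close>

definition expo :: "'a::{euclidean_space,real_normed_field} \<Rightarrow> real \<Rightarrow> 'a" where
  "expo s x = s * of_real x + of_real (integral {0..x} \<mu>)"

text \<open>Used with complex scalars for the solution, and with real scalars and
  \<open>s = 0\<close> for its majorant. The formula is meaningful only for \<open>x < L\<close>: at
  \<open>L\<close> the integral in \<open>expo\<close> does not exist and takes its default
  value.\<close>

definition duhamel :: "'a::{euclidean_space,real_normed_field} \<Rightarrow> 'a \<Rightarrow> (real \<Rightarrow> 'a) \<Rightarrow> real \<Rightarrow> 'a" where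
  "duhamel s c y x = exp (- expo s x) * (c + integral {0..x} (\<lambda>t. y t * exp (expo s t)))"

lemma expo_0 [simp]: "expo s 0 = 0"
  by (simp add: expo_def)

lemma duhamel_0 [simp]: "duhamel s c y 0 = c"
  by (simp add: duhamel_def)

lemma primitive_on_expo:
  fixes s :: "'a::{euclidean_space,real_normed_field}"
  assumes "l < L"
  shows "primitive_on l (expo s) (\<lambda>x. s + of_real (\<mu> x))"
proof -
  have "primitive_on l (\<lambda>x. 0 + integral {0..x} (\<lambda>x. of_real (\<mu> x) :: 'a)) (\<lambda>x. of_real (\<mu> x))"
    using absolutely_integrable_linear[OF \<mu>_integrable[OF assms] bounded_linear_of_real]
    by (intro primitive_on_integral) (simp add: o_def)
  moreover have "0 + integral {0..x} (\<lambda>x. of_real (\<mu> x) :: 'a) = of_real (integral {0..x} \<mu>)" if "x \<in> {0..l}" for x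
    using integral_linear[OF set_lebesgue_integral_eq_integral(1)[OF \<mu>_integrable[of x]] bounded_linear_of_real]
      that assms by (auto simp: o_def)
  ultimately have "primitive_on l (\<lambda>x. of_real (integral {0..x} \<mu>) :: 'a) (\<lambda>x. of_real (\<mu> x))"
    by (rule primitive_on_cong[OF _ _ negligible_empty]) auto
  moreover have "primitive_on l (\<lambda>x. s * of_real x) (\<lambda>x. s)"
  proof (rule primitive_on_C1)
    have "((\<lambda>x. of_real x :: 'a) has_vector_derivative 1) (at x)" for x
      using bounded_linear.has_vector_derivative[OF bounded_linear_of_real has_vector_derivative_id, of "at x"]
      by simp
    then show "((\<lambda>x. s * of_real x) has_vector_derivative s) (at x)" for x
      using bounded_linear.has_vector_derivative[OF bounded_linear_mult_right[of s]] by fastforce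
  qed simp
  ultimately show ?thesis
    unfolding expo_def[abs_def] by (intro primitive_on_add)
qed

lemma primitive_on_duhamel:
  assumes y: "y absolutely_integrable_on {0..L}" and l: "l < L"
  shows "primitive_on l (duhamel s c y) (\<lambda>x. y x - (s + of_real (\<mu> x)) * duhamel s c y x)"
proof -
  note e = primitive_on_expo[OF l, of s]
  have yl: "y absolutely_integrable_on {0..l}"
    using y by (rule absolutely_integrable_on_subinterval) (use l in auto)
  have "primitive_on l (\<lambda>x. c + integral {0..x} (\<lambda>t. y t * exp (expo s t))) (\<lambda>t. y t * exp (expo s t))"
    using primitive_on_continuous[OF primitive_on_exp[OF e]] yl
    by (intro primitive_on_integral absolutely_integrable_continuous_mult_left)
  from primitive_on_mult[OF primitive_on_exp[OF primitive_on_cmult[OF e, of "-1"]] this]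
  show ?thesis
    by (rule primitive_on_cong[OF _ _ negligible_empty])
      (auto simp: duhamel_def algebra_simps exp_minus)
qed

text \<open>The integrating factor cancels the terms with \<open>s + \<mu>\<close> and leaves an
  indefinite integral for \<open>p * exp (expo s)\<close>. This is the uniqueness half of the theory
  below \<open>L\<close>.\<close>

lemma eq_duhamel:
  assumes p: "primitive_on l p (\<lambda>x. y x - (s + of_real (\<mu> x)) * p x)" and l: "l < L" and x: "x \<in> {0..l}"
  shows "p x = duhamel s (p 0) y x"
proof -
  have "primitive_on l (\<lambda>x. p x * exp (expo s x)) (\<lambda>x. y x * exp (expo s x))"
    by (rule primitive_on_cong[OF primitive_on_mult[OF p primitive_on_exp[OF primitive_on_expo[OF l, of s]]] _ negligible_empty])
      (auto simp: algebra_simps)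
  from primitive_on_eq[OF this x]
  have "p x * exp (expo s x) = p 0 + integral {0..x} (\<lambda>x. y x * exp (expo s x))" by simp
  then show ?thesis
    by (simp add: duhamel_def exp_minus field_simps)
qed

text \<open>\<open>exp (- expo s x) * exp (expo s t)\<close> equals \<open>exp (- s (x - t))\<close>
  times a real factor free of \<open>s\<close>. Since \<open>x - t\<close> lies in
  \<open>[0,L]\<close>, the first is bounded by \<open>K\<close>; what remains is the formula for
  the real equation with \<open>s = 0\<close> and data \<open>norm c\<close>,
  \<open>norm y\<close>.\<close>

lemma norm_duhamel_le:
  fixes s :: "'a::{euclidean_space,real_normed_field}"
  assumes y: "y absolutely_integrable_on {0..L}"
    and K: "\<And>x. x \<in> {0..L} \<Longrightarrow> norm (exp (- (s * of_real x))) \<le> K"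
    and x: "x \<in> {0..<L}"
  shows "norm (duhamel s c y x) \<le> K * duhamel 0 (norm c) (\<lambda>t. norm (y t)) x"
proof -
  let ?M = "\<lambda>x. integral {0..x} \<mu>"
  have yx: "y absolutely_integrable_on {0..x}"
    using y by (rule absolutely_integrable_on_subinterval) (use x in auto)
  have "continuous_on {0..x} (expo s)" "continuous_on {0..x} (expo (0::real))"
    using primitive_on_continuous[OF primitive_on_expo] x by auto
  then have int: "(\<lambda>t. exp (- expo s x) * (y t * exp (expo s t))) absolutely_integrable_on {0..x}"
      "(\<lambda>t. norm (y t) * exp (expo (0::real) t)) absolutely_integrable_on {0..x}"
    using yx by (auto intro!: set_integrable_mult_right absolutely_integrable_continuous_mult_left continuous_intros
        absolutely_integrable_norm[unfolded o_def])
  have le: "norm (exp (- expo s x) * exp (expo s t)) \<le> K * (exp (- ?M x) * exp (?M t))" if "t \<in> {0..x}" for t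
  proof -
    have "- expo s x + expo s t = - (s * of_real (x - t)) + of_real (?M t - ?M x)"
      by (simp add: expo_def algebra_simps)
    then have "exp (- expo s x) * exp (expo s t) = exp (- (s * of_real (x - t))) * exp (of_real (?M t - ?M x))"
      by (simp only: exp_add[symmetric])
    then have "norm (exp (- expo s x) * exp (expo s t)) = norm (exp (- (s * of_real (x - t)))) * exp (?M t - ?M x)"
      by (simp add: norm_mult exp_of_real del: of_real_diff)
    also have "\<dots> \<le> K * exp (?M t - ?M x)"
      using that x by (intro mult_right_mono K) auto
    finally show ?thesis by (simp add: exp_diff exp_minus divide_inverse mult.commute)
  qed
  have "duhamel s c y x = exp (- expo s x) * c + integral {0..x} (\<lambda>t. exp (- expo s x) * (y t * exp (expo s t)))"
    by (simp add: duhamel_def distrib_left)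
  also have "norm \<dots> \<le> K * exp (- ?M x) * norm c +
      integral {0..x} (\<lambda>t. K * exp (- ?M x) * (norm (y t) * exp (expo (0::real) t)))"
  proof (intro norm_triangle_mono integral_norm_bound_integral set_lebesgue_integral_eq_integral(1) int(1)
      set_integrable_mult_right int(2))
    show "norm (exp (- expo s x) * c) \<le> K * exp (- ?M x) * norm c"
      using le[of 0] x by (auto simp: norm_mult intro!: mult_right_mono)
    show "norm (exp (- expo s x) * (y t * exp (expo s t))) \<le> K * exp (- ?M x) * (norm (y t) * exp (expo (0::real) t))"
      if "t \<in> {0..x}" for t
      using mult_right_mono[OF le[OF that], of "norm (y t)"]
      by (simp add: expo_def norm_mult mult_ac)
  qed
  also have "\<dots> = K * duhamel 0 (norm c) (\<lambda>t. norm (y t)) x"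
    by (simp add: duhamel_def expo_def distrib_left mult.assoc)
  finally show ?thesis .
qed

text \<open>Integrating \<open>q' = y - \<mu> q\<close> gives
  \<open>q l + \<integral> \<mu> q = c + \<integral> y\<close> over \<open>[0,l]\<close>. Both
  summands on the left are nonnegative, so each is bounded independently of \<open>l < L\<close>;
  monotone convergence then makes \<open>\<mu> q\<close> integrable up to \<open>L\<close> although
  \<open>\<mu>\<close> is not.\<close>

lemma duhamel_real_bounds:
  fixes c :: real
  assumes y: "y absolutely_integrable_on {0..L}" and "0 \<le> c" and y0: "\<And>x. x \<in> {0..L} \<Longrightarrow> 0 \<le> y x"
  defines "q \<equiv> duhamel 0 c y"
  shows "x \<in> {0..<L} \<Longrightarrow> 0 \<le> q x" "x \<in> {0..<L} \<Longrightarrow> q x \<le> c + integral {0..L} y"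
    "(\<lambda>x. if x < L then \<mu> x * q x else 0) absolutely_integrable_on {0..L}"
    "integral {0..L} (\<lambda>x. if x < L then \<mu> x * q x else 0) \<le> c + integral {0..L} y"
proof -
  have q0: "0 \<le> q x" if "x \<in> {0..<L}" for x
  proof -
    have "y absolutely_integrable_on {0..x}"
      using y by (rule absolutely_integrable_on_subinterval) (use that in auto)
    moreover have "continuous_on {0..x} (expo (0::real))"
      using primitive_on_continuous[OF primitive_on_expo] that by auto
    ultimately have "(\<lambda>t. y t * exp (expo (0::real) t)) absolutely_integrable_on {0..x}"
      by (intro absolutely_integrable_continuous_mult_left continuous_intros)
    then have "0 \<le> integral {0..x} (\<lambda>t. y t * exp (expo (0::real) t))"
      using that y0 by (intro integral_nonneg set_lebesgue_integral_eq_integral(1)) auto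
    then show ?thesis using \<open>0 \<le> c\<close> by (simp add: q_def duhamel_def)
  qed
  have key: "(\<lambda>x. \<mu> x * q x) absolutely_integrable_on {0..l}" "q l + integral {0..l} (\<lambda>x. \<mu> x * q x) \<le> c + integral {0..L} y"
    if "l \<in> {0..<L}" for l
  proof -
    have l: "l < L" "l \<in> {0..l}" using that by auto
    note q = primitive_on_duhamel[OF y l(1), of 0 c, folded q_def]
    show \<mu>q: "(\<lambda>x. \<mu> x * q x) absolutely_integrable_on {0..l}"
      by (intro absolutely_integrable_continuous_mult_left primitive_on_continuous[OF q] \<mu>_integrable l)
    have yl: "y absolutely_integrable_on {0..l}"
      using y by (rule absolutely_integrable_on_subinterval) (use that in auto)
    have "q l = c + integral {0..l} (\<lambda>x. y x - \<mu> x * q x)"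
      using primitive_on_eq[OF q l(2)] by (simp add: q_def)
    also have "\<dots> = c + integral {0..l} y - integral {0..l} (\<lambda>x. \<mu> x * q x)"
      using set_lebesgue_integral_eq_integral(1) \<mu>q yl by (subst integral_diff) auto
    also have "integral {0..l} y \<le> integral {0..L} y"
      using y0 that y yl by (intro integral_subset_le set_lebesgue_integral_eq_integral(1)) auto
    finally show "q l + integral {0..l} (\<lambda>x. \<mu> x * q x) \<le> c + integral {0..L} y" by simp
  qed
  have nonneg': "0 \<le> integral {0..l} (\<lambda>x. \<mu> x * q x)" if "l \<in> {0..<L}" for l
    using that q0 nonneg by (intro integral_nonneg set_lebesgue_integral_eq_integral(1)[OF key(1)]) auto
  show "0 \<le> q x" if "x \<in> {0..<L}" by (rule q0[OF that])
  show "q x \<le> c + integral {0..L} y" if "x \<in> {0..<L}"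
    using key(2)[OF that] nonneg'[OF that] by simp
  \<comment> \<open>Set to \<open>0\<close> at \<open>L\<close>, where \<open>duhamel\<close> does
    not represent the solution.\<close>
  let ?f = "\<lambda>x. if x < L then \<mu> x * q x else 0"
  have 1: "0 \<le> ?f x" if "x \<in> {0..L}" for x
    using that q0 nonneg by auto
  have 2: "?f absolutely_integrable_on {0..l}" if "0 \<le> l" "l < L" for l
    by (rule absolutely_integrable_spike[OF key(1) negligible_empty]) (use that in auto)
  have 3: "integral {0..l} ?f \<le> c + integral {0..L} y" if "0 \<le> l" "l < L" for l
  proof -
    have "integral {0..l} ?f = integral {0..l} (\<lambda>x. \<mu> x * q x)"
      by (rule integral_cong) (use that in auto)
    then show ?thesis using key(2)[of l] q0[of l] that by auto
  qed
  show "?f absolutely_integrable_on {0..L}" "integral {0..L} ?f \<le> c + integral {0..L} y"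
    by (rule nonneg_bounded_integrals_imp_integrable[OF L_pos 1 2 3]; assumption)+
qed

end

section \<open>Solutions on the whole interval \<open>[0,L]\<close>\<close>

context repair_rate begin

text \<open>In contrast to \<open>duhamel\<close>, \<open>p\<close> is determined at
  \<open>L\<close> too, by continuity. The integrability of \<open>\<mu> p\<close> comes from the
  domain of the operator and forces \<open>p L = 0\<close>; together with the equation it makes
  \<open>y\<close> integrable (\<open>solves_integrable\<close>).\<close>

definition solves :: "complex \<Rightarrow> complex \<Rightarrow> (real \<Rightarrow> complex) \<Rightarrow> (real \<Rightarrow> complex) \<Rightarrow> bool" where
  "solves s c y p \<longleftrightarrow> p 0 = c \<and> primitive_on L p (\<lambda>x. y x - (s + of_real (\<mu> x)) * p x) \<and>
     (\<lambda>x. of_real (\<mu> x) * p x) absolutely_integrable_on {0..L}"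

lemma solves_eq_duhamel:
  assumes "solves s c y p" "x \<in> {0..<L}"
  shows "p x = duhamel s c y x"
  using eq_duhamel[OF primitive_on_subinterval, of L p y s x x] assms by (auto simp: solves_def)

lemma norm_exp_neg_le: "x \<in> {0..L} \<Longrightarrow> norm (exp (- (s * of_real x))) \<le> exp (norm s * L)" for s :: complex
  by (rule order_trans[OF norm_exp]) (auto simp: norm_mult intro!: mult_left_mono)

lemma duhamel_dominated:
  fixes s c :: complex
  assumes y: "y absolutely_integrable_on {0..L}"
    and K: "\<And>x. x \<in> {0..L} \<Longrightarrow> norm (exp (- (s * of_real x))) \<le> K"
    and x: "x \<in> {0..<L}"
  shows "norm (duhamel s c y x) \<le> K * (norm c + integral {0..L} (\<lambda>t. norm (y t)))"
    and "norm (of_real (\<mu> x) * duhamel s c y x) \<le>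
      K * (if x < L then \<mu> x * duhamel 0 (norm c) (\<lambda>t. norm (y t)) x else 0)"
proof -
  have ny: "(\<lambda>t. norm (y t)) absolutely_integrable_on {0..L}"
    using absolutely_integrable_norm[OF y] by (simp add: o_def)
  have "0 \<le> K" using K[of 0] L_pos by auto
  note le = norm_duhamel_le[OF y K x, of c]
  show "norm (duhamel s c y x) \<le> K * (norm c + integral {0..L} (\<lambda>t. norm (y t)))"
    by (rule order_trans[OF le mult_left_mono[OF duhamel_real_bounds(2)[OF ny _ _ x] \<open>0 \<le> K\<close>]]) auto
  show "norm (of_real (\<mu> x) * duhamel s c y x) \<le>
      K * (if x < L then \<mu> x * duhamel 0 (norm c) (\<lambda>t. norm (y t)) x else 0)"
    using mult_left_mono[OF le, of "\<mu> x"] nonneg[of x] x by (auto simp: norm_mult mult_ac)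
qed

text \<open>\<open>duhamel\<close> solves the equation on \<open>[0,l]\<close> for each
  \<open>l < L\<close>, and domination makes its right-hand side integrable on \<open>[0,L]\<close>.
  The solution is therefore taken to be the indefinite integral of that right-hand side: it agrees
  with \<open>duhamel\<close> below \<open>L\<close> and is continuous at \<open>L\<close>.\<close>

lemma ex_solves:
  assumes y: "y absolutely_integrable_on {0..L}"
  shows "\<exists>p. solves s c y p"
proof -
  let ?d = "duhamel s c y"
  let ?K = "exp (norm s * L)"
  have K: "norm (exp (- (s * of_real x))) \<le> ?K" if "x \<in> {0..L}" for x
    using norm_exp_neg_le that by blast
  have ny: "(\<lambda>t. norm (y t)) absolutely_integrable_on {0..L}"
    using absolutely_integrable_norm[OF y] by (simp add: o_def)
  have cont: "continuous_on {0..l} ?d" if "l < L" for l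
    using primitive_on_continuous[OF primitive_on_duhamel[OF y that]] .
  have "(\<lambda>x. of_real (\<mu> x) * ?d x) absolutely_integrable_on {0..L}"
  proof (rule dominated_imp_integrable[OF L_pos])
    fix l :: real assume "0 \<le> l" "l < L"
    then show "(\<lambda>x. of_real (\<mu> x) * ?d x) absolutely_integrable_on {0..l}"
      by (intro absolutely_integrable_continuous_mult_left cont
          absolutely_integrable_linear[OF \<mu>_integrable bounded_linear_of_real, unfolded o_def])
  next
    show "(\<lambda>x. ?K * (if x < L then \<mu> x * duhamel 0 (norm c) (\<lambda>t. norm (y t)) x else 0)) absolutely_integrable_on {0..L}"
      by (intro set_integrable_mult_right duhamel_real_bounds(3) ny) auto
  qed (rule duhamel_dominated(2)[OF y K])
  note \<mu>d = this
  have "?d absolutely_integrable_on {0..L}"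
  proof (rule dominated_imp_integrable[OF L_pos])
    show "?d absolutely_integrable_on {0..l}" if "l < L" for l
      by (rule absolutely_integrable_continuous_real[OF cont[OF that]])
    show "(\<lambda>x. ?K * (norm c + integral {0..L} (\<lambda>t. norm (y t)))) absolutely_integrable_on {0..L}"
      by (intro absolutely_integrable_continuous_real continuous_intros)
  qed (rule duhamel_dominated(1)[OF y K])
  then have v: "(\<lambda>x. y x - (s + of_real (\<mu> x)) * ?d x) absolutely_integrable_on {0..L}"
    using set_integral_diff(1)[OF y set_integral_add(1)[OF set_integrable_mult_right[of s] \<mu>d]]
    by (simp add: algebra_simps)
  define p where "p x = c + integral {0..x} (\<lambda>x. y x - (s + of_real (\<mu> x)) * ?d x)" for x
  have prim: "primitive_on L p (\<lambda>x. y x - (s + of_real (\<mu> x)) * ?d x)"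
    unfolding p_def[abs_def] by (rule primitive_on_integral[OF v])
  have eq: "p x = ?d x" if "x \<in> {0..<L}" for x
    using primitive_on_eq[OF primitive_on_duhamel[OF y, of x s c], of x] that by (simp add: p_def)
  have "primitive_on L p (\<lambda>x. y x - (s + of_real (\<mu> x)) * p x)"
    by (rule primitive_on_cong[OF prim _ negligible_sing[of L]]) (auto simp: eq)
  moreover have "(\<lambda>x. of_real (\<mu> x) * p x) absolutely_integrable_on {0..L}"
    by (rule absolutely_integrable_spike[OF \<mu>d negligible_sing[of L]]) (auto simp: eq)
  ultimately show ?thesis
    unfolding solves_def by (intro exI[of _ p]) (simp add: p_def)
qed

text \<open>A nonzero limit of \<open>p\<close> at \<open>L\<close> would make \<open>\<mu>\<close> integrable, because \<open>\<mu> p\<close> is.\<close>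

lemma solves_end:
  assumes "solves s c y p"
  shows "p L = 0"
proof (rule ccontr)
  assume "p L \<noteq> 0"
  have prim: "primitive_on L p (\<lambda>x. y x - (s + of_real (\<mu> x)) * p x)"
    and \<mu>p: "(\<lambda>x. of_real (\<mu> x) * p x) absolutely_integrable_on {0..L}"
    using assms by (auto simp: solves_def)
  define \<delta> where "\<delta> = norm (p L) / 2"
  have "\<delta> > 0" using \<open>p L \<noteq> 0\<close> by (simp add: \<delta>_def)
  then obtain d where d: "d > 0" "\<And>x. x \<in> {0..L} \<Longrightarrow> dist x L < d \<Longrightarrow> dist (p x) (p L) < \<delta>"
    using primitive_on_continuous[OF prim] L_pos unfolding continuous_on_iff
    by (metis atLeastAtMost_iff less_eq_real_def)
  \<comment> \<open>Right of \<open>a\<close> the norm of \<open>p\<close> is at least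
    \<open>\<delta>\<close>, so \<open>\<mu>\<close> is bounded there by
    \<open>norm (\<mu> p) / \<delta>\<close>; on \<open>[0,a]\<close> it is integrable because
    \<open>a < L\<close>.\<close>
  define a where "a = max 0 (L - d / 2)"
  have a: "0 \<le> a" "a < L" using d(1) L_pos by (auto simp: a_def)
  have "\<mu> absolutely_integrable_on {0..L}"
  proof (rule dominated_imp_integrable[OF L_pos])
    show "\<mu> absolutely_integrable_on {0..l}" if "l < L" for l
      by (rule \<mu>_integrable[OF that])
    have "(\<lambda>x. if x \<in> {0..a} then \<mu> x else 0) absolutely_integrable_on {0..L}"
    proof (rule nonnegative_absolutely_integrable_1)
      show "(\<lambda>x. if x \<in> {0..a} then \<mu> x else 0) integrable_on {0..L}"
        using set_lebesgue_integral_eq_integral(1)[OF \<mu>_integrable[OF a(2)]] a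
        by (simp add: integrable_restrict_Int min_absorb1 del: atLeastAtMost_iff)
    qed (use nonneg in auto)
    moreover have "(\<lambda>x. (1 / \<delta>) * norm (of_real (\<mu> x) * p x)) absolutely_integrable_on {0..L}"
      using absolutely_integrable_norm[OF \<mu>p] by (intro set_integrable_mult_right) (simp add: o_def)
    ultimately show "(\<lambda>x. (if x \<in> {0..a} then \<mu> x else 0) + (1 / \<delta>) * norm (of_real (\<mu> x) * p x)) absolutely_integrable_on {0..L}"
      by (rule set_integral_add(1))
    show "norm (\<mu> x) \<le> (if x \<in> {0..a} then \<mu> x else 0) + (1 / \<delta>) * norm (of_real (\<mu> x) * p x)" if x: "x \<in> {0..<L}" for x
    proof (cases "x \<le> a")
      case True
      then show ?thesis using x nonneg[of x] \<open>\<delta> > 0\<close> by simp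
    next
      case False
      then have "dist (p x) (p L) < \<delta>"
        using x d by (intro d(2)) (auto simp: a_def dist_real_def)
      moreover have "norm (p L) \<le> norm (p x) + dist (p x) (p L)"
        by (metis add.commute dist_norm dist_commute norm_triangle_sub)
      ultimately have "\<delta> \<le> norm (p x)" by (simp add: \<delta>_def)
      then have "1 \<le> norm (p x) / \<delta>" using \<open>\<delta> > 0\<close> by simp
      then have "\<mu> x * 1 \<le> \<mu> x * (norm (p x) / \<delta>)" using nonneg[of x] x by (intro mult_left_mono) auto
      then show ?thesis using False nonneg[of x] x by (simp add: norm_mult)
    qed
  qed
  then show False using not_integrable by simp
qed

text \<open>\<open>duhamel\<close> decides below \<open>L\<close>; at \<open>L\<close> both
  solutions vanish by \<open>solves_end\<close>.\<close>

lemma solves_unique: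
  assumes "solves s c y p" "solves s c y q" "x \<in> {0..L}"
  shows "p x = q x"
  using solves_eq_duhamel[OF assms(1), of x] solves_eq_duhamel[OF assms(2), of x]
    solves_end[OF assms(1)] solves_end[OF assms(2)] assms(3) by (cases "x = L") auto

lemma solves_linear:
  assumes "solves s c y p" "solves s c' y' p'"
  shows "solves s (a * c + c') (\<lambda>x. a * y x + y' x) (\<lambda>x. a * p x + p' x)"
proof -
  have prim: "primitive_on L p (\<lambda>x. y x - (s + of_real (\<mu> x)) * p x)"
      "primitive_on L p' (\<lambda>x. y' x - (s + of_real (\<mu> x)) * p' x)"
    and int: "(\<lambda>x. of_real (\<mu> x) * p x) absolutely_integrable_on {0..L}"
      "(\<lambda>x. of_real (\<mu> x) * p' x) absolutely_integrable_on {0..L}"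
    using assms by (auto simp: solves_def)
  have "primitive_on L (\<lambda>x. a * p x + p' x) (\<lambda>x. (a * y x + y' x) - (s + of_real (\<mu> x)) * (a * p x + p' x))"
    by (rule primitive_on_cong[OF primitive_on_add[OF primitive_on_cmult[OF prim(1), of a] prim(2)] _ negligible_empty])
      (auto simp: algebra_simps)
  moreover have "(\<lambda>x. of_real (\<mu> x) * (a * p x + p' x)) absolutely_integrable_on {0..L}"
    using set_integral_add(1)[OF set_integrable_mult_right[of a, OF int(1)] int(2)]
    by (simp add: algebra_simps)
  ultimately show ?thesis using assms by (simp add: solves_def)
qed

lemma solves_integrable:
  assumes "solves s c y p"
  shows "p absolutely_integrable_on {0..L}" "y absolutely_integrable_on {0..L}"
proof -
  have prim: "primitive_on L p (\<lambda>x. y x - (s + of_real (\<mu> x)) * p x)"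
    and int: "(\<lambda>x. of_real (\<mu> x) * p x) absolutely_integrable_on {0..L}"
    using assms by (auto simp: solves_def)
  show p: "p absolutely_integrable_on {0..L}"
    by (rule absolutely_integrable_continuous_real[OF primitive_on_continuous[OF prim]])
  show "y absolutely_integrable_on {0..L}"
    using set_integral_add(1)[OF primitive_on_integrable[OF prim] set_integral_add(1)[OF set_integrable_mult_right[of s, OF p] int]]
    by (simp add: algebra_simps)
qed

text \<open>\<open>K\<close> is a parameter because two values matter: \<open>1\<close> when
  \<open>Re s \<ge> 0\<close>, which gives exactly the bound \<open>1\<close> in
  \<open>solves_nonvanishing\<close>, and \<open>exp (norm s * L)\<close>, which is available for
  every \<open>s\<close>.\<close>

lemma solves_bounds:
  assumes sol: "solves s c y p"
    and K: "\<And>x. x \<in> {0..L} \<Longrightarrow> norm (exp (- (s * of_real x))) \<le> K"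
  defines "R \<equiv> K * (norm c + integral {0..L} (\<lambda>t. norm (y t)))"
  shows "x \<in> {0..L} \<Longrightarrow> norm (p x) \<le> R"
    and "integral {0..L} (\<lambda>x. norm (of_real (\<mu> x) * p x)) \<le> R"
proof -
  note y = solves_integrable(2)[OF sol]
  have ny: "(\<lambda>t. norm (y t)) absolutely_integrable_on {0..L}"
    using absolutely_integrable_norm[OF y] by (simp add: o_def)
  have "0 \<le> K" using K[of 0] L_pos by auto
  have "0 \<le> integral {0..L} (\<lambda>t. norm (y t))"
    by (rule integral_nonneg[OF set_lebesgue_integral_eq_integral(1)[OF ny]]) simp
  then have "0 \<le> R" using \<open>0 \<le> K\<close> by (simp add: R_def)
  show "norm (p x) \<le> R" if "x \<in> {0..L}"
  proof (cases "x = L")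
    case True
    then show ?thesis using solves_end[OF sol] \<open>0 \<le> R\<close> by simp
  next
    case False
    then have x: "x \<in> {0..<L}" using that by simp
    show ?thesis
      unfolding R_def solves_eq_duhamel[OF sol x] by (rule duhamel_dominated(1)[OF y K x])
  qed
  let ?h = "\<lambda>x. if x < L then \<mu> x * duhamel 0 (norm c) (\<lambda>t. norm (y t)) x else 0"
  have h: "?h absolutely_integrable_on {0..L}" "integral {0..L} ?h \<le> norm c + integral {0..L} (\<lambda>t. norm (y t))"
    by (intro duhamel_real_bounds ny; simp)+
  have "(\<lambda>x. of_real (\<mu> x) * p x) absolutely_integrable_on {0..L}"
    using sol by (simp add: solves_def)
  then have "integral {0..L} (\<lambda>x. norm (of_real (\<mu> x) * p x)) \<le> integral {0..L} (\<lambda>x. K * ?h x)"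
  proof (intro integral_le set_lebesgue_integral_eq_integral(1) set_integrable_mult_right h(1))
    show "norm (of_real (\<mu> x) * p x) \<le> K * ?h x" if "x \<in> {0..L}" for x
    proof (cases "x = L")
      case True
      then show ?thesis using solves_end[OF sol] by simp
    next
      case False
      then have x: "x \<in> {0..<L}" using that by simp
      show ?thesis
        unfolding solves_eq_duhamel[OF sol x] by (rule duhamel_dominated(2)[OF y K x])
    qed
  qed (auto dest: absolutely_integrable_norm simp: o_def)
  also have "\<dots> = K * integral {0..L} ?h" by (rule integral_mult_right)
  also have "\<dots> \<le> R" unfolding R_def by (intro mult_left_mono h(2) \<open>0 \<le> K\<close>)
  finally show "integral {0..L} (\<lambda>x. norm (of_real (\<mu> x) * p x)) \<le> R" .
qed

text \<open>Integrate the equation over \<open>[0,L]\<close>: by \<open>solves_end\<close> there is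
  no boundary term at \<open>L\<close>.\<close>

lemma solves_mass:
  assumes sol: "solves s c y p"
  shows "integral {0..L} (\<lambda>x. of_real (\<mu> x) * p x) + s * integral {0..L} p = c + integral {0..L} y"
proof -
  have prim: "primitive_on L p (\<lambda>x. y x - (s + of_real (\<mu> x)) * p x)" and "p 0 = c"
    and int: "(\<lambda>x. of_real (\<mu> x) * p x) absolutely_integrable_on {0..L}"
    using sol by (auto simp: solves_def)
  have "0 = c + integral {0..L} (\<lambda>x. y x - (s + of_real (\<mu> x)) * p x)"
    using primitive_on_eq[OF prim, of L] L_pos solves_end[OF sol] \<open>p 0 = c\<close> by simp
  also have "integral {0..L} (\<lambda>x. y x - (s + of_real (\<mu> x)) * p x) =
      integral {0..L} (\<lambda>x. y x - (s * p x + of_real (\<mu> x) * p x))"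
    by (simp add: algebra_simps)
  also have "\<dots> = integral {0..L} y - (s * integral {0..L} p + integral {0..L} (\<lambda>x. of_real (\<mu> x) * p x))"
  proof -
    note i = solves_integrable[OF sol, THEN set_lebesgue_integral_eq_integral(1)]
      int[THEN set_lebesgue_integral_eq_integral(1)]
    have sp: "(\<lambda>x. s * p x) integrable_on {0..L}" using i(1) by (rule integrable_on_mult_right)
    show ?thesis
      by (simp only: integral_diff[OF i(2) integrable_add[OF sp i(3)]] integral_add[OF sp i(3)] integral_mult_right)
  qed
  finally show ?thesis by (simp add: algebra_simps)
qed

text \<open>Integrating the equation for \<open>y = 0\<close>, \<open>c = 1\<close> gives \<open>s \<integral>p = 1 - \<integral>\<mu>p\<close> with \<open>\<bar>\<integral>\<mu>p\<bar> \<le> 1\<close>,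
  so a zero of \<open>1 + k \<integral>p\<close> would satisfy \<open>\<bar>s + k\<bar> \<le> k\<close>.\<close>

lemma solves_nonvanishing:
  assumes sol: "solves s 1 (\<lambda>x. 0) p" and "0 < k" "0 \<le> Re s" "s \<noteq> 0"
  shows "1 + of_real k * integral {0..L} p \<noteq> 0"
proof
  let ?G = "integral {0..L} (\<lambda>x. of_real (\<mu> x) * p x)"
  assume *: "1 + of_real k * integral {0..L} p = 0"
  have int: "(\<lambda>x. of_real (\<mu> x) * p x) absolutely_integrable_on {0..L}"
    using sol by (simp add: solves_def)
  have "norm ?G \<le> integral {0..L} (\<lambda>x. norm (of_real (\<mu> x) * p x))"
    using int by (intro integral_norm_bound_integral) (auto simp: absolutely_integrable_on_def)
  also have "\<dots> \<le> 1 * (norm (1::complex) + integral {0..L} (\<lambda>t. norm (0::complex)))"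
    using \<open>0 \<le> Re s\<close> by (intro solves_bounds(2)[OF sol]) auto
  finally have G: "norm ?G \<le> 1" by simp
  have mass: "?G + s * integral {0..L} p = 1"
    using solves_mass[OF sol] by simp
  have "s + of_real k = of_real k * ?G"
  proof -
    have "of_real k * integral {0..L} p = - 1" using * by (simp add: eq_neg_iff_add_eq_0 add.commute)
    then have "s * (of_real k * integral {0..L} p) = - s" by simp
    moreover have "of_real k * ?G + s * (of_real k * integral {0..L} p) = of_real k"
      using arg_cong[OF mass, of "\<lambda>z. of_real k * z"] by (simp add: algebra_simps)
    ultimately show ?thesis by (simp add: algebra_simps)
  qed
  \<comment> \<open>The closed disc of radius \<open>k\<close> around \<open>- k\<close> meets the
    half-plane \<open>Re s \<ge> 0\<close> only at \<open>0\<close>.\<close>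
  then have "norm (s + of_real k) \<le> k"
    using G \<open>0 < k\<close> by (simp add: norm_mult mult_left_le)
  then have "(Re s + k)\<^sup>2 + (Im s)\<^sup>2 \<le> k\<^sup>2"
    using power_mono[of "norm (s + of_real k)" k 2] by (simp add: cmod_power2)
  moreover have "k\<^sup>2 \<le> (Re s + k)\<^sup>2"
    using \<open>0 < k\<close> \<open>0 \<le> Re s\<close> by (intro power_mono) auto
  ultimately have "(Im s)\<^sup>2 \<le> 0" "(Re s + k)\<^sup>2 \<le> k\<^sup>2"
    using zero_le_power2[of "Im s"] by linarith+
  then have "Im s = 0" by simp
  have "Re s \<le> 0"
    using \<open>0 < k\<close> power2_le_imp_le[OF \<open>(Re s + k)\<^sup>2 \<le> k\<^sup>2\<close>] by simp
  then show False using \<open>0 \<le> Re s\<close> \<open>Im s = 0\<close> \<open>s \<noteq> 0\<close> by (simp add: complex_eq_iff)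
qed

text \<open>For real \<open>s\<close> the solution is \<open>exp (- expo s)\<close> below
  \<open>L\<close>, hence positive. This holds for either sign of \<open>r\<close> and so handles
  negative eigenvalues, which are out of reach of \<open>solves_nonvanishing\<close>.\<close>

lemma solves_real_pos:
  assumes sol: "solves (of_real r) 1 (\<lambda>x. 0) p"
  shows "\<exists>H>0. integral {0..L} p = of_real H"
proof -
  have eq: "p x = of_real (exp (- expo r x))" if "x \<in> {0..<L}" for x
    using solves_eq_duhamel[OF sol that] by (simp add: duhamel_def expo_def exp_of_real[symmetric])
  note p = solves_integrable(1)[OF sol, THEN set_lebesgue_integral_eq_integral(1)]
  have prim: "primitive_on L p (\<lambda>x. 0 - (of_real r + of_real (\<mu> x)) * p x)"
    using sol by (simp add: solves_def)
  have real: "Im (p x) = 0" "0 \<le> Re (p x)" if "x \<in> {0..L}" for x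
    using eq[of x] solves_end[OF sol] that by (cases "x = L"; auto)+
  have p_eq: "p x = of_real (Re (p x))" if "x \<in> {0..L}" for x
    using real[OF that] by (simp add: complex_eq_iff)
  have cont: "continuous_on {0..L} (\<lambda>x. Re (p x))"
    using primitive_on_continuous[OF prim] by (rule continuous_on_Re)
  then have int: "(\<lambda>x. Re (p x)) integrable_on {0..L}" by (rule integrable_continuous_real)
  have "integral {0..L} p = integral {0..L} (\<lambda>x. complex_of_real (Re (p x)))"
    by (rule integral_cong) (rule p_eq)
  also have "\<dots> = of_real (integral {0..L} (\<lambda>x. Re (p x)))"
    by (rule integral_linear[OF int bounded_linear_of_real, unfolded o_def])
  finally have "integral {0..L} p = of_real (integral {0..L} (\<lambda>x. Re (p x)))" .
  moreover have "integral {0..L} (\<lambda>x. Re (p x)) \<noteq> 0"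
    using integral_eq_0_iff[OF cont L_pos real(2)] eq[of 0] L_pos by (auto dest!: bspec[of _ _ 0])
  moreover have "0 \<le> integral {0..L} (\<lambda>x. Re (p x))"
    using int real(2) by (rule integral_nonneg)
  ultimately show ?thesis by (intro exI[of _ "integral {0..L} (\<lambda>x. Re (p x))"]) auto
qed

end

section \<open>The space \<open>L\<^sup>1\<close>\<close>

lemma l1_rel_rep_abs: "integrable lebesgue f \<Longrightarrow> l1_rel (rep_l1 (abs_l1 f)) f"
  by (rule Quotient3_rep_abs[OF Quotient3_l1]) (simp add: l1_rel_def)

lemma integrable_rep_l1 [simp]: "integrable lebesgue (rep_l1 u)"
  using Quotient3_rep_reflp[OF Quotient3_l1, of u] by (simp add: l1_rel_def)

lemma AE_rep_abs_l1: "integrable lebesgue f \<Longrightarrow> AE x in lebesgue. rep_l1 (abs_l1 f) x = f x"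
  using l1_rel_rep_abs[of f] by (simp add: l1_rel_def)

lemma abs_rep_l1 [simp]: "abs_l1 (rep_l1 u) = u"
  by (rule Quotient3_abs_rep[OF Quotient3_l1])

lemma abs_l1_eqI:
  assumes "integrable lebesgue f" "integrable lebesgue g" "AE x in lebesgue. f x = g x"
  shows "abs_l1 f = abs_l1 g"
  by (rule Quotient3_rel_abs[OF Quotient3_l1]) (use assms in \<open>simp add: l1_rel_def\<close>)

lemma l1_eqI: "AE x in lebesgue. rep_l1 u x = rep_l1 v x \<Longrightarrow> u = v"
  using abs_l1_eqI[of "rep_l1 u" "rep_l1 v"] by simp

lemma AE_rep_plus: "AE x in lebesgue. rep_l1 (u + v) x = rep_l1 u x + rep_l1 v x"
  using AE_rep_abs_l1[of "\<lambda>x. rep_l1 u x + rep_l1 v x"]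
    plus_l1.abs_eq[of "rep_l1 u" "rep_l1 v"] by (simp add: l1_rel_def)

lemma AE_rep_minus: "AE x in lebesgue. rep_l1 (u - v) x = rep_l1 u x - rep_l1 v x"
  using AE_rep_abs_l1[of "\<lambda>x. rep_l1 u x - rep_l1 v x"]
    minus_l1.abs_eq[of "rep_l1 u" "rep_l1 v"] by (simp add: l1_rel_def)

lemma AE_rep_uminus: "AE x in lebesgue. rep_l1 (- u) x = - rep_l1 u x"
  using AE_rep_abs_l1[of "\<lambda>x. - rep_l1 u x"]
    uminus_l1.abs_eq[of "rep_l1 u"] by (simp add: l1_rel_def)

lemma AE_rep_scaleC: "AE x in lebesgue. rep_l1 (c *\<^sub>C u) x = c * rep_l1 u x"
  using AE_rep_abs_l1[of "\<lambda>x. c * rep_l1 u x"]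
    scaleC_l1.abs_eq[of "rep_l1 u" c] by (simp add: l1_rel_def)

lemma AE_rep_zero: "AE x in lebesgue. rep_l1 0 x = 0"
  using AE_rep_abs_l1[of "\<lambda>x. 0"] by (simp add: zero_l1_def)

lemma norm_l1_eq: "norm u = (LINT x|lebesgue. norm (rep_l1 u x))"
  using norm_l1.abs_eq[of "rep_l1 u"] by (simp add: l1_rel_def)

lemma norm_abs_l1: "integrable lebesgue f \<Longrightarrow> norm (abs_l1 f) = (LINT x|lebesgue. norm (f x))"
  using norm_l1.abs_eq[of f] by (simp add: l1_rel_def)

lemma norm_l1_diff: "norm (u - v) = (LINT x|lebesgue. norm (rep_l1 u x - rep_l1 v x))"
  using minus_l1.abs_eq[of "rep_l1 u" "rep_l1 v"] norm_abs_l1[of "\<lambda>x. rep_l1 u x - rep_l1 v x"]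
  by (simp add: l1_rel_def)

section \<open>Completeness of \<open>l1\<close>\<close>

lemma integral_suminf_norm_AE:
  fixes f :: "nat \<Rightarrow> 'a \<Rightarrow> 'b::{banach,second_countable_topology}"
  assumes f: "\<And>k. integrable M (f k)" and sum: "summable (\<lambda>k. LINT x|M. norm (f k x))"
  shows "AE x in M. summable (\<lambda>k. norm (f k x))"
proof -
  have meas: "(\<lambda>x. ennreal (norm (f k x))) \<in> borel_measurable M" for k
    using borel_measurable_integrable[OF f[of k]] by measurable
  have "(\<integral>\<^sup>+x. (\<Sum>k. ennreal (norm (f k x))) \<partial>M) = (\<Sum>k. \<integral>\<^sup>+x. ennreal (norm (f k x)) \<partial>M)"
    by (rule nn_integral_suminf[OF meas])
  also have "\<dots> = (\<Sum>k. ennreal (LINT x|M. norm (f k x)))"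
    using f by (simp add: nn_integral_eq_integral)
  also have "\<dots> \<noteq> \<infinity>"
    using sum by (simp add: suminf_ennreal2)
  finally have "AE x in M. (\<Sum>k. ennreal (norm (f k x))) \<noteq> \<infinity>"
    by (rule nn_integral_PInf_AE[rotated]) (use meas in measurable)
  then show ?thesis
    by eventually_elim (rule summable_suminf_not_top, auto)
qed

text \<open>The Riesz-Fischer argument: the telescoping series converges absolutely almost
  everywhere, and its pointwise sum \<open>h\<close> represents the limit in \<open>l1\<close> by
  dominated convergence.\<close>

lemma l1_summable_limit:
  fixes g :: "nat \<Rightarrow> l1"
  assumes sum: "summable (\<lambda>k. norm (g (Suc k) - g k))"
  shows "\<exists>u. g \<longlonglongrightarrow> u"
proof -
  define f where "f k x = rep_l1 (g (Suc k)) x - rep_l1 (g k) x" for k x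
  have f: "integrable lebesgue (f k)" for k
    unfolding f_def[abs_def] by (intro Bochner_Integration.integrable_diff integrable_rep_l1)
  have sum': "summable (\<lambda>k. LINT x|lebesgue. norm (f k x))"
    using sum by (simp add: norm_l1_diff f_def)
  note ae = integral_suminf_norm_AE[OF f sum']
  define h where "h x = rep_l1 (g 0) x + (\<Sum>k. f k x)" for x
  have "integrable lebesgue (\<lambda>x. \<Sum>k. f k x)"
    by (rule integrable_suminf[OF f ae sum'])
  then have h: "integrable lebesgue h"
    unfolding h_def[abs_def] by (intro Bochner_Integration.integrable_add integrable_rep_l1)
  have "integrable lebesgue (\<lambda>x. \<Sum>k. norm (f k x))"
    by (rule integrable_suminf) (use f ae sum' in auto)
  \<comment> \<open>The factor \<open>2\<close> covers a partial sum and the full series, each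
    bounded by the sum of the norms.\<close>
  then have w: "integrable lebesgue (\<lambda>x. 2 * (\<Sum>k. norm (f k x)))" by simp
  have part: "rep_l1 (g n) x = rep_l1 (g 0) x + (\<Sum>k<n. f k x)" for n x
    by (induction n) (auto simp: f_def)
  have "(\<lambda>n. LINT x|lebesgue. norm (rep_l1 (g n) x - h x)) \<longlonglongrightarrow> (LINT x|(lebesgue :: real measure). (0::real))"
  proof (rule integral_dominated_convergence[where w = "\<lambda>x. 2 * (\<Sum>k. norm (f k x))"])
    show "(\<lambda>x. norm (rep_l1 (g n) x - h x)) \<in> borel_measurable lebesgue" for n
      using h by (intro borel_measurable_norm borel_measurable_diff borel_measurable_integrable) simp_all
    show "AE x in lebesgue. (\<lambda>n. norm (rep_l1 (g n) x - h x)) \<longlonglongrightarrow> 0"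
      using ae
    proof eventually_elim
      case (elim x)
      have "(\<lambda>n. \<Sum>k<n. f k x) \<longlonglongrightarrow> (\<Sum>k. f k x)"
        by (rule summable_LIMSEQ[OF summable_norm_cancel[OF elim]])
      then have "(\<lambda>n. rep_l1 (g 0) x + (\<Sum>k<n. f k x)) \<longlonglongrightarrow> h x"
        unfolding h_def by (intro tendsto_add tendsto_const)
      then have "(\<lambda>n. rep_l1 (g n) x) \<longlonglongrightarrow> h x" by (simp only: part[symmetric])
      then show ?case using tendsto_norm_zero LIM_zero by blast
    qed
    show "AE x in lebesgue. norm (norm (rep_l1 (g n) x - h x)) \<le> 2 * (\<Sum>k. norm (f k x))" for n
      using ae
    proof eventually_elim
      case (elim x)
      have "norm (rep_l1 (g n) x - h x) = norm ((\<Sum>k<n. f k x) - (\<Sum>k. f k x))"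
        unfolding part[of n] h_def by simp
      also have "\<dots> \<le> norm (\<Sum>k<n. f k x) + norm (\<Sum>k. f k x)"
        by (rule norm_triangle_ineq4)
      also have "\<dots> \<le> (\<Sum>k. norm (f k x)) + (\<Sum>k. norm (f k x))"
        by (intro add_mono order_trans[OF norm_sum] sum_le_suminf summable_norm elim) auto
      finally show ?case by simp
    qed
  qed (use w in simp_all)
  moreover have "dist (g n) (abs_l1 h) = (LINT x|lebesgue. norm (rep_l1 (g n) x - h x))" for n
    unfolding dist_norm norm_l1_diff
    using AE_rep_abs_l1[OF h] h
    by (intro integral_cong_AE) (auto elim!: eventually_mono intro!: borel_measurable_integrable integrable_norm)
  ultimately have "(\<lambda>n. dist (g n) (abs_l1 h)) \<longlonglongrightarrow> 0" by simp
  then have "g \<longlonglongrightarrow> abs_l1 h" by (rule tendsto_dist_iff[THEN iffD2])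
  then show ?thesis ..
qed

text \<open>Completeness is what lets total boundedness imply compactness later on. A Cauchy
  sequence has a subsequence with geometrically small steps, to which
  \<open>l1_summable_limit\<close> applies.\<close>

instance l1 :: banach
proof
  fix X :: "nat \<Rightarrow> l1" assume X: "Cauchy X"
  have "\<exists>N. \<forall>m\<ge>N. \<forall>n\<ge>N. norm (X m - X n) < (1/2) ^ k" for k :: nat
    using CauchyD[OF X, of "(1/2) ^ k"] by auto
  then obtain N where N: "\<And>k m n. m \<ge> N k \<Longrightarrow> n \<ge> N k \<Longrightarrow> norm (X m - X n) < (1/2) ^ k"
    by metis
  \<comment> \<open>Summing all thresholds up to \<open>k\<close> makes \<open>r k\<close> at least
    \<open>N k\<close>, and the added \<open>Suc\<close> makes \<open>r\<close> strictly
    increasing.\<close>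
  define r where "r k = (\<Sum>j\<le>k. Suc (N j))" for k
  have r: "strict_mono r"
    unfolding strict_mono_Suc_iff r_def by simp
  have rN: "N k \<le> r k" for k
    by (cases k) (auto simp: r_def)
  have "norm (X (r (Suc k)) - X (r k)) \<le> (1/2) ^ k" for k
    using N[of k "r (Suc k)" "r k"] rN[of k] strict_monoD[OF r, of k "Suc k"] by simp
  then have "summable (\<lambda>k. norm (X (r (Suc k)) - X (r k)))"
    by (intro summable_comparison_test'[OF summable_geometric[of "1/2 :: real"]]) auto
  then obtain u where "(\<lambda>k. X (r k)) \<longlonglongrightarrow> u"
    using l1_summable_limit[of "\<lambda>k. X (r k)"] by auto
  then have "(X \<circ> r) \<longlonglongrightarrow> u" by (simp add: o_def)
  with X r have "X \<longlonglongrightarrow> u" by (rule Cauchy_converges_subseq)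
  then show "convergent X" by (rule convergentI)
qed

section \<open>The subspace \<open>L1 L\<close> and integrals over \<open>(0,L)\<close>\<close>

lemma AE_not_endpoint: "AE x in lebesgue. x \<noteq> (a::real)"
  by (rule AE_completion) (rule AE_lborel_singleton)

lemma absolutely_integrable_rep_l1: "S \<in> sets lebesgue \<Longrightarrow> rep_l1 u absolutely_integrable_on S"
  unfolding set_integrable_def by (rule integrable_mult_indicator[OF _ integrable_rep_l1])

lemma absolutely_integrable_Ioo:
  fixes f :: "real \<Rightarrow> 'a::euclidean_space"
  shows "f absolutely_integrable_on {a..b} \<Longrightarrow> f absolutely_integrable_on {a<..<b}"
  by (simp only: absolutely_integrable_on_Icc_iff_Ioo)

lemma integrable_to_L1:
  fixes f :: "real \<Rightarrow> complex"
  shows "f absolutely_integrable_on {0..L} \<Longrightarrow> integrable lebesgue (\<lambda>x. indicator {0<..<L} x *\<^sub>R f x)"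
  by (drule absolutely_integrable_Ioo) (simp add: set_integrable_def)

lemma AE_rep_to_L1:
  "f absolutely_integrable_on {0..L} \<Longrightarrow> AE x in lebesgue. rep_l1 (to_L1 L f) x = indicator {0<..<L} x *\<^sub>R f x"
  unfolding to_L1_def by (rule AE_rep_abs_l1[OF integrable_to_L1])

lemma to_L1_in_L1: "f absolutely_integrable_on {0..L} \<Longrightarrow> to_L1 L f \<in> L1 L"
  using AE_rep_to_L1[of L f] by (auto simp: L1_def elim!: eventually_mono)

lemma to_L1_rep: "u \<in> L1 L \<Longrightarrow> to_L1 L (rep_l1 u) = u"
  by (rule l1_eqI, use AE_rep_to_L1[OF absolutely_integrable_rep_l1[of "{0..L}" u]] in \<open>auto simp: L1_def elim!: eventually_elim2\<close>)

lemma to_L1_eqI: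
  assumes f: "f absolutely_integrable_on {0..L}" and g: "g absolutely_integrable_on {0..L}"
    and ae: "AE x in lebesgue. x \<in> {0<..<L} \<longrightarrow> f x = g x"
  shows "to_L1 L f = to_L1 L g"
  unfolding to_L1_def
  by (rule abs_l1_eqI[OF integrable_to_L1[OF f] integrable_to_L1[OF g]])
    (use ae in \<open>auto elim!: eventually_mono split: split_indicator\<close>)

lemma to_L1_eq_rep:
  assumes "f absolutely_integrable_on {0..L}" "u \<in> L1 L" "AE x in lebesgue. x \<in> {0<..<L} \<longrightarrow> rep_l1 u x = f x"
  shows "u = to_L1 L f"
  using to_L1_eqI[OF absolutely_integrable_rep_l1[of "{0..L}" u] assms(1,3)] to_L1_rep[OF assms(2)] by simp

lemma norm_to_L1:
  assumes f: "f absolutely_integrable_on {0..L}"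
  shows "norm (to_L1 L f) = integral {0..L} (\<lambda>x. norm (f x))"
proof -
  have "norm (to_L1 L f) = (LINT x|lebesgue. indicator {0<..<L} x *\<^sub>R norm (f x))"
    unfolding to_L1_def norm_abs_l1[OF integrable_to_L1[OF f]] by simp
  also have "\<dots> = integral {0<..<L} (\<lambda>x. norm (f x))"
    using set_lebesgue_integral_eq_integral(2)[OF absolutely_integrable_norm[OF absolutely_integrable_Ioo[OF f]]]
    by (simp add: set_lebesgue_integral_def o_def)
  finally show ?thesis by (simp add: integral_open_interval_real)
qed

lemma norm_L1: "u \<in> L1 L \<Longrightarrow> norm u = integral {0..L} (\<lambda>x. norm (rep_l1 u x))"
  using norm_to_L1[OF absolutely_integrable_rep_l1[of "{0..L}" u]] to_L1_rep[of u L] by simp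

lemma to_L1_add:
  assumes f: "f absolutely_integrable_on {0..L}" and g: "g absolutely_integrable_on {0..L}"
  shows "to_L1 L (\<lambda>x. f x + g x) = to_L1 L f + to_L1 L g"
  unfolding to_L1_def using integrable_to_L1[OF f] integrable_to_L1[OF g]
  by (simp add: plus_l1.abs_eq l1_rel_def scaleR_right_distrib)

lemma to_L1_diff:
  assumes f: "f absolutely_integrable_on {0..L}" and g: "g absolutely_integrable_on {0..L}"
  shows "to_L1 L (\<lambda>x. f x - g x) = to_L1 L f - to_L1 L g"
  unfolding to_L1_def using integrable_to_L1[OF f] integrable_to_L1[OF g]
  by (simp add: minus_l1.abs_eq l1_rel_def scaleR_right_diff_distrib)

lemma to_L1_cmult:
  assumes f: "f absolutely_integrable_on {0..L}"
  shows "to_L1 L (\<lambda>x. c * f x) = c *\<^sub>C to_L1 L f"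
  unfolding to_L1_def using integrable_to_L1[OF f]
  by (simp add: scaleC_l1.abs_eq l1_rel_def)

lemma L1_subspace:
  shows "0 \<in> L1 L" "u \<in> L1 L \<Longrightarrow> v \<in> L1 L \<Longrightarrow> u + v \<in> L1 L" "u \<in> L1 L \<Longrightarrow> v \<in> L1 L \<Longrightarrow> u - v \<in> L1 L"
    "u \<in> L1 L \<Longrightarrow> - u \<in> L1 L" "u \<in> L1 L \<Longrightarrow> c *\<^sub>C u \<in> L1 L"
proof -
  show "0 \<in> L1 L" using AE_rep_zero by (auto simp: L1_def)
  show "u + v \<in> L1 L" if "u \<in> L1 L" "v \<in> L1 L"
    using AE_rep_plus[of u v] that[unfolded L1_def mem_Collect_eq]
    unfolding L1_def mem_Collect_eq by eventually_elim auto
  show "u - v \<in> L1 L" if "u \<in> L1 L" "v \<in> L1 L"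
    using AE_rep_minus[of u v] that[unfolded L1_def mem_Collect_eq]
    unfolding L1_def mem_Collect_eq by eventually_elim auto
  show "- u \<in> L1 L" if "u \<in> L1 L"
    using AE_rep_uminus[of u] that[unfolded L1_def mem_Collect_eq]
    unfolding L1_def mem_Collect_eq by eventually_elim auto
  show "c *\<^sub>C u \<in> L1 L" if "u \<in> L1 L"
    using AE_rep_scaleC[of c u] that[unfolded L1_def mem_Collect_eq]
    unfolding L1_def mem_Collect_eq by eventually_elim auto
qed

lemma set_lebesgue_integral_Ioo:
  fixes f :: "real \<Rightarrow> 'a::euclidean_space"
  assumes "f absolutely_integrable_on {0..L}"
  shows "(LINT x:{0<..<L}|lebesgue. f x) = integral {0..L} f"
  using set_lebesgue_integral_eq_integral(2)[OF absolutely_integrable_Ioo[OF assms]]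
  by (simp add: integral_open_interval_real)

section \<open>Vanishing almost everywhere, from integrals over intervals\<close>

lemma AE_lebesgue_iff_negligible: "(AE x in lebesgue. P x) \<longleftrightarrow> negligible {x. \<not> P x}"
proof
  assume "AE x in lebesgue. P x"
  then obtain N where "N \<in> null_sets lebesgue" "{x. \<not> P x} \<subseteq> N"
    by (auto simp: eventually_ae_filter)
  then show "negligible {x. \<not> P x}"
    using negligible_iff_null_sets negligible_subset by blast
next
  assume "negligible {x. \<not> P x}"
  then have "{x. \<not> P x} \<in> null_sets lebesgue" by (simp add: negligible_iff_null_sets)
  from AE_not_in[OF this] show "AE x in lebesgue. P x" by simp
qed

text \<open>Sets over which \<open>F\<close> has integral zero are stable under countable disjoint
  unions and, because the total integral vanishes, under complements. So they include all Borel
  sets, and then all Lebesgue sets, which differ from Borel sets by null sets.\<close>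

lemma interval_integrals_zero_imp_AE:
  fixes F :: "real \<Rightarrow> 'b::euclidean_space"
  assumes F: "integrable lebesgue F" and zero: "\<And>a b. a \<le> b \<Longrightarrow> (LINT x:{a..b}|lebesgue. F x) = 0"
  shows "AE x in lebesgue. F x = 0"
proof (rule lebesgue.density_zero[OF F])
  have set_int: "set_integrable lebesgue A F" if "A \<in> sets lebesgue" for A
    unfolding set_integrable_def by (rule integrable_mult_indicator[OF that F])
  have total: "integral\<^sup>L lebesgue F = 0"
  proof -
    have "(\<lambda>n. LINT x:{- real n..real n}|lebesgue. F x) \<longlonglongrightarrow> (LINT x:(\<Union>n. {- real n..real n})|lebesgue. F x)"
      by (rule set_integral_cont_up) (auto simp: incseq_def intro!: set_int)
    moreover have "(\<Union>n. {- real n..real n}) = UNIV"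
    proof -
      have "\<exists>n. - real n \<le> x \<and> x \<le> real n" for x
        using real_arch_simple[of "\<bar>x\<bar>"] by (metis abs_le_iff minus_le_iff)
      then show ?thesis by auto
    qed
    ultimately show ?thesis using LIMSEQ_unique[OF _ tendsto_const] zero by (auto simp: set_lebesgue_integral_def)
  qed
  have borel: "(LINT x:A|lebesgue. F x) = 0" if "A \<in> sets borel" for A :: "real set"
    using that
  proof (induction rule: borel_set_induct)
    case (compl A)
    have "(LINT x:- A|lebesgue. F x) = (LINT x|lebesgue. F x - indicator A x *\<^sub>R F x)"
      unfolding set_lebesgue_integral_def
      by (intro Bochner_Integration.integral_cong) (auto split: split_indicator)
    also have "\<dots> = 0"
      using F set_int[of A] compl total by (subst Bochner_Integration.integral_diff) (auto simp: set_integrable_def set_lebesgue_integral_def)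
    finally show ?case .
  next
    case (union f)
    then have "(LINT x:(\<Union>i. f i)|lebesgue. F x) = (\<Sum>i. LINT x:f i|lebesgue. F x)"
      by (intro lebesgue_integral_countable_add set_int) (auto simp: disjoint_family_on_def)
    then show ?case using union by simp
  qed (auto simp: zero, simp add: set_lebesgue_integral_def)
  show "(LINT x:A|lebesgue. F x) = 0" if "A \<in> sets lebesgue" for A
  proof -
    from that obtain S N N' where A: "A = S \<union> N" "N \<subseteq> N'" "N' \<in> null_sets lborel" "S \<in> sets lborel"
      by (rule sets_completionE)
    have "AE x in lebesgue. x \<notin> N'"
      by (rule AE_completion[OF AE_not_in[OF A(3)]])
    then have "(LINT x:A|lebesgue. F x) = (LINT x:S|lebesgue. F x)"
      unfolding set_lebesgue_integral_def using set_int[OF that] set_int[of S] A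
      by (intro integral_cong_AE) (auto simp: set_integrable_def intro!: borel_measurable_integrable elim!: eventually_mono split: split_indicator)
    then show ?thesis using borel A by simp
  qed
qed

text \<open>Differences of indefinite integrals are integrals over intervals, so the extension of
  \<open>f\<close> by zero falls under the preceding lemma.\<close>

lemma indefinite_integral_zero_imp_AE:
  fixes f :: "real \<Rightarrow> 'b::euclidean_space"
  assumes f: "f absolutely_integrable_on {0..L}" and zero: "\<And>x. x \<in> {0..L} \<Longrightarrow> integral {0..x} f = 0"
  shows "AE x in lebesgue. x \<in> {0<..<L} \<longrightarrow> f x = 0"
proof -
  define F where "F x = indicator {0..L} x *\<^sub>R f x" for x
  have F: "integrable lebesgue F"
    using f by (simp add: set_integrable_def F_def[abs_def])
  have "(LINT x:{a..b}|lebesgue. F x) = 0" if "a \<le> b" for a b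
  proof -
    define a' b' where "a' = max 0 a" and "b' = min L b"
    have "(LINT x:{a..b}|lebesgue. F x) = (LINT x:{a'..b'}|lebesgue. f x)"
      unfolding set_lebesgue_integral_def F_def a'_def b'_def
      by (intro Bochner_Integration.integral_cong) (auto split: split_indicator)
    also have "\<dots> = 0"
    proof (cases "a' \<le> b'")
      case True
      have sub: "f absolutely_integrable_on {a'..b'}"
        using f by (rule absolutely_integrable_on_subinterval) (auto simp: a'_def b'_def)
      have "f absolutely_integrable_on {0..b'}"
        using f by (rule absolutely_integrable_on_subinterval) (auto simp: b'_def)
      then have "f integrable_on {0..b'}" by (rule set_lebesgue_integral_eq_integral(1))
      then have "integral {0..a'} f + integral {a'..b'} f = integral {0..b'} f"
        using True by (intro Henstock_Kurzweil_Integration.integral_combine) (auto simp: a'_def)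
      moreover have "a' \<in> {0..L}" "b' \<in> {0..L}" using True by (auto simp: a'_def b'_def)
      ultimately show ?thesis using set_lebesgue_integral_eq_integral(2)[OF sub] zero by simp
    qed (simp add: set_lebesgue_integral_def)
    finally show ?thesis .
  qed
  then have "AE x in lebesgue. F x = 0" by (rule interval_integrals_zero_imp_AE[OF F])
  then show ?thesis by eventually_elim (auto simp: F_def)
qed

section \<open>Weak derivatives and indefinite integrals\<close>

lemma test_functionD:
  assumes "test_function L \<phi>"
  shows "\<exists>D. (\<forall>x. (\<phi> has_vector_derivative D x) (at x)) \<and> continuous_on UNIV D \<and> deriv \<phi> = D \<and> \<phi> 0 = 0 \<and> \<phi> L = 0"
proof -
  obtain D where D: "\<And>x. (\<phi> has_vector_derivative D x) (at x)" "continuous_on UNIV D"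
    using assms by (auto simp: test_function_def C1_differentiable_on_def)
  moreover have "deriv \<phi> = D"
    using D(1) by (intro ext DERIV_imp_deriv) (simp add: has_real_derivative_iff_has_vector_derivative)
  moreover have "\<phi> 0 = 0" "\<phi> L = 0"
    using assms by (force simp: test_function_def)+
  ultimately show ?thesis by blast
qed

lemma test_function_by_parts:
  fixes P f :: "real \<Rightarrow> complex"
  assumes \<phi>: "test_function L \<phi>" and P: "primitive_on L P f" and "0 \<le> L"
  shows "(\<lambda>x. deriv \<phi> x *\<^sub>R P x) absolutely_integrable_on {0..L}"
    and "(\<lambda>x. \<phi> x *\<^sub>R f x) absolutely_integrable_on {0..L}"
    and "integral {0..L} (\<lambda>x. deriv \<phi> x *\<^sub>R P x) = - integral {0..L} (\<lambda>x. \<phi> x *\<^sub>R f x)"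
proof -
  obtain D where D: "\<And>x. (\<phi> has_vector_derivative D x) (at x)" "continuous_on UNIV D" "deriv \<phi> = D"
    and zero: "\<phi> 0 = 0" "\<phi> L = 0"
    using test_functionD[OF \<phi>] by blast
  have contD: "continuous_on {0..L} (\<lambda>x. complex_of_real (D x))"
    using D(2) by (intro continuous_intros) (rule continuous_on_subset, auto)
  have prim: "primitive_on L (\<lambda>x. complex_of_real (\<phi> x)) (\<lambda>x. of_real (D x))"
    using D(1) contD
    by (intro primitive_on_C1 has_vector_derivative_of_real)
      (simp_all add: has_real_derivative_iff_has_vector_derivative)
  show 1: "(\<lambda>x. deriv \<phi> x *\<^sub>R P x) absolutely_integrable_on {0..L}"
    using absolutely_integrable_continuous_real[OF continuous_on_mult[OF contD primitive_on_continuous[OF P]]]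
    by (simp add: D(3) scaleR_conv_of_real)
  show 2: "(\<lambda>x. \<phi> x *\<^sub>R f x) absolutely_integrable_on {0..L}"
    using absolutely_integrable_continuous_mult[OF primitive_on_continuous[OF prim] primitive_on_integrable[OF P]]
    by (simp add: scaleR_conv_of_real)
  have "0 = integral {0..L} (\<lambda>x. deriv \<phi> x *\<^sub>R P x + \<phi> x *\<^sub>R f x)"
    using primitive_on_eq[OF primitive_on_mult[OF prim P], of L] \<open>0 \<le> L\<close> zero
    by (simp add: D(3) scaleR_conv_of_real)
  also have "\<dots> = integral {0..L} (\<lambda>x. deriv \<phi> x *\<^sub>R P x) + integral {0..L} (\<lambda>x. \<phi> x *\<^sub>R f x)"
    by (intro integral_add set_lebesgue_integral_eq_integral(1) 1 2)
  finally show "integral {0..L} (\<lambda>x. deriv \<phi> x *\<^sub>R P x) = - integral {0..L} (\<lambda>x. \<phi> x *\<^sub>R f x)"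
    by (simp add: eq_neg_iff_add_eq_0)
qed

text \<open>The indefinite integral of \<open>\<psi>\<close> vanishes left of \<open>a\<close> by
  the support condition, and right of \<open>b\<close> because the total integral is zero.\<close>

lemma ex_test_function_deriv:
  fixes \<psi> :: "real \<Rightarrow> real"
  assumes cont: "continuous_on UNIV \<psi>" and ab: "0 < a" "b < L" "0 \<le> L"
    and supp: "\<And>x. x \<notin> {a..b} \<Longrightarrow> \<psi> x = 0" and zero: "integral {0..L} \<psi> = 0"
  shows "\<exists>\<phi>. test_function L \<phi> \<and> deriv \<phi> = \<psi>"
proof -
  define \<phi> where "\<phi> x = integral {0..x} \<psi>" for x
  have int: "\<psi> integrable_on {x..y}" for x y
    by (rule integrable_continuous_real[OF continuous_on_subset[OF cont]]) simp
  have low: "\<phi> x = 0" if "x < a" for x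
    unfolding \<phi>_def using that by (intro integral_eq_0_iff[THEN iffD2] integral_unique has_integral_is_0 supp) auto
  have high: "\<phi> x = 0" if "b < x" "a \<le> x" for x
  proof -
    \<comment> \<open>\<open>x\<close> may lie on either side of \<open>L\<close>; the maximum lets
      the integrals up to \<open>x\<close> and up to \<open>L\<close> be extended to a common end
      point.\<close>
    have "integral {x..max x L} \<psi> = 0" "integral {L..max x L} \<psi> = 0"
      using that ab by (auto intro!: integral_unique has_integral_is_0 supp)
    moreover have "integral {0..x} \<psi> + integral {x..max x L} \<psi> = integral {0..max x L} \<psi>"
      using that ab int by (intro Henstock_Kurzweil_Integration.integral_combine) auto
    moreover have "integral {0..L} \<psi> + integral {L..max x L} \<psi> = integral {0..max x L} \<psi>"
      using that ab int by (intro Henstock_Kurzweil_Integration.integral_combine) auto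
    ultimately show ?thesis using zero by (simp add: \<phi>_def)
  qed
  have deriv: "(\<phi> has_vector_derivative \<psi> x) (at x)" for x
  proof (cases "x < a")
    case True
    have "((\<lambda>x. 0) has_vector_derivative 0) (at x)" by simp
    then have "(\<phi> has_vector_derivative 0) (at x)"
      by (rule has_vector_derivative_transform_within_open[where S = "{..<a}"]) (use True low in auto)
    then show ?thesis using True supp[of x] by simp
  next
    case False
    have "((\<lambda>u. integral {0..u} \<psi>) has_vector_derivative \<psi> x) (at x within {0..x + 1})"
      by (rule integral_has_vector_derivative[OF continuous_on_subset[OF cont]]) (use False ab in auto)
    then show ?thesis
      using False ab at_within_interior[of x "{0..x + 1}"] by (simp add: \<phi>_def[abs_def])
  qed
  have "test_function L \<phi>"
    unfolding test_function_def C1_differentiable_on_def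
  proof (intro conjI exI ballI allI impI)
    show "(\<phi> has_vector_derivative \<psi> x) (at x)" for x by (rule deriv)
    show "continuous_on UNIV \<psi>" by (rule cont)
    show "compact {a..b}" by simp
    show "{a..b} \<subseteq> {0<..<L}" using ab by auto
    show "\<phi> x = 0" if "x \<notin> {a..b}" for x
      using low[of x] high[of x] that by (cases "x < a") auto
  qed
  moreover have "deriv \<phi> = \<psi>"
    using deriv by (intro ext DERIV_imp_deriv) (simp add: has_real_derivative_iff_has_vector_derivative)
  ultimately show ?thesis by blast
qed

text \<open>For \<open>n > 0\<close> a trapezoid: \<open>0\<close> wherever the smaller of
  \<open>t\<close> and \<open>b - t\<close> is at most \<open>1 / n\<close>, and \<open>1\<close>
  wherever it is at least \<open>2 / n\<close>. Continuity is enough, since combinations of bumps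
  serve as derivatives of test functions, which are only required to be continuously
  differentiable.\<close>

definition bump :: "nat \<Rightarrow> real \<Rightarrow> real \<Rightarrow> real" where
  "bump n b t = max 0 (min 1 (real n * min t (b - t) - 1))"

lemma continuous_on_bump: "continuous_on S (bump n b)"
  unfolding bump_def by (intro continuous_intros)

lemma bump_bounds: "0 \<le> bump n b t" "bump n b t \<le> 1"
  by (auto simp: bump_def)

lemma bump_eq_0:
  assumes "0 < n" "n \<le> m" "b \<le> L" "t \<notin> {1 / real m..L - 1 / real m}"
  shows "bump n b t = 0"
proof -
  have "1 / real m \<le> 1 / real n" using assms(1,2) by (intro divide_left_mono) auto
  then have "t \<le> 1 / real n \<or> b - t \<le> 1 / real n" using assms(3,4) by auto
  then have "min t (b - t) \<le> 1 / real n" by linarith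
  then have "real n * min t (b - t) \<le> 1" using assms(1) by (simp add: field_simps)
  then show ?thesis by (simp add: bump_def)
qed

lemma bump_tendsto: "(\<lambda>n. bump n b t) \<longlonglongrightarrow> (if t \<in> {0<..<b} then 1 else 0)"
proof (cases "t \<in> {0<..<b}")
  case True
  then have pos: "min t (b - t) > 0" by auto
  then have "filterlim (\<lambda>n. real n * min t (b - t)) at_top sequentially"
    using filterlim_real_sequentially by (rule filterlim_tendsto_pos_mult_at_top[OF tendsto_const, where c = "min t (b - t)", unfolded mult.commute[of "min t (b - t)"]])
  then have "eventually (\<lambda>n. real n * min t (b - t) \<ge> 2) sequentially"
    by (simp add: filterlim_at_top)
  then have "eventually (\<lambda>n. bump n b t = 1) sequentially"
    by eventually_elim (simp add: bump_def)
  then show ?thesis using True by (simp add: tendsto_eventually)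
next
  case False
  then have "min t (b - t) \<le> 0" by auto
  then have "real n * min t (b - t) \<le> 0" for n by (simp add: mult_nonneg_nonpos)
  then have "min 1 (real n * min t (b - t) - 1) \<le> 0" for n by (smt (verit))
  then have "bump n b t = 0" for n unfolding bump_def by (rule max_absorb1)
  then have "(\<lambda>n. bump n b t) \<longlonglongrightarrow> 0" by simp
  then show ?thesis unfolding if_not_P[OF False] .
qed

text \<open>The lemma of du Bois-Reymond: \<open>w = u - \<integral> v\<close> is orthogonal to all continuous \<open>\<psi>\<close> of compact support
  with \<open>\<integral> \<psi> = 0\<close>, because these are the derivatives of test functions; correcting bump functions by a
  multiple of a fixed one shows that \<open>w\<close> is constant.\<close>

lemma weak_deriv_imp_primitive:
  assumes "0 < L" and weak: "is_weak_deriv L u v"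
  shows "\<exists>p. primitive_on L p (rep_l1 v) \<and> (AE x in lebesgue. x \<in> {0<..<L} \<longrightarrow> rep_l1 u x = p x)"
proof -
  define V where "V x = 0 + integral {0..x} (rep_l1 v)" for x
  have V: "primitive_on L V (rep_l1 v)"
    unfolding V_def[abs_def] by (intro primitive_on_integral absolutely_integrable_rep_l1) simp
  note contV = primitive_on_continuous[OF V]
  define w where "w x = rep_l1 u x - V x" for x
  have w: "w absolutely_integrable_on {0..L}"
    unfolding w_def[abs_def]
    by (intro set_integral_diff(1) absolutely_integrable_rep_l1 absolutely_integrable_continuous_real contV) simp
  have scaleR_int: "(\<lambda>x. \<psi> x *\<^sub>R g x) absolutely_integrable_on {0..L}"
    if "continuous_on {0..L} \<psi>" "g absolutely_integrable_on {0..L}" for \<psi> :: "real \<Rightarrow> real" and g :: "real \<Rightarrow> complex"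
    using absolutely_integrable_continuous_mult[of 0 L "\<lambda>x. of_real (\<psi> x)" g] that
    by (simp add: scaleR_conv_of_real continuous_on_of_real)
  have orth: "integral {0..L} (\<lambda>x. \<psi> x *\<^sub>R w x) = 0"
    if cont: "continuous_on UNIV \<psi>" and ab: "0 < a" "b < L"
      and supp: "\<And>x. x \<notin> {a..b} \<Longrightarrow> \<psi> x = 0" and zero: "integral {0..L} \<psi> = 0" for \<psi> :: "real \<Rightarrow> real" and a b
  proof -
    obtain \<phi> where \<phi>: "test_function L \<phi>" "deriv \<phi> = \<psi>"
      using ex_test_function_deriv[OF cont ab _ supp zero] \<open>0 < L\<close> by auto
    note parts = test_function_by_parts[OF \<phi>(1) V, unfolded \<phi>(2)]
    have \<psi>u: "(\<lambda>x. \<psi> x *\<^sub>R rep_l1 u x) absolutely_integrable_on {0..L}"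
      using continuous_on_subset[OF cont] by (intro scaleR_int absolutely_integrable_rep_l1) auto
    have "integral {0..L} (\<lambda>x. \<psi> x *\<^sub>R rep_l1 u x) = - integral {0..L} (\<lambda>x. \<phi> x *\<^sub>R rep_l1 v x)"
      using weak \<phi> set_lebesgue_integral_Ioo[OF \<psi>u] set_lebesgue_integral_Ioo[OF parts(2)] \<open>0 < L\<close>
      by (auto simp: is_weak_deriv_def)
    then have "integral {0..L} (\<lambda>x. \<psi> x *\<^sub>R rep_l1 u x) = integral {0..L} (\<lambda>x. \<psi> x *\<^sub>R V x)"
      using parts(3) \<open>0 < L\<close> by simp
    moreover have "integral {0..L} (\<lambda>x. \<psi> x *\<^sub>R rep_l1 u x - \<psi> x *\<^sub>R V x) =
        integral {0..L} (\<lambda>x. \<psi> x *\<^sub>R rep_l1 u x) - integral {0..L} (\<lambda>x. \<psi> x *\<^sub>R V x)"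
      using \<psi>u parts(1) \<open>0 < L\<close> by (intro integral_diff set_lebesgue_integral_eq_integral(1)) auto
    ultimately show ?thesis by (simp add: w_def scaleR_right_diff_distrib)
  qed
  \<comment> \<open>With \<open>4 / L < n0\<close> the midpoint satisfies
    \<open>L / 2 > 2 / n0\<close>, so the reference bump is \<open>1\<close> there and its integral
    \<open>I0\<close> is nonzero.\<close>
  obtain n0 :: nat where n0: "4 / L < real n0" using reals_Archimedean2 by blast
  then have "0 < n0" using \<open>0 < L\<close> by (metis divide_pos_pos less_trans of_nat_0_less_iff zero_less_numeral)
  define \<psi>0 where "\<psi>0 = bump n0 L"
  define I0 where "I0 = integral {0..L} \<psi>0"
  have int_bump: "bump n b integrable_on {0..L}" for n b
    by (rule integrable_continuous_real[OF continuous_on_bump])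
  have "\<psi>0 (L / 2) \<noteq> 0"
  proof -
    have "real n0 * (L / 2) > 2" using n0 \<open>0 < L\<close> by (simp add: field_simps)
    then show ?thesis by (simp add: \<psi>0_def bump_def)
  qed
  then have "I0 \<noteq> 0"
    using integral_eq_0_iff[of 0 L \<psi>0] continuous_on_bump bump_bounds \<open>0 < L\<close>
    unfolding I0_def \<psi>0_def by (metis atLeastAtMost_iff divide_nonneg_nonneg field_sum_of_halves less_eq_real_def less_add_same_cancel2 linorder_not_less zero_le_numeral)
  \<comment> \<open>The only candidate for the constant: the mean of \<open>w\<close> weighted by
    \<open>\<psi>0\<close>.\<close>
  define c where "c = integral {0..L} (\<lambda>x. \<psi>0 x *\<^sub>R w x) /\<^sub>R I0"
  have wc: "(\<lambda>x. w x - c) absolutely_integrable_on {0..L}"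
    by (intro set_integral_diff(1) w absolutely_integrable_continuous_real continuous_intros)
  have bump_zero: "integral {0..L} (\<lambda>x. bump n b x *\<^sub>R (w x - c)) = 0" if "0 < n" "b \<le> L" for n b
  proof -
    \<comment> \<open>\<open>k\<close> gives the corrected bump integral zero; \<open>m\<close>
      provides one compact interval inside \<open>(0,L)\<close> outside which both bumps
      vanish.\<close>
    define k where "k = integral {0..L} (bump n b) / I0"
    define m where "m = max n n0"
    have m: "0 < m" "n \<le> m" "n0 \<le> m" using that by (auto simp: m_def)
    have "integral {0..L} (\<lambda>x. (bump n b x - k * \<psi>0 x) *\<^sub>R w x) = 0"
    proof (rule orth)
      show "continuous_on UNIV (\<lambda>x. bump n b x - k * \<psi>0 x)"
        unfolding \<psi>0_def by (intro continuous_intros continuous_on_bump)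
      show "0 < 1 / real m" "L - 1 / real m < L" using m by auto
      show "bump n b x - k * \<psi>0 x = 0" if "x \<notin> {1 / real m..L - 1 / real m}" for x
        using bump_eq_0[OF \<open>0 < n\<close> m(2) \<open>b \<le> L\<close> that] bump_eq_0[OF \<open>0 < n0\<close> m(3) order_refl that]
        by (simp add: \<psi>0_def)
      show "integral {0..L} (\<lambda>x. bump n b x - k * \<psi>0 x) = 0"
      proof -
        have "(\<lambda>x. k * \<psi>0 x) integrable_on {0..L}"
          unfolding \<psi>0_def by (rule integrable_on_mult_right[OF int_bump])
        from integral_diff[OF int_bump this, of n b]
        have "integral {0..L} (\<lambda>x. bump n b x - k * \<psi>0 x) = integral {0..L} (bump n b) - k * I0"
          by (simp only: integral_mult_right I0_def)
        then show ?thesis using \<open>I0 \<noteq> 0\<close> by (simp add: k_def)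
      qed
    qed
    moreover have "integral {0..L} (\<lambda>x. (bump n b x - k * \<psi>0 x) *\<^sub>R w x) =
        integral {0..L} (\<lambda>x. bump n b x *\<^sub>R w x) - k *\<^sub>R integral {0..L} (\<lambda>x. \<psi>0 x *\<^sub>R w x)"
    proof -
      have i: "(\<lambda>x. bump n b x *\<^sub>R w x) integrable_on {0..L}" "(\<lambda>x. \<psi>0 x *\<^sub>R w x) integrable_on {0..L}"
        unfolding \<psi>0_def by (intro set_lebesgue_integral_eq_integral(1) scaleR_int continuous_on_bump w)+
      have "integral {0..L} (\<lambda>x. bump n b x *\<^sub>R w x - k *\<^sub>R (\<psi>0 x *\<^sub>R w x)) =
          integral {0..L} (\<lambda>x. bump n b x *\<^sub>R w x) - k *\<^sub>R integral {0..L} (\<lambda>x. \<psi>0 x *\<^sub>R w x)"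
        by (simp only: integral_diff[OF i(1) integrable_cmul[OF i(2)]] integral_cmul)
      then show ?thesis by (simp add: scaleR_left_diff_distrib)
    qed
    moreover have "k *\<^sub>R integral {0..L} (\<lambda>x. \<psi>0 x *\<^sub>R w x) = integral {0..L} (bump n b) *\<^sub>R c"
      by (simp add: k_def c_def divide_inverse)
    moreover have "integral {0..L} (\<lambda>x. bump n b x *\<^sub>R (w x - c)) =
        integral {0..L} (\<lambda>x. bump n b x *\<^sub>R w x) - integral {0..L} (bump n b) *\<^sub>R c"
    proof -
      have "(\<lambda>x. bump n b x *\<^sub>R w x) integrable_on {0..L}"
        by (intro set_lebesgue_integral_eq_integral(1) scaleR_int continuous_on_bump w)
      moreover have "((\<lambda>x. bump n b x *\<^sub>R c) has_integral (integral {0..L} (bump n b) *\<^sub>R c)) {0..L}"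
        using int_bump by (intro has_integral_scaleR_left integrable_integral)
      ultimately show ?thesis
        using integral_diff[of "\<lambda>x. bump n b x *\<^sub>R w x" "{0..L}" "\<lambda>x. bump n b x *\<^sub>R c"]
        by (simp add: scaleR_right_diff_distrib integral_unique has_integral_integrable)
    qed
    ultimately show ?thesis by simp
  qed
  have "AE x in lebesgue. x \<in> {0<..<L} \<longrightarrow> w x - c = 0"
  proof (rule indefinite_integral_zero_imp_AE[OF wc])
    fix b assume b: "b \<in> {0..L}"
    \<comment> \<open>As \<open>n\<close> grows the bumps tend to the indicator of
      \<open>(0,b)\<close>, so the indefinite integral of \<open>w - c\<close> vanishes at
      \<open>b\<close>.\<close>
    let ?g = "\<lambda>t. if t \<in> {0<..<b} then w t - c else 0"
    have "(\<lambda>n. integral {0..L} (\<lambda>t. bump (Suc n) b t *\<^sub>R (w t - c))) \<longlonglongrightarrow> integral {0..L} ?g"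
    proof (rule dominated_convergence(2)[where h = "\<lambda>t. norm (w t - c)"])
      show "(\<lambda>t. bump (Suc n) b t *\<^sub>R (w t - c)) integrable_on {0..L}" for n
        by (intro set_lebesgue_integral_eq_integral(1) scaleR_int continuous_on_bump wc)
      show "(\<lambda>t. norm (w t - c)) integrable_on {0..L}"
        using set_lebesgue_integral_eq_integral(1)[OF absolutely_integrable_norm[OF wc]] by (simp add: o_def)
      show "norm (bump (Suc n) b t *\<^sub>R (w t - c)) \<le> norm (w t - c)" for n t
        using mult_right_mono[OF bump_bounds(2) norm_ge_zero] bump_bounds(1) by (simp add: abs_of_nonneg)
      show "(\<lambda>n. bump (Suc n) b t *\<^sub>R (w t - c)) \<longlonglongrightarrow> ?g t" for t
        using tendsto_scaleR[OF LIMSEQ_Suc[OF bump_tendsto[of b t]] tendsto_const[of "w t - c"]]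
        by (cases "t \<in> {0<..<b}") (simp_all only: if_True if_False scaleR_one scaleR_zero_left)
    qed
    then have "integral {0..L} ?g = 0"
      using bump_zero[of _ b] b by (simp add: LIMSEQ_const_iff)
    moreover have "{0<..<b} \<inter> {0..L} = {0<..<b}" using b by auto
    ultimately show "integral {0..b} (\<lambda>x. w x - c) = 0"
      by (simp only: integral_restrict_Int integral_open_interval_real)
  qed
  then have "AE x in lebesgue. x \<in> {0<..<L} \<longrightarrow> rep_l1 u x = c + V x"
    by eventually_elim (auto simp: w_def algebra_simps)
  moreover have "primitive_on L (\<lambda>x. c + V x) (rep_l1 v)"
    using primitive_on_add[OF primitive_on_const V, of c] by simp
  ultimately show ?thesis by blast
qed

section \<open>\<open>W11\<close> as the space of indefinite integrals\<close>

lemma primitive_imp_weak_deriv: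
  assumes "0 < L" and p: "primitive_on L p (rep_l1 v)"
    and u: "AE x in lebesgue. x \<in> {0<..<L} \<longrightarrow> rep_l1 u x = p x"
  shows "is_weak_deriv L u v"
  unfolding is_weak_deriv_def
proof (intro allI impI)
  fix \<phi> assume \<phi>: "test_function L \<phi>"
  note parts = test_function_by_parts[OF \<phi> p less_imp_le[OF \<open>0 < L\<close>]]
  obtain D where D: "continuous_on UNIV D" "deriv \<phi> = D"
    using test_functionD[OF \<phi>] by blast
  have Du: "(\<lambda>x. deriv \<phi> x *\<^sub>R rep_l1 u x) absolutely_integrable_on {0..L}"
    using continuous_on_subset[OF D(1)] unfolding D(2) scaleR_conv_of_real
    by (intro absolutely_integrable_continuous_mult continuous_on_of_real absolutely_integrable_rep_l1) auto
  have "(LINT x:{0<..<L}|lebesgue. deriv \<phi> x *\<^sub>R rep_l1 u x) = (LINT x:{0<..<L}|lebesgue. deriv \<phi> x *\<^sub>R p x)"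
    unfolding set_lebesgue_integral_def
  proof (rule integral_cong_AE)
    show "AE x in lebesgue. indicator {0<..<L} x *\<^sub>R deriv \<phi> x *\<^sub>R rep_l1 u x =
        indicator {0<..<L} x *\<^sub>R deriv \<phi> x *\<^sub>R p x"
      using u by eventually_elim (auto split: split_indicator)
  qed (rule borel_measurable_integrable[OF absolutely_integrable_Ioo[OF Du, unfolded set_integrable_def]],
      rule borel_measurable_integrable[OF absolutely_integrable_Ioo[OF parts(1), unfolded set_integrable_def]])
  then show "(LINT x:{0<..<L}|lebesgue. deriv \<phi> x *\<^sub>R rep_l1 u x) = - (LINT x:{0<..<L}|lebesgue. \<phi> x *\<^sub>R rep_l1 v x)"
    using parts by (simp add: set_lebesgue_integral_Ioo)
qed

text \<open>A continuous function whose norm integrates to zero vanishes everywhere, end points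
  included. This makes \<open>trace0\<close> well defined.\<close>

lemma continuous_AE_eq:
  fixes f g :: "real \<Rightarrow> complex"
  assumes "0 < L" and f: "continuous_on {0..L} f" and g: "continuous_on {0..L} g"
    and ae: "AE x in lebesgue. x \<in> {0<..<L} \<longrightarrow> f x = g x" and x: "x \<in> {0..L}"
  shows "f x = g x"
proof -
  have "continuous_on {0..L} (\<lambda>x. norm (f x - g x))"
    by (intro continuous_intros f g)
  moreover have "integral {0..L} (\<lambda>x. norm (f x - g x)) = 0"
  proof -
    have "AE x in lebesgue. x \<in> {0..L} \<longrightarrow> f x = g x"
      using ae AE_not_endpoint[of 0] AE_not_endpoint[of L] by eventually_elim auto
    then have "negligible {x. \<not> (x \<in> {0..L} \<longrightarrow> f x = g x)}"
      by (simp only: AE_lebesgue_iff_negligible)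
    then have "integral {0..L} (\<lambda>x. norm (f x - g x)) = integral {0..L} (\<lambda>x. 0::real)"
      by (rule integral_spike) auto
    then show ?thesis by simp
  qed
  ultimately have "norm (f x - g x) = 0"
    using integral_eq_0_iff[of 0 L "\<lambda>x. norm (f x - g x)"] \<open>0 < L\<close> x by auto
  then show ?thesis by simp
qed

lemma trace0_eq:
  assumes "0 < L" and p: "continuous_on {0..L} p" and u: "AE x in lebesgue. x \<in> {0<..<L} \<longrightarrow> rep_l1 u x = p x"
  shows "trace0 L u = p 0"
  unfolding trace0_def
proof (rule the_equality)
  show "\<exists>g. continuous_on {0..L} g \<and> (AE x in lebesgue. x \<in> {0<..<L} \<longrightarrow> rep_l1 u x = g x) \<and> g 0 = p 0"
    using p u by blast
  fix c assume "\<exists>g. continuous_on {0..L} g \<and> (AE x in lebesgue. x \<in> {0<..<L} \<longrightarrow> rep_l1 u x = g x) \<and> g 0 = c"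
  then obtain g where g: "continuous_on {0..L} g" "AE x in lebesgue. x \<in> {0<..<L} \<longrightarrow> rep_l1 u x = g x" "g 0 = c"
    by blast
  have "AE x in lebesgue. x \<in> {0<..<L} \<longrightarrow> g x = p x"
    using g(2) u by eventually_elim auto
  from continuous_AE_eq[OF \<open>0 < L\<close> g(1) p this, of 0] show "c = p 0"
    using g(3) \<open>0 < L\<close> by simp
qed

text \<open>Both candidates are densities of a continuous representative of \<open>u\<close>, and
  that representative is unique on \<open>[0,L]\<close>. Equality outside \<open>(0,L)\<close> comes
  from membership in \<open>L1 L\<close>.\<close>

lemma weak_deriv_unique:
  assumes "0 < L" "v \<in> L1 L" "v' \<in> L1 L" "is_weak_deriv L u v" "is_weak_deriv L u v'"
  shows "v = v'"
proof -
  obtain p where p: "primitive_on L p (rep_l1 v)" "AE x in lebesgue. x \<in> {0<..<L} \<longrightarrow> rep_l1 u x = p x"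
    using weak_deriv_imp_primitive assms by blast
  obtain q where q: "primitive_on L q (rep_l1 v')" "AE x in lebesgue. x \<in> {0<..<L} \<longrightarrow> rep_l1 u x = q x"
    using weak_deriv_imp_primitive assms by blast
  have "AE x in lebesgue. x \<in> {0<..<L} \<longrightarrow> p x = q x"
    using p(2) q(2) by eventually_elim auto
  then have eq: "p x = q x" if "x \<in> {0..L}" for x
    using continuous_AE_eq[OF \<open>0 < L\<close> primitive_on_continuous[OF p(1)] primitive_on_continuous[OF q(1)] _ that] by blast
  have "AE x in lebesgue. x \<in> {0<..<L} \<longrightarrow> rep_l1 v x - rep_l1 v' x = 0"
  proof (rule indefinite_integral_zero_imp_AE)
    show "(\<lambda>x. rep_l1 v x - rep_l1 v' x) absolutely_integrable_on {0..L}"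
      by (intro set_integral_diff(1) absolutely_integrable_rep_l1) simp_all
    fix x assume x: "x \<in> {0..L}"
    have "integral {0..x} (\<lambda>x. rep_l1 v x - rep_l1 v' x) = integral {0..x} (rep_l1 v) - integral {0..x} (rep_l1 v')"
      by (intro integral_diff set_lebesgue_integral_eq_integral(1) absolutely_integrable_rep_l1) simp_all
    also have "\<dots> = (p x - p 0) - (q x - q 0)"
      using primitive_on_eq[OF p(1) x] primitive_on_eq[OF q(1) x] by (metis add_diff_cancel_left')
    also have "\<dots> = 0" using eq[OF x] eq[of 0] \<open>0 < L\<close> by simp
    finally show "integral {0..x} (\<lambda>x. rep_l1 v x - rep_l1 v' x) = 0" .
  qed
  then have "AE x in lebesgue. rep_l1 v x = rep_l1 v' x"
    using assms(2,3)[unfolded L1_def mem_Collect_eq] by eventually_elim auto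
  then show ?thesis by (rule l1_eqI)
qed

text \<open>Together with \<open>W11_to_L1\<close> this evaluates the description operators in
  \<open>weak_deriv\<close> and \<open>trace0\<close>, so that the transport equations can be
  treated with \<open>primitive_on\<close> alone.\<close>

lemma W11_D:
  assumes "0 < L" "u \<in> W11 L"
  shows "weak_deriv L u \<in> L1 L"
    and "\<exists>p. primitive_on L p (rep_l1 (weak_deriv L u)) \<and>
      (AE x in lebesgue. x \<in> {0<..<L} \<longrightarrow> rep_l1 u x = p x) \<and> p 0 = trace0 L u"
proof -
  obtain v where v: "v \<in> L1 L" "is_weak_deriv L u v"
    using assms by (auto simp: W11_def)
  have eq: "weak_deriv L u = v"
    unfolding weak_deriv_def by (rule the_equality) (use v weak_deriv_unique[OF \<open>0 < L\<close>] in blast)+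
  show "weak_deriv L u \<in> L1 L" using v eq by simp
  obtain p where p: "primitive_on L p (rep_l1 v)" "AE x in lebesgue. x \<in> {0<..<L} \<longrightarrow> rep_l1 u x = p x"
    using weak_deriv_imp_primitive[OF \<open>0 < L\<close> v(2)] by blast
  then show "\<exists>p. primitive_on L p (rep_l1 (weak_deriv L u)) \<and>
      (AE x in lebesgue. x \<in> {0<..<L} \<longrightarrow> rep_l1 u x = p x) \<and> p 0 = trace0 L u"
    using trace0_eq[OF \<open>0 < L\<close> primitive_on_continuous[OF p(1)] p(2)] eq by auto
qed

lemma W11_to_L1:
  assumes "0 < L" and p: "primitive_on L p f"
  shows "to_L1 L p \<in> W11 L" "weak_deriv L (to_L1 L p) = to_L1 L f" "trace0 L (to_L1 L p) = p 0"
proof -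
  have f: "f absolutely_integrable_on {0..L}" and cont: "continuous_on {0..L} p"
    and pint: "p absolutely_integrable_on {0..L}"
    using primitive_on_integrable[OF p] primitive_on_continuous[OF p] absolutely_integrable_continuous_real by auto
  have u: "AE x in lebesgue. x \<in> {0<..<L} \<longrightarrow> rep_l1 (to_L1 L p) x = p x"
    using AE_rep_to_L1[OF pint] by eventually_elim auto
  have "AE x in lebesgue. x \<in> {0..L} \<longrightarrow> f x = rep_l1 (to_L1 L f) x"
    using AE_rep_to_L1[OF f] AE_not_endpoint[of 0] AE_not_endpoint[of L] by eventually_elim auto
  then have "negligible {x. \<not> (x \<in> {0..L} \<longrightarrow> f x = rep_l1 (to_L1 L f) x)}"
    by (simp only: AE_lebesgue_iff_negligible)
  then have p': "primitive_on L p (rep_l1 (to_L1 L f))"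
    by (rule primitive_on_cong[OF p refl]) auto
  note weak = primitive_imp_weak_deriv[OF \<open>0 < L\<close> p' u]
  show "to_L1 L p \<in> W11 L"
    using weak to_L1_in_L1[OF pint] to_L1_in_L1[OF f] by (auto simp: W11_def)
  show "weak_deriv L (to_L1 L p) = to_L1 L f"
    unfolding weak_deriv_def
    by (rule the_equality) (use weak to_L1_in_L1[OF f] weak_deriv_unique[OF \<open>0 < L\<close>] in blast)+
  show "trace0 L (to_L1 L p) = p 0"
    by (rule trace0_eq[OF \<open>0 < L\<close> cont u])
qed

section \<open>Compactness of \<open>W\<^sup>1\<^sup>,\<^sup>1\<close> in \<open>L\<^sup>1\<close>\<close>

text \<open>Total boundedness passes from \<open>F\<close> to \<open>S\<close> at the cost of the
  approximation error. The compact set may change with \<open>e\<close>, which permits step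
  functions on finer and finer grids.\<close>

lemma compact_closure_if_approx:
  fixes S :: "'a::complete_space set"
  assumes approx: "\<And>e. e > 0 \<Longrightarrow> \<exists>F. compact F \<and> (\<forall>x\<in>S. \<exists>y\<in>F. dist x y < e)"
  shows "compact (closure S)"
  unfolding compact_eq_totally_bounded
proof (intro conjI allI impI)
  show "complete (closure S)" by (simp add: complete_eq_closed)
  fix e :: real assume "e > 0"
  then have e3: "e / 3 > 0" by simp
  obtain F where F: "compact F" "\<And>x. x \<in> S \<Longrightarrow> \<exists>y\<in>F. dist x y < e / 3"
    using approx[OF e3] by blast
  obtain k where k: "finite k" "F \<subseteq> (\<Union>x\<in>k. ball x (e / 3))"
    using F(1) e3 unfolding compact_eq_totally_bounded by meson
  \<comment> \<open>Closed balls, because their finite union is closed and so contains the closure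
    as well; the last third of \<open>e\<close> makes room for open balls.\<close>
  have "S \<subseteq> (\<Union>x\<in>k. cball x (2 * e / 3))"
  proof
    fix x assume "x \<in> S"
    then obtain y where y: "y \<in> F" "dist x y < e / 3" using F(2) by blast
    then obtain z where z: "z \<in> k" "dist z y < e / 3" using k(2) by auto
    have "dist z x \<le> 2 * e / 3" using dist_triangle[of z x y] y z by (simp add: dist_commute)
    then show "x \<in> (\<Union>x\<in>k. cball x (2 * e / 3))" using z by auto
  qed
  then have "closure S \<subseteq> (\<Union>x\<in>k. cball x (2 * e / 3))"
    by (rule closure_minimal) (use k(1) in auto)
  also have "\<dots> \<subseteq> (\<Union>x\<in>k. ball x e)"
    using \<open>e > 0\<close> by (intro UN_mono order_refl) (auto simp: field_simps)
  finally show "\<exists>k. finite k \<and> closure S \<subseteq> (\<Union>x\<in>k. ball x e)" using k(1) by blast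
qed

lemma bounded_linear_scaleC_left: "bounded_linear (\<lambda>z. z *\<^sub>C (e :: 'a::complex_normed_vector))"
proof (rule bounded_linear_intro)
  show "(x + y) *\<^sub>C e = x *\<^sub>C e + y *\<^sub>C e" for x y by (rule scaleC_add_left)
  show "(r *\<^sub>R x) *\<^sub>C e = r *\<^sub>R (x *\<^sub>C e)" for r x
    by (metis scaleC_of_real scaleC_scaleC scaleR_conv_of_real)
  show "norm (x *\<^sub>C e) \<le> norm x * norm e" for x by (simp add: norm_scaleC)
qed

text \<open>A sum of finitely many compact sets, each the continuous image of a closed disc; the
  induction adds one of them at a time.\<close>

lemma compact_bounded_combinations:
  fixes e :: "nat \<Rightarrow> 'a::complex_normed_vector"
  shows "compact {\<Sum>i<n. z i *\<^sub>C e i |z. \<forall>i<n. norm (z i) \<le> B}"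
proof (induction n)
  case (Suc n)
  let ?F = "{\<Sum>i<n. z i *\<^sub>C e i |z. \<forall>i<n. norm (z i) \<le> B}"
  let ?G = "(\<lambda>z. z *\<^sub>C e n) ` cball 0 B"
  have "compact ?G"
    by (intro compact_continuous_image linear_continuous_on bounded_linear_scaleC_left compact_cball)
  then have "compact {a + b |a b. a \<in> ?F \<and> b \<in> ?G}" by (rule compact_sums[OF Suc])
  moreover have "{\<Sum>i<Suc n. z i *\<^sub>C e i |z. \<forall>i<Suc n. norm (z i) \<le> B} = {a + b |a b. a \<in> ?F \<and> b \<in> ?G}"
  proof (intro subset_antisym subsetI)
    fix u assume "u \<in> {\<Sum>i<Suc n. z i *\<^sub>C e i |z. \<forall>i<Suc n. norm (z i) \<le> B}"
    then obtain z where "u = (\<Sum>i<n. z i *\<^sub>C e i) + z n *\<^sub>C e n" "\<forall>i<Suc n. norm (z i) \<le> B" by auto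
    then show "u \<in> {a + b |a b. a \<in> ?F \<and> b \<in> ?G}" by fastforce
  next
    fix u assume "u \<in> {a + b |a b. a \<in> ?F \<and> b \<in> ?G}"
    then obtain z c where u: "u = (\<Sum>i<n. z i *\<^sub>C e i) + c *\<^sub>C e n" "\<forall>i<n. norm (z i) \<le> B" "norm c \<le> B" by auto
    then have "u = (\<Sum>i<Suc n. (z(n := c)) i *\<^sub>C e i)" "\<forall>i<Suc n. norm ((z(n := c)) i) \<le> B"
      by (auto simp: less_Suc_eq)
    then show "u \<in> {\<Sum>i<Suc n. z i *\<^sub>C e i |z. \<forall>i<Suc n. norm (z i) \<le> B}" by blast
  qed
  ultimately show ?case by simp
qed simp

lemma has_integral_indicator_Ico:
  fixes a b L :: real
  assumes "0 \<le> a" "a \<le> b" "b \<le> L"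
  shows "((\<lambda>x. indicat_real {a..<b} x) has_integral (b - a)) {0..L}"
proof -
  have "((\<lambda>x. 1::real) has_integral (b - a)) {a..b}"
    using has_integral_const_real[of "1::real" a b] assms by simp
  then have "((\<lambda>x. if x \<in> {a..b} then 1 else 0) has_integral (b - a)) {0..L}"
    using assms by (subst has_integral_restrict) auto
  then show ?thesis
    by (rule has_integral_spike[OF negligible_sing[of b], rotated]) (auto split: split_indicator)
qed

lemma to_L1_sum:
  assumes "\<And>i. i < (n::nat) \<Longrightarrow> g i absolutely_integrable_on {0..L}"
  shows "(\<lambda>x. \<Sum>i<n. g i x) absolutely_integrable_on {0..L} \<and>
    to_L1 L (\<lambda>x. \<Sum>i<n. g i x) = (\<Sum>i<n. to_L1 L (g i))"
  using assms
proof (induction n)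
  case 0
  have "to_L1 L (\<lambda>x. 0) = 0" by (simp add: to_L1_def zero_l1_def)
  then show ?case by (simp add: set_integrable_def)
next
  case (Suc n)
  then show ?case
    using set_integral_add(1)[of lebesgue "{0..L}" "\<lambda>x. \<Sum>i<n. g i x" "g n"]
      to_L1_add[of L "\<lambda>x. \<Sum>i<n. g i x" "g n"] by simp
qed

text \<open>On each of the \<open>n\<close> cells \<open>p\<close> differs from its value at the
  left node by at most the integral of \<open>norm f\<close> over the cell. Multiplying by the cell
  length \<open>L / n\<close> and summing telescopes to the bound.\<close>

lemma primitive_on_step_approx:
  assumes "0 < L" "0 < n" and p: "primitive_on L p f"
  shows "norm (to_L1 L p - (\<Sum>i<n. p (real i * (L / real n)) *\<^sub>C
      to_L1 L (\<lambda>x. of_real (indicator {real i * (L / real n)..<real (Suc i) * (L / real n)} x))))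
    \<le> L / real n * integral {0..L} (\<lambda>x. norm (f x))"
proof -
  define h where "h = L / real n"
  define t where "t i = real i * h" for i
  have h: "0 < h" "t 0 = 0" "t n = L" using assms by (auto simp: h_def t_def)
  have t_mono: "t i \<le> t j" if "i \<le> j" for i j
    unfolding t_def using that h by (intro mult_right_mono) auto
  have t_mem: "t i \<in> {0..L}" if "i \<le> n" for i
    using t_mono[of 0 i] t_mono[OF that] h by simp
  define I where "I i = {t i..<t (Suc i)}" for i
  define V where "V x = integral {0..x} (\<lambda>x. norm (f x))" for x
  note f = primitive_on_integrable[OF p]
  have nf: "(\<lambda>x. norm (f x)) absolutely_integrable_on {0..L}"
    using absolutely_integrable_norm[OF f] by (simp add: o_def)
  have osc: "norm (p y - p x) \<le> V y - V x" and V_mono: "V x \<le> V y" if xy: "0 \<le> x" "x \<le> y" "y \<le> L" for x y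
  proof -
    have "f absolutely_integrable_on {0..y}" and fxy: "f absolutely_integrable_on {x..y}"
      using f xy by (auto elim: absolutely_integrable_on_subinterval)
    then have int: "f integrable_on {0..y}" "(\<lambda>x. norm (f x)) integrable_on {0..y}"
      "f integrable_on {x..y}" "(\<lambda>x. norm (f x)) integrable_on {x..y}"
      by (auto simp: absolutely_integrable_on_def)
    have "integral {0..x} f + integral {x..y} f = integral {0..y} f"
      using xy int by (intro Henstock_Kurzweil_Integration.integral_combine)
    moreover have "p x = p 0 + integral {0..x} f" "p y = p 0 + integral {0..y} f"
      by (rule primitive_on_eq[OF p]; use xy in simp)+
    ultimately have "p y - p x = integral {x..y} f" by (simp add: algebra_simps)
    moreover have "V x + integral {x..y} (\<lambda>x. norm (f x)) = V y"
      unfolding V_def using xy int by (intro Henstock_Kurzweil_Integration.integral_combine)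
    moreover have "norm (integral {x..y} f) \<le> integral {x..y} (\<lambda>x. norm (f x))"
      using int by (intro integral_norm_bound_integral) auto
    ultimately show "norm (p y - p x) \<le> V y - V x" by simp
    then show "V x \<le> V y" using norm_ge_zero[of "p y - p x"] by linarith
  qed
  define g :: "nat \<Rightarrow> real \<Rightarrow> complex" where "g i x = of_real (indicator (I i) x)" for i x
  have ind: "(indicat_real (I i) has_integral h) {0..L}" if "i < n" for i
    using has_integral_indicator_Ico[of "t i" "t (Suc i)" L] t_mem[of i] t_mem[of "Suc i"] t_mono[of i "Suc i"] that
    by (simp add: I_def t_def algebra_simps)
  have ind_abs: "indicat_real (I i) absolutely_integrable_on {0..L}" if "i < n" for i
    using ind[OF that] by (intro nonnegative_absolutely_integrable_1) auto
  have g: "g i absolutely_integrable_on {0..L}" if "i < n" for i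
    unfolding g_def[abs_def] using absolutely_integrable_linear[OF ind_abs[OF that] bounded_linear_of_real]
    by (simp add: o_def)
  have cg: "(\<lambda>x. p (t i) * g i x) absolutely_integrable_on {0..L}" if "i < n" for i
    by (rule set_integrable_mult_right) (use g[OF that] in simp)
  note sums = to_L1_sum[OF cg]
  have pint: "p absolutely_integrable_on {0..L}"
    by (rule absolutely_integrable_continuous_real[OF primitive_on_continuous[OF p]])
  have unity: "(\<Sum>i<n. indicat_real (I i) x) = 1" if "0 \<le> x" "x < L" for x
  proof -
    \<comment> \<open>The indicator of a half-open cell is a difference of consecutive terms in
      \<open>i\<close>, so that the sum telescopes.\<close>
    have "indicat_real (I i) x = indicat_real {x<..} (t (Suc i)) - indicat_real {x<..} (t i)" for i
      using t_mono[of i "Suc i"] by (auto simp: I_def split: split_indicator)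
    then have "(\<Sum>i<n. indicat_real (I i) x) = indicat_real {x<..} (t n) - indicat_real {x<..} (t 0)"
      using sum_lessThan_telescope[of "\<lambda>i. indicat_real {x<..} (t i)" n] by simp
    then show ?thesis using that h by simp
  qed
  have "to_L1 L p - (\<Sum>i<n. p (t i) *\<^sub>C to_L1 L (g i)) = to_L1 L (\<lambda>x. p x - (\<Sum>i<n. p (t i) * g i x))"
    using sums pint g by (simp add: to_L1_diff to_L1_cmult)
  then have "norm (to_L1 L p - (\<Sum>i<n. p (t i) *\<^sub>C to_L1 L (g i))) =
      integral {0..L} (\<lambda>x. norm (p x - (\<Sum>i<n. p (t i) * g i x)))"
    using sums by (simp add: norm_to_L1 set_integral_diff(1)[OF pint])
  also have "\<dots> = integral {0..L} (\<lambda>x. if x \<in> {L} then 0 else norm (p x - (\<Sum>i<n. p (t i) * g i x)))"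
    by (rule integral_spike[OF negligible_sing[of L]]) auto
  also have "\<dots> \<le> integral {0..L} (\<lambda>x. \<Sum>i<n. (V (t (Suc i)) - V (t i)) * indicator (I i) x)"
  proof (rule integral_le)
    have "(\<lambda>x. norm (p x - (\<Sum>i<n. p (t i) * g i x))) integrable_on {0..L}"
      using set_integral_diff(1)[OF pint conjunct1[OF sums]] by (auto simp: absolutely_integrable_on_def)
    then show "(\<lambda>x. if x \<in> {L} then 0 else norm (p x - (\<Sum>i<n. p (t i) * g i x))) integrable_on {0..L}"
      by (rule integrable_spike[OF _ negligible_sing[of L]]) auto
    show "(\<lambda>x. \<Sum>i<n. (V (t (Suc i)) - V (t i)) * indicator (I i) x) integrable_on {0..L}"
      using ind by (intro integrable_sum integrable_on_mult_right) (auto intro: has_integral_integrable)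
    fix x assume x: "x \<in> {0..L}"
    show "(if x \<in> {L} then 0 else norm (p x - (\<Sum>i<n. p (t i) * g i x))) \<le> (\<Sum>i<n. (V (t (Suc i)) - V (t i)) * indicator (I i) x)"
    proof (cases "x = L")
      case True
      have "0 \<le> (\<Sum>i<n. (V (t (Suc i)) - V (t i)) * indicator (I i) x)"
        using V_mono t_mono t_mem by (intro sum_nonneg mult_nonneg_nonneg) auto
      then show ?thesis using True by simp
    next
      case False
      then have "p x = p x * of_real (\<Sum>i<n. indicat_real (I i) x)" using unity x by simp
      then have "p x - (\<Sum>i<n. p (t i) * g i x) = (\<Sum>i<n. (p x - p (t i)) * g i x)"
        by (simp add: g_def sum_distrib_left sum_subtractf left_diff_distrib)
      also have "norm \<dots> \<le> (\<Sum>i<n. norm ((p x - p (t i)) * g i x))" by (rule norm_sum)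
      also have "\<dots> \<le> (\<Sum>i<n. (V (t (Suc i)) - V (t i)) * indicator (I i) x)"
      proof (rule sum_mono)
        fix i assume "i \<in> {..<n}"
        then have i: "t i \<in> {0..L}" "t (Suc i) \<in> {0..L}"
          using t_mem[of i] t_mem[of "Suc i"] by auto
        show "norm ((p x - p (t i)) * g i x) \<le> (V (t (Suc i)) - V (t i)) * indicator (I i) x"
        proof (cases "x \<in> I i")
          case True
          then have "norm (p x - p (t i)) \<le> V (t (Suc i)) - V (t i)"
            using osc[of "t i" x] V_mono[of x "t (Suc i)"] i by (auto simp: I_def)
          then show ?thesis using True by (simp add: g_def)
        qed (simp add: g_def)
      qed
      finally show ?thesis using False by simp
    qed
  qed
  also have "\<dots> = (\<Sum>i<n. (V (t (Suc i)) - V (t i)) * h)"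
    using ind by (intro integral_unique has_integral_sum has_integral_mult_right) auto
  also have "\<dots> = h * (V (t n) - V (t 0))"
    unfolding sum_distrib_right[symmetric] sum_lessThan_telescope[of "\<lambda>i. V (t i)" n] by (rule mult.commute)
  also have "\<dots> = h * integral {0..L} (\<lambda>x. norm (f x))"
    using h by (simp add: V_def)
  finally show ?thesis
    unfolding g_def I_def t_def h_def .
qed

text \<open>Step functions on a fixed grid with bounded coefficients form a compact set, and the
  approximation error is at most \<open>L * R / n\<close> for all admissible \<open>p\<close> at
  once.\<close>

lemma ex_compact_primitives:
  assumes "0 < L"
  shows "\<exists>K. compact K \<and> K \<subseteq> L1 L \<and>
    (\<forall>p f. primitive_on L p f \<longrightarrow> norm (p 0) \<le> R \<longrightarrow> integral {0..L} (\<lambda>x. norm (f x)) \<le> R \<longrightarrow> to_L1 L p \<in> K)"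
proof -
  define S where "S = {to_L1 L p |p. \<exists>f. primitive_on L p f \<and> norm (p 0) \<le> R \<and> integral {0..L} (\<lambda>x. norm (f x)) \<le> R}"
  have "compact (closure S)"
  proof (rule compact_closure_if_approx)
    fix e :: real assume "e > 0"
    obtain n :: nat where n: "L * R / e < real n" "0 < n"
      using reals_Archimedean2[of "max 0 (L * R / e)"] by auto
    define t where "t i = real i * (L / real n)" for i
    define g where "g i = to_L1 L (\<lambda>x. of_real (indicator {t i..<t (Suc i)} x))" for i
    \<comment> \<open>\<open>2 * R\<close> bounds \<open>norm (p 0)\<close> plus the integral of
      \<open>norm f\<close>, hence \<open>p\<close> at every node.\<close>
    let ?F = "{\<Sum>i<n. z i *\<^sub>C g i |z. \<forall>i<n. norm (z i) \<le> 2 * R}"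
    have "\<exists>y\<in>?F. dist u y < e" if uS: "u \<in> S" for u
    proof -
      obtain p f where u: "u = to_L1 L p" and p: "primitive_on L p f" "norm (p 0) \<le> R" "integral {0..L} (\<lambda>x. norm (f x)) \<le> R"
        using uS unfolding S_def by blast
      have bound: "norm (p (t i)) \<le> 2 * R" if "i < n" for i
      proof -
        have ti: "t i \<in> {0..L}"
          using that \<open>0 < L\<close> by (auto simp: t_def field_simps)
        have "f absolutely_integrable_on {0..t i}"
          using primitive_on_integrable[OF p(1)] by (rule absolutely_integrable_on_subinterval) (use ti in auto)
        then have "norm (integral {0..t i} f) \<le> integral {0..t i} (\<lambda>x. norm (f x))"
          by (intro integral_norm_bound_integral) (auto simp: absolutely_integrable_on_def)
        also have "\<dots> \<le> integral {0..L} (\<lambda>x. norm (f x))"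
          using \<open>f absolutely_integrable_on {0..t i}\<close> primitive_on_integrable[OF p(1)] ti
          by (intro integral_subset_le) (auto simp: absolutely_integrable_on_def)
        finally have "norm (integral {0..t i} f) \<le> R" using p(3) by simp
        then have "norm (p 0 + integral {0..t i} f) \<le> 2 * R"
          using p(2) norm_triangle_ineq[of "p 0" "integral {0..t i} f"] by linarith
        then show ?thesis by (simp only: primitive_on_eq[OF p(1) ti, symmetric])
      qed
      have "dist u (\<Sum>i<n. p (t i) *\<^sub>C g i) \<le> L / real n * integral {0..L} (\<lambda>x. norm (f x))"
        using primitive_on_step_approx[OF \<open>0 < L\<close> n(2) p(1)] by (simp only: u dist_norm g_def t_def)
      also have "\<dots> \<le> L / real n * R" using p(3) \<open>0 < L\<close> by (intro mult_left_mono) auto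
      also have "\<dots> < e" using n \<open>e > 0\<close> by (simp add: field_simps)
      finally have "dist u (\<Sum>i<n. p (t i) *\<^sub>C g i) < e" .
      moreover have "(\<Sum>i<n. p (t i) *\<^sub>C g i) \<in> ?F"
        by (intro CollectI exI[of _ "\<lambda>i. p (t i)"]) (use bound in simp)
      ultimately show ?thesis by (rule bexI)
    qed
    then show "\<exists>F. compact F \<and> (\<forall>u\<in>S. \<exists>y\<in>F. dist u y < e)"
      by (intro exI[of _ ?F] conjI compact_bounded_combinations ballI)
  qed
  \<comment> \<open>Restriction to \<open>(0,L)\<close> is a contraction into \<open>L1 L\<close>
    that fixes the elements of \<open>S\<close>. Passing to the image under it places the compact
    set inside \<open>L1 L\<close>.\<close>
  moreover have "continuous_on (closure S) (\<lambda>u. to_L1 L (rep_l1 u))"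
  proof (rule continuous_on_subset[OF _ subset_UNIV])
    have "dist (to_L1 L (rep_l1 u)) (to_L1 L (rep_l1 v)) \<le> dist u v" for u v
    proof -
      have "dist (to_L1 L (rep_l1 u)) (to_L1 L (rep_l1 v)) = norm (to_L1 L (\<lambda>x. rep_l1 u x - rep_l1 v x))"
        by (simp add: to_L1_diff absolutely_integrable_rep_l1 dist_norm)
      also have "\<dots> = (LINT x|lebesgue. norm (indicator {0<..<L} x *\<^sub>R (rep_l1 u x - rep_l1 v x)))"
        unfolding to_L1_def
        by (intro norm_abs_l1 integrable_to_L1 set_integral_diff(1) absolutely_integrable_rep_l1) simp_all
      also have "\<dots> \<le> (LINT x|lebesgue. norm (rep_l1 u x - rep_l1 v x))"
        by (intro integral_mono integrable_norm integrable_to_L1 set_integral_diff(1) absolutely_integrable_rep_l1)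
          (auto split: split_indicator)
      finally show ?thesis by (simp add: dist_norm norm_l1_diff)
    qed
    then show "continuous_on UNIV (\<lambda>u. to_L1 L (rep_l1 u))"
      unfolding continuous_on_iff by (meson le_less_trans)
  qed
  ultimately have "compact ((\<lambda>u. to_L1 L (rep_l1 u)) ` closure S)"
    by (intro compact_continuous_image)
  moreover have "(\<lambda>u. to_L1 L (rep_l1 u)) ` closure S \<subseteq> L1 L"
    by (auto intro!: to_L1_in_L1 absolutely_integrable_rep_l1)
  moreover have "to_L1 L p \<in> (\<lambda>u. to_L1 L (rep_l1 u)) ` closure S"
    if "primitive_on L p f" "norm (p 0) \<le> R" "integral {0..L} (\<lambda>x. norm (f x)) \<le> R" for p f
  proof -
    have "to_L1 L p \<in> closure S"
      using that closure_subset by (fastforce simp: S_def)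
    moreover have "to_L1 L (rep_l1 (to_L1 L p)) = to_L1 L p"
      by (intro to_L1_rep to_L1_in_L1 absolutely_integrable_continuous_real primitive_on_continuous[OF that(1)])
    ultimately show ?thesis by (metis image_eqI)
  qed
  ultimately show ?thesis by blast
qed

section \<open>Transport equations for classes in \<open>W11 L\<close>\<close>

context repair_rate begin

lemma solves_cong:
  assumes sol: "solves s c y p" and ae: "AE x in lebesgue. x \<in> {0<..<L} \<longrightarrow> y x = z x"
  shows "solves s c z p"
proof -
  have "AE x in lebesgue. x \<in> {0..L} \<longrightarrow> y x = z x"
    using ae AE_not_endpoint[of 0] AE_not_endpoint[of L] by eventually_elim auto
  then have neg: "negligible {x. \<not> (x \<in> {0..L} \<longrightarrow> y x = z x)}"
    by (simp only: AE_lebesgue_iff_negligible)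
  have prim: "primitive_on L p (\<lambda>x. y x - (s + of_real (\<mu> x)) * p x)"
    using sol by (simp add: solves_def)
  have "primitive_on L p (\<lambda>x. z x - (s + of_real (\<mu> x)) * p x)"
    by (rule primitive_on_cong[OF prim refl neg]) auto
  then show ?thesis using sol by (simp add: solves_def)
qed

text \<open>\<open>k\<close> is a constant rate added to \<open>\<mu>\<close>. It only shifts
  \<open>r\<close> to \<open>r + k\<close>, so the rate function itself remains
  \<open>\<mu>\<close>. The first component has \<open>k = lam2\<close>, the second
  \<open>k = 0\<close>.\<close>

lemma solves_of_W11:
  assumes u: "u \<in> W11 L" and \<mu>u: "set_integrable lebesgue {0<..<L} (\<lambda>x. \<mu> x *\<^sub>R rep_l1 u x)"
    and eq: "r *\<^sub>C u + (weak_deriv L u + to_L1 L (\<lambda>x. (\<mu> x + k) *\<^sub>R rep_l1 u x)) = y"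
  shows "\<exists>p. solves (r + of_real k) (trace0 L u) (rep_l1 y) p \<and> u = to_L1 L p"
proof -
  obtain p where p: "primitive_on L p (rep_l1 (weak_deriv L u))"
    and up: "AE x in lebesgue. x \<in> {0<..<L} \<longrightarrow> rep_l1 u x = p x" and p0: "p 0 = trace0 L u"
    using W11_D(2)[OF L_pos u] by blast
  have pint: "p absolutely_integrable_on {0..L}"
    by (rule absolutely_integrable_continuous_real[OF primitive_on_continuous[OF p]])
  have "u \<in> L1 L" using u by (simp add: W11_def)
  then have u_eq: "u = to_L1 L p" by (rule to_L1_eq_rep[OF pint _ up])
  have \<mu>u': "(\<lambda>x. \<mu> x *\<^sub>R rep_l1 u x) absolutely_integrable_on {0..L}"
    using \<mu>u by (simp only: absolutely_integrable_on_Icc_iff_Ioo)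
  have "AE x in lebesgue. x \<in> {0..L} \<longrightarrow> \<mu> x *\<^sub>R rep_l1 u x = of_real (\<mu> x) * p x"
    using up AE_not_endpoint[of 0] AE_not_endpoint[of L] by eventually_elim (auto simp: scaleR_conv_of_real)
  then have "negligible {x. \<not> (x \<in> {0..L} \<longrightarrow> \<mu> x *\<^sub>R rep_l1 u x = of_real (\<mu> x) * p x)}"
    by (simp only: AE_lebesgue_iff_negligible)
  then have \<mu>p: "(\<lambda>x. of_real (\<mu> x) * p x) absolutely_integrable_on {0..L}"
    by (rule absolutely_integrable_spike[OF \<mu>u']) auto
  have "(\<lambda>x. (\<mu> x + k) *\<^sub>R rep_l1 u x) absolutely_integrable_on {0..L}"
    using set_integral_add(1)[OF \<mu>u' set_integrable_scaleR_right[of k, OF absolutely_integrable_rep_l1[of "{0..L}" u]]]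
    by (simp add: scaleR_left_distrib)
  note rep_k = AE_rep_to_L1[OF this]
  have "AE x in lebesgue. x \<in> {0..L} \<longrightarrow>
      rep_l1 (weak_deriv L u) x = rep_l1 y x - (r + of_real k + of_real (\<mu> x)) * p x"
    using AE_rep_plus[of "r *\<^sub>C u" "weak_deriv L u + to_L1 L (\<lambda>x. (\<mu> x + k) *\<^sub>R rep_l1 u x)"]
      AE_rep_plus[of "weak_deriv L u" "to_L1 L (\<lambda>x. (\<mu> x + k) *\<^sub>R rep_l1 u x)"]
      AE_rep_scaleC[of r u] rep_k up AE_not_endpoint[of 0] AE_not_endpoint[of L]
    unfolding eq
    by eventually_elim (auto simp: scaleR_conv_of_real algebra_simps)
  then have neg: "negligible {x. \<not> (x \<in> {0..L} \<longrightarrow>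
      rep_l1 (weak_deriv L u) x = rep_l1 y x - (r + of_real k + of_real (\<mu> x)) * p x)}"
    by (simp only: AE_lebesgue_iff_negligible)
  have "primitive_on L p (\<lambda>x. rep_l1 y x - (r + of_real k + of_real (\<mu> x)) * p x)"
    by (rule primitive_on_cong[OF p refl neg]) auto
  then show ?thesis
    using p0 \<mu>p u_eq by (auto simp: solves_def)
qed

lemma solves_integral_eqs:
  assumes sol: "solves s c y p"
  shows "set_integrable lebesgue {0<..<L} (\<lambda>x. \<mu> x *\<^sub>R rep_l1 (to_L1 L p) x)"
    and "(LINT x:{0<..<L}|lebesgue. \<mu> x *\<^sub>R rep_l1 (to_L1 L p) x) = integral {0..L} (\<lambda>x. of_real (\<mu> x) * p x)"
    and "(LINT x:{0<..<L}|lebesgue. rep_l1 (to_L1 L p) x) = integral {0..L} p"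
    and "AE x in lebesgue. x \<in> {0..L} \<longrightarrow> rep_l1 (to_L1 L p) x = p x"
proof -
  have \<mu>p: "(\<lambda>x. of_real (\<mu> x) * p x) absolutely_integrable_on {0..L}"
    using sol by (simp add: solves_def)
  show ae: "AE x in lebesgue. x \<in> {0..L} \<longrightarrow> rep_l1 (to_L1 L p) x = p x"
    using AE_rep_to_L1[OF solves_integrable(1)[OF sol]] AE_not_endpoint[of 0] AE_not_endpoint[of L]
    by eventually_elim auto
  then have neg: "negligible {x. \<not> (x \<in> {0..L} \<longrightarrow> rep_l1 (to_L1 L p) x = p x)}"
    by (simp only: AE_lebesgue_iff_negligible)
  have int: "(\<lambda>x. \<mu> x *\<^sub>R rep_l1 (to_L1 L p) x) absolutely_integrable_on {0..L}"
    by (rule absolutely_integrable_spike[OF \<mu>p neg]) (auto simp: scaleR_conv_of_real)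
  then show "set_integrable lebesgue {0<..<L} (\<lambda>x. \<mu> x *\<^sub>R rep_l1 (to_L1 L p) x)"
    by (rule absolutely_integrable_Ioo)
  show "(LINT x:{0<..<L}|lebesgue. \<mu> x *\<^sub>R rep_l1 (to_L1 L p) x) = integral {0..L} (\<lambda>x. of_real (\<mu> x) * p x)"
    unfolding set_lebesgue_integral_Ioo[OF int] by (rule integral_spike[OF neg]) (auto simp: scaleR_conv_of_real)
  show "(LINT x:{0<..<L}|lebesgue. rep_l1 (to_L1 L p) x) = integral {0..L} p"
    unfolding set_lebesgue_integral_Ioo[OF absolutely_integrable_rep_l1[of "{0..L}" "to_L1 L p", simplified]]
    by (rule integral_spike[OF neg]) auto
qed

lemma W11_of_solves:
  assumes sol: "solves (r + of_real k) c (rep_l1 y) p" and y: "y \<in> L1 L"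
  shows "to_L1 L p \<in> W11 L" "trace0 L (to_L1 L p) = c"
    "r *\<^sub>C to_L1 L p + (weak_deriv L (to_L1 L p) + to_L1 L (\<lambda>x. (\<mu> x + k) *\<^sub>R rep_l1 (to_L1 L p) x)) = y"
proof -
  let ?f = "\<lambda>x. rep_l1 y x - (r + of_real k + of_real (\<mu> x)) * p x"
  have prim: "primitive_on L p ?f" and p0: "p 0 = c"
    using sol by (auto simp: solves_def)
  note pint = solves_integrable(1)[OF sol]
  note W = W11_to_L1[OF L_pos prim]
  show "to_L1 L p \<in> W11 L" "trace0 L (to_L1 L p) = c" using W p0 by auto
  have \<mu>u: "(\<lambda>x. \<mu> x *\<^sub>R rep_l1 (to_L1 L p) x) absolutely_integrable_on {0..L}"
    using solves_integral_eqs(1)[OF sol] by (simp only: absolutely_integrable_on_Icc_iff_Ioo)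
  have "(\<lambda>x. (\<mu> x + k) *\<^sub>R rep_l1 (to_L1 L p) x) absolutely_integrable_on {0..L}"
    using set_integral_add(1)[OF \<mu>u set_integrable_scaleR_right[of k, OF absolutely_integrable_rep_l1[of "{0..L}" "to_L1 L p"]]]
    by (simp add: scaleR_left_distrib)
  note rep_k = AE_rep_to_L1[OF this]
  let ?u = "to_L1 L p" and ?w = "to_L1 L (\<lambda>x. (\<mu> x + k) *\<^sub>R rep_l1 (to_L1 L p) x)"
  have "AE x in lebesgue. rep_l1 (r *\<^sub>C ?u + (to_L1 L ?f + ?w)) x = rep_l1 y x"
    using AE_rep_plus[of "r *\<^sub>C ?u" "to_L1 L ?f + ?w"] AE_rep_plus[of "to_L1 L ?f" ?w] AE_rep_scaleC[of r ?u]
      rep_k AE_rep_to_L1[OF primitive_on_integrable[OF prim]] AE_rep_to_L1[OF pint] y[unfolded L1_def mem_Collect_eq]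
    by eventually_elim (auto simp: scaleR_conv_of_real algebra_simps split: split_indicator)
  then show "r *\<^sub>C ?u + (weak_deriv L ?u + ?w) = y"
    unfolding W(2) by (rule l1_eqI)
qed

text \<open>Superposition and uniqueness. It isolates the initial value \<open>c\<close>, which in
  the system depends on the still unknown \<open>p\<^sub>0\<close>.\<close>

lemma solves_decompose:
  assumes e: "solves s 1 (\<lambda>x. 0) e" and g: "solves s 0 y g" and p: "solves s c y p"
  shows "to_L1 L p = c *\<^sub>C to_L1 L e + to_L1 L g" "integral {0..L} p = c * integral {0..L} e + integral {0..L} g"
proof -
  have sol: "solves s c y (\<lambda>x. c * e x + g x)"
    using solves_linear[OF e g, of c] by simp
  have eq: "p x = c * e x + g x" if "x \<in> {0..L}" for x
    by (rule solves_unique[OF p sol that])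
  note ints = solves_integrable(1)[OF e] solves_integrable(1)[OF g]
  have "to_L1 L p = to_L1 L (\<lambda>x. c * e x + g x)"
    by (rule to_L1_eqI[OF solves_integrable(1)[OF p] solves_integrable(1)[OF sol]]) (auto simp: eq)
  also have "\<dots> = c *\<^sub>C to_L1 L e + to_L1 L g"
    using ints by (simp add: to_L1_add to_L1_cmult)
  finally show "to_L1 L p = c *\<^sub>C to_L1 L e + to_L1 L g" .
  have "integral {0..L} p = integral {0..L} (\<lambda>x. c * e x + g x)"
    by (rule integral_cong) (rule eq)
  also have "\<dots> = integral {0..L} (\<lambda>x. c * e x) + integral {0..L} g"
    by (rule integral_add[OF integrable_on_mult_right]) (rule set_lebesgue_integral_eq_integral(1), rule ints)+
  finally show "integral {0..L} p = c * integral {0..L} e + integral {0..L} g"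
    by (simp only: integral_mult_right)
qed

lemma solves_L1_bound:
  assumes sol: "solves s c y p"
  shows "norm (to_L1 L p) \<le> L * exp (norm s * L) * (norm c + integral {0..L} (\<lambda>x. norm (y x)))"
    and "norm (integral {0..L} p) \<le> norm (to_L1 L p)"
proof -
  note p = solves_integrable(1)[OF sol]
  have np: "(\<lambda>x. norm (p x)) integrable_on {0..L}"
    using p absolutely_integrable_on_def by blast
  let ?R = "exp (norm s * L) * (norm c + integral {0..L} (\<lambda>x. norm (y x)))"
  have "integral {0..L} (\<lambda>x. norm (p x)) \<le> integral {0..L} (\<lambda>x. ?R)"
    by (rule integral_le[OF np]) (use solves_bounds(1)[OF sol norm_exp_neg_le] in auto)
  then show "norm (to_L1 L p) \<le> L * exp (norm s * L) * (norm c + integral {0..L} (\<lambda>x. norm (y x)))"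
    using L_pos by (simp add: norm_to_L1[OF p] mult_ac)
  show "norm (integral {0..L} p) \<le> norm (to_L1 L p)"
    unfolding norm_to_L1[OF p]
    by (rule integral_norm_bound_integral[OF set_lebesgue_integral_eq_integral(1)[OF p] np]) simp
qed

text \<open>Only the term with \<open>\<mu> p\<close> needs more than the triangle inequality: a
  bound on \<open>p\<close> says nothing about it, and it is controlled through
  \<open>solves_bounds\<close>.\<close>

lemma solves_deriv_bound:
  assumes sol: "solves s c y p"
  shows "integral {0..L} (\<lambda>x. norm (y x - (s + of_real (\<mu> x)) * p x)) \<le>
    integral {0..L} (\<lambda>x. norm (y x)) + norm s * norm (to_L1 L p) +
    exp (norm s * L) * (norm c + integral {0..L} (\<lambda>x. norm (y x)))"
proof -
  note p = solves_integrable(1)[OF sol] and y = solves_integrable(2)[OF sol]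
  have prim: "primitive_on L p (\<lambda>x. y x - (s + of_real (\<mu> x)) * p x)"
    and \<mu>p: "(\<lambda>x. of_real (\<mu> x) * p x) absolutely_integrable_on {0..L}"
    using sol by (auto simp: solves_def)
  have np: "(\<lambda>x. norm (p x)) integrable_on {0..L}" and ny: "(\<lambda>x. norm (y x)) integrable_on {0..L}"
    and n\<mu>p: "(\<lambda>x. norm (of_real (\<mu> x) * p x)) integrable_on {0..L}"
    and nf: "(\<lambda>x. norm (y x - (s + of_real (\<mu> x)) * p x)) integrable_on {0..L}"
    using p y \<mu>p primitive_on_integrable[OF prim] unfolding absolutely_integrable_on_def by auto
  have "integral {0..L} (\<lambda>x. norm (y x - (s + of_real (\<mu> x)) * p x)) \<le>
      integral {0..L} (\<lambda>x. (norm (y x) + norm s * norm (p x)) + norm (of_real (\<mu> x) * p x))"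
  proof (rule integral_le[OF nf integrable_add[OF integrable_add[OF ny integrable_on_mult_right[OF np]] n\<mu>p]])
    fix x
    have eq: "y x - (s + of_real (\<mu> x)) * p x = (y x - s * p x) - of_real (\<mu> x) * p x"
      by (simp add: algebra_simps)
    show "norm (y x - (s + of_real (\<mu> x)) * p x) \<le> (norm (y x) + norm s * norm (p x)) + norm (of_real (\<mu> x) * p x)"
      unfolding eq
      using norm_triangle_ineq4[of "y x - s * p x" "of_real (\<mu> x) * p x"] norm_triangle_ineq4[of "y x" "s * p x"]
      by (simp add: norm_mult)
  qed
  also have "\<dots> = integral {0..L} (\<lambda>x. norm (y x)) + norm s * integral {0..L} (\<lambda>x. norm (p x)) +
      integral {0..L} (\<lambda>x. norm (of_real (\<mu> x) * p x))"
    by (simp only: integral_add[OF integrable_add[OF ny integrable_on_mult_right[OF np]] n\<mu>p]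
        integral_add[OF ny integrable_on_mult_right[OF np]] integral_mult_right)
  also have "\<dots> \<le> integral {0..L} (\<lambda>x. norm (y x)) + norm s * norm (to_L1 L p) +
      exp (norm s * L) * (norm c + integral {0..L} (\<lambda>x. norm (y x)))"
    using solves_bounds(2)[OF sol norm_exp_neg_le] by (simp add: norm_to_L1[OF p])
  finally show ?thesis .
qed

end

lemma set_lebesgue_integral_L1: "norm (LINT x:{0<..<L}|lebesgue. rep_l1 u x) \<le> norm u"
proof -
  have i: "set_integrable lebesgue {0<..<L} (rep_l1 u)"
    by (intro absolutely_integrable_rep_l1) simp
  have "norm (LINT x:{0<..<L}|lebesgue. rep_l1 u x) \<le> (LINT x|lebesgue. norm (indicator {0<..<L} x *\<^sub>R rep_l1 u x))"
    unfolding set_lebesgue_integral_def by (rule integral_norm_bound)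
  also have "\<dots> \<le> norm u"
    unfolding norm_l1_eq
    by (intro integral_mono integrable_norm i[unfolded set_integrable_def] integrable_rep_l1)
      (auto split: split_indicator)
  finally show ?thesis .
qed

text \<open>The three coordinate embeddings are isometries for the sum norm, so the set is a sum of
  three compact sets.\<close>

lemma compact_State:
  assumes "compact A" "compact B" "compact C"
  shows "compact {State a b c |a b c. a \<in> A \<and> b \<in> B \<and> c \<in> C}"
proof -
  have 0: "bounded_linear (\<lambda>a. State a 0 0)"
    by (rule bounded_linear_intro[of _ 1]) (simp_all add: plus_state_def scaleR_state_def norm_state_def)
  have 1: "bounded_linear (\<lambda>b. State 0 b 0)"
    by (rule bounded_linear_intro[of _ 1]) (simp_all add: plus_state_def scaleR_state_def norm_state_def)
  have 2: "bounded_linear (\<lambda>c. State 0 0 c)"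
    by (rule bounded_linear_intro[of _ 1]) (simp_all add: plus_state_def scaleR_state_def norm_state_def)
  let ?AB = "{x + y |x y. x \<in> (\<lambda>a. State a 0 0) ` A \<and> y \<in> (\<lambda>b. State 0 b 0) ` B}"
  have "compact {x + y |x y. x \<in> ?AB \<and> y \<in> (\<lambda>c. State 0 0 c) ` C}"
    using assms by (intro compact_sums compact_continuous_image linear_continuous_on 0 1 2)
  moreover have "{x + y |x y. x \<in> ?AB \<and> y \<in> (\<lambda>c. State 0 0 c) ` C} = {State a b c |a b c. a \<in> A \<and> b \<in> B \<and> c \<in> C}"
  proof (intro set_eqI iffI)
    fix p assume "p \<in> {x + y |x y. x \<in> ?AB \<and> y \<in> (\<lambda>c. State 0 0 c) ` C}"
    then obtain a b c where "a \<in> A" "b \<in> B" "c \<in> C" "p = State a 0 0 + State 0 b 0 + State 0 0 c"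
      by blast
    then show "p \<in> {State a b c |a b c. a \<in> A \<and> b \<in> B \<and> c \<in> C}"
      by (auto simp: plus_state_def)
  next
    fix p assume "p \<in> {State a b c |a b c. a \<in> A \<and> b \<in> B \<and> c \<in> C}"
    then obtain a b c where "a \<in> A" "b \<in> B" "c \<in> C" "p = State a b c" by blast
    moreover from this have "p = State a 0 0 + State 0 b 0 + State 0 0 c"
      by (simp add: plus_state_def)
    ultimately show "p \<in> {x + y |x y. x \<in> ?AB \<and> y \<in> (\<lambda>c. State 0 0 c) ` C}"
      by blast
  qed
  ultimately show ?thesis by simp
qed

section \<open>The repairable system\<close>

locale repairable_system =
  R1: repair_rate L \<mu>1 + R2: repair_rate L \<mu>2 for L :: real and \<mu>1 \<mu>2 :: "real \<Rightarrow> real" +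
  fixes lam1 lam2 :: real
  assumes lam1_pos: "0 < lam1" and lam2_pos: "0 < lam2"
begin

abbreviation "D \<equiv> A_dom L lam1 lam2 \<mu>1 \<mu>2"
abbreviation "A \<equiv> A_op L lam1 lam2 \<mu>1 \<mu>2"

text \<open>The last identity is conservation of mass: it replaces the equation for \<open>p\<^sub>0\<close>, from which it arises
  by integrating the two transport equations over \<open>(0,L)\<close>.\<close>

lemma resolvent_eqD:
  assumes p: "p \<in> D" and eq: "r *\<^sub>C p - A p = y"
  shows "\<exists>p1 p2. R1.solves (r + of_real lam2) (of_real lam1 * comp0 p) (rep_l1 (comp1 y)) p1 \<and>
    R2.solves r (of_real lam2 * (comp0 p + integral {0..L} p1)) (rep_l1 (comp2 y)) p2 \<and>
    comp1 p = to_L1 L p1 \<and> comp2 p = to_L1 L p2 \<and>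
    r * (comp0 p + integral {0..L} p1 + integral {0..L} p2) =
      comp0 y + integral {0..L} (rep_l1 (comp1 y)) + integral {0..L} (rep_l1 (comp2 y))"
proof -
  have dom: "comp1 p \<in> W11 L" "comp2 p \<in> W11 L"
      "set_integrable lebesgue {0<..<L} (\<lambda>x. \<mu>1 x *\<^sub>R rep_l1 (comp1 p) x)"
      "set_integrable lebesgue {0<..<L} (\<lambda>x. \<mu>2 x *\<^sub>R rep_l1 (comp2 p) x)"
      "trace0 L (comp1 p) = of_real lam1 * comp0 p"
      "trace0 L (comp2 p) = of_real lam2 * comp0 p + of_real lam2 * (LINT x:{0<..<L}|lebesgue. rep_l1 (comp1 p) x)"
    using p by (auto simp: A_dom_def)
  have comps: "r * comp0 p - comp0 (A p) = comp0 y" "r *\<^sub>C comp1 p - comp1 (A p) = comp1 y"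
      "r *\<^sub>C comp2 p - comp2 (A p) = comp2 y"
    using eq by (auto simp: minus_state_def scaleC_state_def)
  have "r *\<^sub>C comp1 p + (weak_deriv L (comp1 p) + to_L1 L (\<lambda>x. (\<mu>1 x + lam2) *\<^sub>R rep_l1 (comp1 p) x)) = comp1 y"
    using comps(2) by (simp add: A_op_def algebra_simps)
  from R1.solves_of_W11[OF dom(1,3) this]
  obtain p1 where p1: "R1.solves (r + of_real lam2) (of_real lam1 * comp0 p) (rep_l1 (comp1 y)) p1" "comp1 p = to_L1 L p1"
    unfolding dom(5) by blast
  note ints1 = R1.solves_integral_eqs(2,3)[OF p1(1), folded p1(2)]
  \<comment> \<open>Written with \<open>+ 0\<close> to match \<open>solves_of_W11\<close> for
    \<open>k = 0\<close>.\<close>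
  have "r *\<^sub>C comp2 p + (weak_deriv L (comp2 p) + to_L1 L (\<lambda>x. (\<mu>2 x + 0) *\<^sub>R rep_l1 (comp2 p) x)) = comp2 y"
    using comps(3) by (simp add: A_op_def algebra_simps)
  from R2.solves_of_W11[OF dom(2,4) this]
  obtain p2 where p2: "R2.solves r (of_real lam2 * (comp0 p + integral {0..L} p1)) (rep_l1 (comp2 y)) p2" "comp2 p = to_L1 L p2"
    unfolding dom(6) ints1(2) distrib_left of_real_0 add_0_right by blast
  note ints2 = R2.solves_integral_eqs(2,3)[OF p2(1), folded p2(2)]
  have m1: "integral {0..L} (\<lambda>x. of_real (\<mu>1 x) * p1 x) =
      of_real lam1 * comp0 p + integral {0..L} (rep_l1 (comp1 y)) - (r + of_real lam2) * integral {0..L} p1"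
    using R1.solves_mass[OF p1(1)] by (simp add: eq_diff_eq)
  have m2: "integral {0..L} (\<lambda>x. of_real (\<mu>2 x) * p2 x) =
      of_real lam2 * (comp0 p + integral {0..L} p1) + integral {0..L} (rep_l1 (comp2 y)) - r * integral {0..L} p2"
    using R2.solves_mass[OF p2(1)] by (simp add: eq_diff_eq)
  have A0: "comp0 (A p) = - of_real (lam1 + lam2) * comp0 p +
      (of_real lam1 * comp0 p + integral {0..L} (rep_l1 (comp1 y)) - (r + of_real lam2) * integral {0..L} p1) +
      (of_real lam2 * (comp0 p + integral {0..L} p1) + integral {0..L} (rep_l1 (comp2 y)) - r * integral {0..L} p2)"
    by (simp only: A_op_def state.sel ints1(1) ints2(1) m1 m2)
  have "r * (comp0 p + integral {0..L} p1 + integral {0..L} p2) =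
      comp0 y + integral {0..L} (rep_l1 (comp1 y)) + integral {0..L} (rep_l1 (comp2 y))"
    unfolding comps(1)[symmetric] A0 by (simp add: algebra_simps)
  then show ?thesis using p1 p2 by blast
qed

lemma resolvent_eqI:
  assumes y: "y \<in> X_space L"
    and p1: "R1.solves (r + of_real lam2) (of_real lam1 * comp0 p) (rep_l1 (comp1 y)) p1" "comp1 p = to_L1 L p1"
    and p2: "R2.solves r (of_real lam2 * (comp0 p + integral {0..L} p1)) (rep_l1 (comp2 y)) p2" "comp2 p = to_L1 L p2"
    and mass: "r * (comp0 p + integral {0..L} p1 + integral {0..L} p2) =
      comp0 y + integral {0..L} (rep_l1 (comp1 y)) + integral {0..L} (rep_l1 (comp2 y))"
  shows "p \<in> D" "r *\<^sub>C p - A p = y"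
proof -
  have y': "comp1 y \<in> L1 L" "comp2 y \<in> L1 L" using y by (auto simp: X_space_def)
  note ints1 = R1.solves_integral_eqs(1-3)[OF p1(1), folded p1(2)]
  note ints2 = R2.solves_integral_eqs(1-3)[OF p2(1), folded p2(2)]
  note W1 = R1.W11_of_solves[OF p1(1) y'(1), folded p1(2)]
  have "R2.solves (r + of_real 0) (of_real lam2 * (comp0 p + integral {0..L} p1)) (rep_l1 (comp2 y)) p2"
    using p2(1) by simp
  note W2 = R2.W11_of_solves[OF this y'(2), folded p2(2)]
  show "p \<in> D"
    using W1(1,2) W2(1,2) ints1 ints2 by (auto simp: A_dom_def X_space_def W11_def distrib_left)
  have m1: "integral {0..L} (\<lambda>x. of_real (\<mu>1 x) * p1 x) =
      of_real lam1 * comp0 p + integral {0..L} (rep_l1 (comp1 y)) - (r + of_real lam2) * integral {0..L} p1"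
    using R1.solves_mass[OF p1(1)] by (simp add: eq_diff_eq)
  have m2: "integral {0..L} (\<lambda>x. of_real (\<mu>2 x) * p2 x) =
      of_real lam2 * (comp0 p + integral {0..L} p1) + integral {0..L} (rep_l1 (comp2 y)) - r * integral {0..L} p2"
    using R2.solves_mass[OF p2(1)] by (simp add: eq_diff_eq)
  have A0: "comp0 (A p) = - of_real (lam1 + lam2) * comp0 p +
      (of_real lam1 * comp0 p + integral {0..L} (rep_l1 (comp1 y)) - (r + of_real lam2) * integral {0..L} p1) +
      (of_real lam2 * (comp0 p + integral {0..L} p1) + integral {0..L} (rep_l1 (comp2 y)) - r * integral {0..L} p2)"
    by (simp only: A_op_def state.sel ints1(2) ints2(2) m1 m2)
  have "comp0 y = r * (comp0 p + integral {0..L} p1 + integral {0..L} p2) -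
      integral {0..L} (rep_l1 (comp1 y)) - integral {0..L} (rep_l1 (comp2 y))"
    unfolding mass by simp
  then have "r * comp0 p - comp0 (A p) = comp0 y"
    unfolding A0 by (simp add: algebra_simps)
  moreover have "r *\<^sub>C comp1 p - comp1 (A p) = comp1 y"
    using W1(3) by (simp add: A_op_def algebra_simps)
  moreover have "r *\<^sub>C comp2 p - comp2 (A p) = comp2 y"
    using W2(3) by (simp add: A_op_def algebra_simps)
  ultimately show "r *\<^sub>C p - A p = y"
    by (cases y) (simp add: minus_state_def scaleC_state_def)
qed

text \<open>The system is triangular. \<open>q\<close> is
  \<open>p\<^sub>0 + \<integral> p\<^sub>1\<close>, affine in \<open>p\<^sub>0\<close>; the boundary
  condition gives \<open>p\<^sub>2\<close> the initial value \<open>lam2 * q\<close>, so the total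
  mass is affine in \<open>q\<close>. This composition is why the slope is a product, and it leaves
  one scalar equation for \<open>p\<^sub>0\<close>.\<close>

lemma resolvent_eq_iff:
  fixes p y :: state
  assumes e1: "R1.solves (r + of_real lam2) 1 (\<lambda>x. 0) e1" and e2: "R2.solves r 1 (\<lambda>x. 0) e2"
    and g1: "R1.solves (r + of_real lam2) 0 (rep_l1 (comp1 y)) g1" and g2: "R2.solves r 0 (rep_l1 (comp2 y)) g2"
    and y: "y \<in> X_space L"
  defines "q \<equiv> comp0 p * (1 + of_real lam1 * integral {0..L} e1) + integral {0..L} g1"
  shows "p \<in> D \<and> r *\<^sub>C p - A p = y \<longleftrightarrow>
    comp1 p = (of_real lam1 * comp0 p) *\<^sub>C to_L1 L e1 + to_L1 L g1 \<and>
    comp2 p = (of_real lam2 * q) *\<^sub>C to_L1 L e2 + to_L1 L g2 \<and>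
    r * (q * (1 + of_real lam2 * integral {0..L} e2) + integral {0..L} g2) =
      comp0 y + integral {0..L} (rep_l1 (comp1 y)) + integral {0..L} (rep_l1 (comp2 y))"
    (is "?lhs \<longleftrightarrow> ?rhs")
proof
  assume ?lhs
  then obtain p1 p2 where p1: "R1.solves (r + of_real lam2) (of_real lam1 * comp0 p) (rep_l1 (comp1 y)) p1"
    and p2: "R2.solves r (of_real lam2 * (comp0 p + integral {0..L} p1)) (rep_l1 (comp2 y)) p2"
    and eq: "comp1 p = to_L1 L p1" "comp2 p = to_L1 L p2"
    and mass: "r * (comp0 p + integral {0..L} p1 + integral {0..L} p2) =
      comp0 y + integral {0..L} (rep_l1 (comp1 y)) + integral {0..L} (rep_l1 (comp2 y))"
    using resolvent_eqD by blast
  have q: "comp0 p + integral {0..L} p1 = q"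
    unfolding R1.solves_decompose(2)[OF e1 g1 p1] q_def by (simp add: algebra_simps)
  have "q + integral {0..L} p2 = q * (1 + of_real lam2 * integral {0..L} e2) + integral {0..L} g2"
    unfolding R2.solves_decompose(2)[OF e2 g2 p2] q by (simp add: algebra_simps)
  then show ?rhs
    using mass R1.solves_decompose(1)[OF e1 g1 p1] R2.solves_decompose(1)[OF e2 g2 p2] eq by (simp add: q)
next
  assume rhs: ?rhs
  obtain p1 where p1: "R1.solves (r + of_real lam2) (of_real lam1 * comp0 p) (rep_l1 (comp1 y)) p1"
    using R1.ex_solves[OF R1.solves_integrable(2)[OF g1]] by blast
  have q: "comp0 p + integral {0..L} p1 = q"
    unfolding R1.solves_decompose(2)[OF e1 g1 p1] q_def by (simp add: algebra_simps)
  obtain p2 where p2: "R2.solves r (of_real lam2 * (comp0 p + integral {0..L} p1)) (rep_l1 (comp2 y)) p2"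
    using R2.ex_solves[OF R2.solves_integrable(2)[OF g2]] by blast
  have mass: "q + integral {0..L} p2 = q * (1 + of_real lam2 * integral {0..L} e2) + integral {0..L} g2"
    unfolding R2.solves_decompose(2)[OF e2 g2 p2] q by (simp add: algebra_simps)
  have "comp1 p = to_L1 L p1" "comp2 p = to_L1 L p2"
    using rhs R1.solves_decompose(1)[OF e1 g1 p1] R2.solves_decompose(1)[OF e2 g2 p2] q by auto
  then show ?lhs
    using resolvent_eqI[OF y p1 _ p2] rhs q mass by simp
qed

section \<open>Points of the resolvent set\<close>

lemma ex_homogeneous:
  obtains e1 e2 where "R1.solves (r + of_real lam2) 1 (\<lambda>x. 0) e1" "R2.solves r 1 (\<lambda>x. 0) e2"
proof -
  have "(\<lambda>x. 0 :: complex) absolutely_integrable_on {0..L}" by (simp add: set_integrable_def)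
  then show ?thesis using R1.ex_solves R2.ex_solves that by blast
qed

lemma ex_inhomogeneous:
  obtains g1 g2 where "R1.solves (r + of_real lam2) 0 (rep_l1 (comp1 y)) g1" "R2.solves r 0 (rep_l1 (comp2 y)) g2"
proof -
  have "rep_l1 u absolutely_integrable_on {0..L}" for u by (rule absolutely_integrable_rep_l1) simp
  then show ?thesis using R1.ex_solves R2.ex_solves that by blast
qed

lemma zero_in_X_space: "0 \<in> X_space L"
  using L1_subspace by (auto simp: X_space_def zero_state_def)

text \<open>The scalar equation is solved by dividing in turn by \<open>r\<close>, \<open>d2\<close>
  and \<open>d1\<close>, which yields first \<open>q\<close> and then
  \<open>p\<^sub>0\<close>.\<close>

lemma in_resolvent_set:
  assumes e1: "R1.solves (r + of_real lam2) 1 (\<lambda>x. 0) e1" and e2: "R2.solves r 1 (\<lambda>x. 0) e2"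
    and "r \<noteq> 0" and nz1: "1 + of_real lam1 * integral {0..L} e1 \<noteq> 0" and nz2: "1 + of_real lam2 * integral {0..L} e2 \<noteq> 0"
  shows "r \<in> resolvent_set (X_space L) D A"
proof -
  define d1 d2 where "d1 = 1 + of_real lam1 * integral {0..L} e1" and "d2 = 1 + of_real lam2 * integral {0..L} e2"
  have nz: "d1 \<noteq> 0" "d2 \<noteq> 0" using nz1 nz2 by (auto simp: d1_def d2_def)
  \<comment> \<open>\<open>K1\<close> and \<open>K2\<close> bound the solutions with initial value
    \<open>0\<close> (\<open>solves_L1_bound\<close>); \<open>Q\<close>, \<open>C0\<close> and
    \<open>C\<close> then bound \<open>q\<close>, \<open>p\<^sub>0\<close> and the whole state by
    multiples of \<open>norm y\<close>.\<close>
  define K1 K2 where "K1 = L * exp (norm (r + of_real lam2) * L)" and "K2 = L * exp (norm r * L)"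
  have K: "0 \<le> K1" "0 \<le> K2" using R1.L_pos by (auto simp: K1_def K2_def)
  define Q where "Q = (1 / norm r + K2) / norm d2"
  define C0 where "C0 = (Q + K1) / norm d1"
  define C where "C = C0 + (lam1 * C0 * norm (to_L1 L e1) + K1) + (lam2 * Q * norm (to_L1 L e2) + K2)"
  have sol: "\<exists>p. (p \<in> D \<and> r *\<^sub>C p - A p = y) \<and> norm p \<le> C * norm y \<and> (\<forall>p'. p' \<in> D \<and> r *\<^sub>C p' - A p' = y \<longrightarrow> p' = p)"
    if y: "y \<in> X_space L" for y
  proof -
    obtain g1 g2 where g1: "R1.solves (r + of_real lam2) 0 (rep_l1 (comp1 y)) g1" and g2: "R2.solves r 0 (rep_l1 (comp2 y)) g2"
      by (rule ex_inhomogeneous)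
    note iff = resolvent_eq_iff[OF e1 e2 g1 g2 y, folded d1_def d2_def]
    define Y where "Y = comp0 y + integral {0..L} (rep_l1 (comp1 y)) + integral {0..L} (rep_l1 (comp2 y))"
    define q where "q = (Y / r - integral {0..L} g2) / d2"
    define c where "c = (q - integral {0..L} g1) / d1"
    define p where "p = State c ((of_real lam1 * c) *\<^sub>C to_L1 L e1 + to_L1 L g1) ((of_real lam2 * q) *\<^sub>C to_L1 L e2 + to_L1 L g2)"
    have cq: "c * d1 + integral {0..L} g1 = q" using nz by (simp add: c_def)
    have qY: "r * (q * d2 + integral {0..L} g2) = Y" using nz \<open>r \<noteq> 0\<close> by (simp add: q_def)
    have p: "p \<in> D \<and> r *\<^sub>C p - A p = y"
      unfolding iff using cq qY by (simp add: p_def Y_def)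
    moreover have "p' = p" if "p' \<in> D \<and> r *\<^sub>C p' - A p' = y" for p'
    proof -
      have p': "comp1 p' = (of_real lam1 * comp0 p') *\<^sub>C to_L1 L e1 + to_L1 L g1"
        "comp2 p' = (of_real lam2 * (comp0 p' * d1 + integral {0..L} g1)) *\<^sub>C to_L1 L e2 + to_L1 L g2"
        "r * ((comp0 p' * d1 + integral {0..L} g1) * d2 + integral {0..L} g2) = Y"
        using that unfolding iff by (auto simp: Y_def)
      have "r * ((comp0 p' * d1 + integral {0..L} g1) * d2 + integral {0..L} g2) = r * (q * d2 + integral {0..L} g2)"
        unfolding p'(3) qY ..
      then have q': "comp0 p' * d1 + integral {0..L} g1 = q" using nz \<open>r \<noteq> 0\<close> by simp
      then have "comp0 p' * d1 = c * d1" using cq by (metis add_right_cancel)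
      then have "comp0 p' = c" using nz by simp
      then show ?thesis using p'(1,2) q' by (cases p') (simp add: p_def)
    qed
    moreover have "norm p \<le> C * norm y"
    proof -
      have ny: "norm y = norm (comp0 y) + norm (comp1 y) + norm (comp2 y)" by (simp add: norm_state_def)
      have y': "comp1 y \<in> L1 L" "comp2 y \<in> L1 L" using y by (auto simp: X_space_def)
      have n1: "norm (to_L1 L g1) \<le> K1 * norm y"
      proof -
        have "norm (to_L1 L g1) \<le> K1 * norm (comp1 y)"
          using R1.solves_L1_bound(1)[OF g1] norm_L1[OF y'(1)] by (simp add: K1_def)
        also have "\<dots> \<le> K1 * norm y" by (rule mult_left_mono[OF _ K(1)]) (simp add: ny)
        finally show ?thesis .
      qed
      have n2: "norm (to_L1 L g2) \<le> K2 * norm y"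
      proof -
        have "norm (to_L1 L g2) \<le> K2 * norm (comp2 y)"
          using R2.solves_L1_bound(1)[OF g2] norm_L1[OF y'(2)] by (simp add: K2_def)
        also have "\<dots> \<le> K2 * norm y" by (rule mult_left_mono[OF _ K(2)]) (simp add: ny)
        finally show ?thesis .
      qed
      have i1: "norm (integral {0..L} g1) \<le> K1 * norm y" and i2: "norm (integral {0..L} g2) \<le> K2 * norm y"
        using R1.solves_L1_bound(2)[OF g1] R2.solves_L1_bound(2)[OF g2] n1 n2 by auto
      have iy: "norm (integral {0..L} (rep_l1 u)) \<le> norm u" if "u \<in> L1 L" for u
        using set_lebesgue_integral_L1[of L u] set_lebesgue_integral_Ioo[OF absolutely_integrable_rep_l1[of "{0..L}" u, simplified]]
        by simp
      have "norm Y \<le> norm (comp0 y) + norm (integral {0..L} (rep_l1 (comp1 y))) + norm (integral {0..L} (rep_l1 (comp2 y)))"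
        unfolding Y_def by (intro norm_triangle_le add_mono norm_triangle_ineq order_refl)
      also have "\<dots> \<le> norm y" unfolding ny using iy y' by (intro add_mono) auto
      finally have nY: "norm Y \<le> norm y" .
      have "norm q = norm (Y / r - integral {0..L} g2) / norm d2" by (simp add: q_def norm_divide)
      also have "\<dots> \<le> (norm y / norm r + K2 * norm y) / norm d2"
        using nY i2 by (intro divide_right_mono norm_triangle_le_diff add_mono) (auto simp: norm_divide divide_right_mono)
      also have "\<dots> = Q * norm y" by (simp add: Q_def field_simps)
      finally have nq: "norm q \<le> Q * norm y" .
      have "norm c = norm (q - integral {0..L} g1) / norm d1" by (simp add: c_def norm_divide)
      also have "\<dots> \<le> (Q * norm y + K1 * norm y) / norm d1"
        using nq i1 by (intro divide_right_mono norm_triangle_le_diff add_mono) auto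
      also have "\<dots> = C0 * norm y" by (simp add: C0_def field_simps)
      finally have nc: "norm c \<le> C0 * norm y" .
      have "norm p = norm c + norm ((of_real lam1 * c) *\<^sub>C to_L1 L e1 + to_L1 L g1) +
          norm ((of_real lam2 * q) *\<^sub>C to_L1 L e2 + to_L1 L g2)"
        by (simp add: p_def norm_state_def)
      also have "\<dots> \<le> C0 * norm y + (lam1 * (C0 * norm y) * norm (to_L1 L e1) + K1 * norm y) +
          (lam2 * (Q * norm y) * norm (to_L1 L e2) + K2 * norm y)"
      proof (intro add_mono norm_triangle_le nc n1 n2)
        show "norm ((of_real lam1 * c) *\<^sub>C to_L1 L e1) \<le> lam1 * (C0 * norm y) * norm (to_L1 L e1)"
          unfolding norm_scaleC norm_mult norm_of_real using nc lam1_pos by (intro mult_right_mono mult_mono) auto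
        show "norm ((of_real lam2 * q) *\<^sub>C to_L1 L e2) \<le> lam2 * (Q * norm y) * norm (to_L1 L e2)"
          unfolding norm_scaleC norm_mult norm_of_real using nq lam2_pos by (intro mult_right_mono mult_mono) auto
      qed
      also have "\<dots> = C * norm y" by (simp add: C_def algebra_simps)
      finally show ?thesis .
    qed
    ultimately show ?thesis by blast
  qed
  \<comment> \<open>Bijectivity is onto \<open>X_space L\<close>, so the map must also stay inside
    it; the domain condition that \<open>\<mu>\<^sub>i p\<^sub>i\<close> be integrable enters
    here.\<close>
  have sub: "r *\<^sub>C p - A p \<in> X_space L" if "p \<in> D" for p
  proof -
    have dom: "comp1 p \<in> W11 L" "comp2 p \<in> W11 L" "comp1 p \<in> L1 L" "comp2 p \<in> L1 L"
      "set_integrable lebesgue {0<..<L} (\<lambda>x. \<mu>1 x *\<^sub>R rep_l1 (comp1 p) x)"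
      "set_integrable lebesgue {0<..<L} (\<lambda>x. \<mu>2 x *\<^sub>R rep_l1 (comp2 p) x)"
      using that by (auto simp: A_dom_def X_space_def)
    then have "(\<lambda>x. \<mu>1 x *\<^sub>R rep_l1 (comp1 p) x) absolutely_integrable_on {0..L}"
      and m2: "(\<lambda>x. \<mu>2 x *\<^sub>R rep_l1 (comp2 p) x) absolutely_integrable_on {0..L}"
      by (simp_all only: absolutely_integrable_on_Icc_iff_Ioo)
    then have "(\<lambda>x. \<mu>1 x *\<^sub>R rep_l1 (comp1 p) x + lam2 *\<^sub>R rep_l1 (comp1 p) x) absolutely_integrable_on {0..L}"
      by (intro set_integral_add(1) set_integrable_scaleR_right absolutely_integrable_rep_l1) auto
    then have "(\<lambda>x. (\<mu>1 x + lam2) *\<^sub>R rep_l1 (comp1 p) x) absolutely_integrable_on {0..L}"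
      by (simp add: scaleR_left_distrib)
    then show ?thesis
      using dom m2 W11_D(1)[OF R1.L_pos] to_L1_in_L1
      by (auto simp: X_space_def minus_state_def scaleC_state_def A_op_def intro!: L1_subspace)
  qed
  have bij: "bij_betw (\<lambda>p. r *\<^sub>C p - A p) D (X_space L)"
    unfolding bij_betw_def
  proof
    show "inj_on (\<lambda>p. r *\<^sub>C p - A p) D"
    proof (rule inj_onI)
      fix p p' assume "p \<in> D" "p' \<in> D" and eq: "r *\<^sub>C p - A p = r *\<^sub>C p' - A p'"
      then show "p = p'" using sol[OF sub[OF \<open>p \<in> D\<close>]] by metis
    qed
    show "(\<lambda>p. r *\<^sub>C p - A p) ` D = X_space L"
      using sub sol by (auto simp: image_iff) metis
  qed
  have "norm (resolvent D A r y) \<le> C * norm y" if yX: "y \<in> X_space L" for y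
  proof -
    obtain p where p: "p \<in> D" "r *\<^sub>C p - A p = y" "norm p \<le> C * norm y"
      using sol[OF yX] by blast
    then have "resolvent D A r y = p"
      unfolding resolvent_def using inv_into_f_f[OF bij_betw_imp_inj_on[OF bij], of p] by simp
    then show ?thesis using p by simp
  qed
  then show ?thesis using bij by (auto simp: resolvent_set_def)
qed

lemma closed_right_half_plane_resolvent:
  assumes "0 \<le> Re r" "r \<noteq> 0"
  shows "r \<in> resolvent_set (X_space L) D A"
proof -
  obtain e1 e2 where e: "R1.solves (r + of_real lam2) 1 (\<lambda>x. 0) e1" "R2.solves r 1 (\<lambda>x. 0) e2"
    by (rule ex_homogeneous)
  have "r + of_real lam2 \<noteq> 0"
    using assms lam2_pos by (auto simp: complex_eq_iff)
  then show ?thesis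
    using assms lam1_pos lam2_pos
    by (intro in_resolvent_set[OF e] R1.solves_nonvanishing[OF e(1)] R2.solves_nonvanishing[OF e(2)]) auto
qed

text \<open>Here \<open>r\<close> is any point of the resolvent set, so no formula for the inverse
  is used: boundedness of the resolvent bounds \<open>p\<close>, hence the initial values of both
  components, hence their derivatives in \<open>L\<^sup>1\<close>.\<close>

lemma compact_resolvent:
  assumes r: "r \<in> resolvent_set (X_space L) D A"
  shows "compact_operator_on (X_space L) (resolvent D A r)"
  unfolding compact_operator_on_def
proof (intro allI impI)
  fix S assume S: "S \<subseteq> X_space L \<and> bounded S"
  then obtain B where B: "0 < B" "\<And>y. y \<in> S \<Longrightarrow> norm y \<le> B"
    by (auto simp: bounded_pos)
  have bij: "bij_betw (\<lambda>p. r *\<^sub>C p - A p) D (X_space L)"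
    using r by (auto simp: resolvent_set_def)
  obtain C' where C': "\<And>y. y \<in> X_space L \<Longrightarrow> norm (resolvent D A r y) \<le> C' * norm y"
    using r by (auto simp: resolvent_set_def)
  define C where "C = \<bar>C'\<bar> * B"
  have "0 \<le> C" using B by (simp add: C_def)
  have bound: "norm (resolvent D A r y) \<le> C" if "y \<in> S" for y
  proof -
    have "norm (resolvent D A r y) \<le> C' * norm y" using C' S that by blast
    also have "\<dots> \<le> \<bar>C'\<bar> * B" using B(2)[OF that] by (intro mult_mono) auto
    finally show ?thesis by (simp add: C_def)
  qed
  define s where "s = r + of_real lam2"
  \<comment> \<open>The largest of four bounds: initial value and derivative for each component.
    \<open>C + C\<close> accounts for \<open>comp0 p\<close> and the integral of
    \<open>p1\<close>.\<close>
  define R where "R = max (max (lam1 * C) (B + norm s * C + exp (norm s * L) * (lam1 * C + B)))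
    (max (lam2 * (C + C)) (B + norm r * C + exp (norm r * L) * (lam2 * (C + C) + B)))"
  have R: "lam1 * C \<le> R" "B + norm s * C + exp (norm s * L) * (lam1 * C + B) \<le> R"
      "lam2 * (C + C) \<le> R" "B + norm r * C + exp (norm r * L) * (lam2 * (C + C) + B) \<le> R"
    unfolding R_def by linarith+
  obtain K where K: "compact K" "K \<subseteq> L1 L"
    "\<And>p f. primitive_on L p f \<Longrightarrow> norm (p 0) \<le> R \<Longrightarrow> integral {0..L} (\<lambda>x. norm (f x)) \<le> R \<Longrightarrow> to_L1 L p \<in> K"
    using ex_compact_primitives[OF R1.L_pos, of R] by blast
  have "resolvent D A r y \<in> {State a b c |a b c. a \<in> cball 0 C \<and> b \<in> K \<and> c \<in> K}" if yS: "y \<in> S" for y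
  proof -
    define p where "p = resolvent D A r y"
    have y: "y \<in> X_space L" using S yS by blast
    have np: "norm p \<le> C" using bound[OF yS] by (simp add: p_def)
    have p: "p \<in> D" "r *\<^sub>C p - A p = y"
      using bij_betw_inv_into_right[OF bij y] bij_betwE[OF bij_betw_inv_into[OF bij]] y
      by (auto simp: p_def resolvent_def)
    obtain p1 p2 where p1: "R1.solves s (of_real lam1 * comp0 p) (rep_l1 (comp1 y)) p1"
      and p2: "R2.solves r (of_real lam2 * (comp0 p + integral {0..L} p1)) (rep_l1 (comp2 y)) p2"
      and eq: "comp1 p = to_L1 L p1" "comp2 p = to_L1 L p2"
      unfolding s_def using resolvent_eqD[OF p] by blast
    have n: "norm (comp0 p) \<le> C" "norm (to_L1 L p1) \<le> C" "norm (to_L1 L p2) \<le> C"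
      using np by (auto simp: norm_state_def eq[symmetric]) (smt (verit) norm_ge_zero)+
    have y': "comp1 y \<in> L1 L" "comp2 y \<in> L1 L" using y by (auto simp: X_space_def)
    have ny: "integral {0..L} (\<lambda>x. norm (rep_l1 (comp1 y) x)) \<le> B" "integral {0..L} (\<lambda>x. norm (rep_l1 (comp2 y) x)) \<le> B"
      unfolding norm_L1[OF y'(1), symmetric] norm_L1[OF y'(2), symmetric]
      using B(2)[OF yS] by (auto simp: norm_state_def) (smt (verit) norm_ge_zero)+
    have c1: "norm (of_real lam1 * comp0 p) \<le> lam1 * C"
      using n lam1_pos by (simp add: norm_mult)
    have c2: "norm (of_real lam2 * (comp0 p + integral {0..L} p1)) \<le> lam2 * (C + C)"
      using n lam2_pos R1.solves_L1_bound(2)[OF p1]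
      unfolding norm_mult by (intro mult_mono norm_triangle_le add_mono) auto
    have "integral {0..L} (\<lambda>x. norm (rep_l1 (comp1 y) x - (s + of_real (\<mu>1 x)) * p1 x)) \<le>
        B + norm s * C + exp (norm s * L) * (lam1 * C + B)"
      by (rule order_trans[OF R1.solves_deriv_bound[OF p1]]) (intro add_mono mult_left_mono ny c1 n; simp)
    then have "to_L1 L p1 \<in> K"
      using p1 order_trans[OF c1 R(1)] R(2) unfolding R1.solves_def by (intro K(3)) auto
    have "integral {0..L} (\<lambda>x. norm (rep_l1 (comp2 y) x - (r + of_real (\<mu>2 x)) * p2 x)) \<le>
        B + norm r * C + exp (norm r * L) * (lam2 * (C + C) + B)"
      by (rule order_trans[OF R2.solves_deriv_bound[OF p2]]) (intro add_mono mult_left_mono ny c2 n; simp)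
    then have "to_L1 L p2 \<in> K"
      using p2 order_trans[OF c2 R(3)] R(4) unfolding R2.solves_def by (intro K(3)) auto
    then show ?thesis
      using \<open>to_L1 L p1 \<in> K\<close> eq n(1) by (cases p) (auto simp: p_def[symmetric])
  qed
  moreover have "compact {State a b c |a b c. a \<in> cball 0 C \<and> b \<in> K \<and> c \<in> K}"
    by (intro compact_State compact_cball K)
  moreover have "{State a b c |a b c. a \<in> cball 0 C \<and> b \<in> K \<and> c \<in> K} \<subseteq> X_space L"
    using K(2) by (auto simp: X_space_def)
  ultimately show "\<exists>K. compact K \<and> K \<subseteq> X_space L \<and> resolvent D A r ` S \<subseteq> K"
    by (intro exI[of _ "{State a b c |a b c. a \<in> cball 0 C \<and> b \<in> K \<and> c \<in> K}"]) blast
qed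

text \<open>The case \<open>y = 0\<close>, where the particular solutions are zero. For
  \<open>r \<noteq> 0\<close> the scalar condition forces \<open>comp0 p = 0\<close> as soon as
  \<open>d1\<close> and \<open>d2\<close> are nonzero; for \<open>r = 0\<close> it is void, and the
  displayed state spans the kernel.\<close>

lemma kernel_iff:
  assumes e1: "R1.solves (of_real r + of_real lam2) 1 (\<lambda>x. 0) e1" and e2: "R2.solves (of_real r) 1 (\<lambda>x. 0) e2"
  defines "d1 \<equiv> 1 + of_real lam1 * integral {0..L} e1" and "d2 \<equiv> 1 + of_real lam2 * integral {0..L} e2"
  shows "p \<in> D \<and> of_real r *\<^sub>C p - A p = 0 \<longleftrightarrow>
    p = comp0 p *\<^sub>C State 1 (of_real lam1 *\<^sub>C to_L1 L e1) ((of_real lam2 * d1) *\<^sub>C to_L1 L e2) \<and>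
    of_real r * (comp0 p * d1 * d2) = 0"
proof -
  have zero: "AE x in lebesgue. x \<in> {0<..<L} \<longrightarrow> 0 * 0 = rep_l1 0 x"
    using AE_rep_zero by eventually_elim auto
  have i0: "integral {0..L} (rep_l1 0) = 0"
    using set_lebesgue_integral_L1[of L 0] set_lebesgue_integral_Ioo[OF absolutely_integrable_rep_l1[of "{0..L}" 0, simplified]]
    by simp
  have t0: "to_L1 L (\<lambda>x. 0) = 0" by (simp add: to_L1_def zero_l1_def)
  have "R1.solves (of_real r + of_real lam2) 0 (\<lambda>x. 0) (\<lambda>x. 0)" "R2.solves (of_real r) 0 (\<lambda>x. 0) (\<lambda>x. 0)"
    using primitive_on_const[of L "0::complex"] by (auto simp: R1.solves_def R2.solves_def set_integrable_def)
  then have g: "R1.solves (of_real r + of_real lam2) 0 (rep_l1 (comp1 0)) (\<lambda>x. 0)"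
    "R2.solves (of_real r) 0 (rep_l1 (comp2 0)) (\<lambda>x. 0)"
    using R1.solves_cong[where y = "\<lambda>x. 0 * 0"] R2.solves_cong[where y = "\<lambda>x. 0 * 0"] zero
    by (auto simp: zero_state_def)
  show ?thesis
    unfolding resolvent_eq_iff[OF e1 e2 g zero_in_X_space]
    by (cases p) (auto simp: d1_def d2_def scaleC_state_def zero_state_def i0 t0 scaleC_scaleC mult_ac)
qed

lemma real_denominators:
  assumes e1: "R1.solves (of_real r + of_real lam2) 1 (\<lambda>x. 0) e1" and e2: "R2.solves (of_real r) 1 (\<lambda>x. 0) e2"
  obtains H1 H2 :: real where "0 < H1" "0 < H2" "integral {0..L} e1 = of_real H1" "integral {0..L} e2 = of_real H2"
    "1 + of_real lam1 * integral {0..L} e1 \<noteq> 0" "1 + of_real lam2 * integral {0..L} e2 \<noteq> 0"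
proof -
  obtain H1 where H1: "0 < H1" "integral {0..L} e1 = of_real H1"
    using R1.solves_real_pos[of "r + lam2"] e1 by (auto simp: of_real_add)
  obtain H2 where H2: "0 < H2" "integral {0..L} e2 = of_real H2"
    using R2.solves_real_pos[OF e2] by blast
  have "1 + lam1 * H1 \<noteq> 0" "1 + lam2 * H2 \<noteq> 0"
    using H1 H2 lam1_pos lam2_pos by (smt (verit) mult_pos_pos)+
  then have "complex_of_real (1 + lam1 * H1) \<noteq> 0" "complex_of_real (1 + lam2 * H2) \<noteq> 0"
    by (simp_all only: of_real_eq_0_iff not_False_eq_True)
  then show ?thesis using that H1 H2 by simp
qed

lemma real_eigenvalue_zero:
  assumes "is_eigenvalue D A (of_real r)"
  shows "r = 0"
proof (rule ccontr)
  assume "r \<noteq> 0"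
  obtain e1 e2 where e: "R1.solves (of_real r + of_real lam2) 1 (\<lambda>x. 0) e1" "R2.solves (of_real r) 1 (\<lambda>x. 0) e2"
    by (rule ex_homogeneous)
  obtain p where p: "p \<in> D" "p \<noteq> 0" "A p = of_real r *\<^sub>C p"
    using assms by (auto simp: is_eigenvalue_def)
  then have "p \<in> D \<and> of_real r *\<^sub>C p - A p = 0" by simp
  note k = this[unfolded kernel_iff[OF e]]
  obtain H1 H2 :: real where "1 + of_real lam1 * integral {0..L} e1 \<noteq> 0" "1 + of_real lam2 * integral {0..L} e2 \<noteq> 0"
    using real_denominators[OF e] by metis
  then have "comp0 p = 0" using k \<open>r \<noteq> 0\<close> by auto
  moreover have "0 *\<^sub>C q = 0" for q :: state
    using scaleC_of_real[of 0 q] by simp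
  ultimately show False using k p(2) by metis
qed

lemma zero_simple_eigenvalue: "is_simple_eigenvalue D A 0"
proof -
  obtain e1 e2 where e: "R1.solves (of_real 0 + of_real lam2) 1 (\<lambda>x. 0) e1" "R2.solves (of_real 0) 1 (\<lambda>x. 0) e2"
    by (rule ex_homogeneous)
  obtain H1 H2 where H: "0 < H1" "0 < H2" "integral {0..L} e1 = complex_of_real H1" "integral {0..L} e2 = complex_of_real H2"
    using real_denominators[OF e] by metis
  define E where "E = State 1 (of_real lam1 *\<^sub>C to_L1 L e1)
    ((of_real lam2 * (1 + of_real lam1 * integral {0..L} e1)) *\<^sub>C to_L1 L e2)"
  have "E \<noteq> 0" by (simp add: E_def zero_state_def)
  have comp0: "comp0 (c *\<^sub>C E) = c" for c by (simp add: E_def scaleC_state_def)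
  have ker: "p \<in> D \<and> 0 *\<^sub>C p - A p = 0 \<longleftrightarrow> p \<in> range (\<lambda>c. c *\<^sub>C E)" for p
    using kernel_iff[OF e, of p, folded E_def] comp0 by auto
  have zero: "0 *\<^sub>C q = 0" for q :: state
    using scaleC_of_real[of 0 q] by simp
  have kerE: "c *\<^sub>C E \<in> D" "0 *\<^sub>C (c *\<^sub>C E) - A (c *\<^sub>C E) = 0" for c
    using ker[of "c *\<^sub>C E"] by auto
  have one: "1 *\<^sub>C q = q" for q :: state
    using scaleC_of_real[of 1 q] by simp
  have "E \<in> D" "A E = 0"
    using kerE[of 1] by (auto simp: one zero)
  have "ker_power D A 0 n \<subseteq> range (\<lambda>c. c *\<^sub>C E)" for n
  proof (induction n)
    case 0
    show ?case using zero[of E] by (auto intro: range_eqI[of _ _ 0])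
  next
    case (Suc n)
    show ?case
    proof
      fix p assume "p \<in> ker_power D A 0 (Suc n)"
      then have p: "p \<in> D" "0 *\<^sub>C p - A p \<in> range (\<lambda>c. c *\<^sub>C E)" using Suc by auto
      then obtain c where c: "0 *\<^sub>C p - A p = c *\<^sub>C E" by blast
      have rep: "integral {0..L} (rep_l1 (z *\<^sub>C to_L1 L e)) = z * integral {0..L} e"
        if "e absolutely_integrable_on {0..L}" for z e
      proof -
        have "AE x in lebesgue. x \<in> {0..L} \<longrightarrow> rep_l1 (z *\<^sub>C to_L1 L e) x = z * e x"
          using AE_rep_scaleC[of z "to_L1 L e"] AE_rep_to_L1[OF that] AE_not_endpoint[of 0] AE_not_endpoint[of L]
          by eventually_elim auto
        then have "negligible {x. \<not> (x \<in> {0..L} \<longrightarrow> rep_l1 (z *\<^sub>C to_L1 L e) x = z * e x)}"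
          by (simp only: AE_lebesgue_iff_negligible)
        then have "integral {0..L} (rep_l1 (z *\<^sub>C to_L1 L e)) = integral {0..L} (\<lambda>x. z * e x)"
          by (rule integral_spike) auto
        then show ?thesis by simp
      qed
      \<comment> \<open>With \<open>r = 0\<close> the left side of the mass identity vanishes, so
        the multiple of \<open>E\<close> by \<open>c\<close> has total mass zero.\<close>
      have "0 = comp0 (c *\<^sub>C E) + integral {0..L} (rep_l1 (comp1 (c *\<^sub>C E))) + integral {0..L} (rep_l1 (comp2 (c *\<^sub>C E)))"
        using resolvent_eqD[OF p(1) c] by auto
      \<comment> \<open>The mass of \<open>E\<close> is the product of \<open>1 + lam1 * H1\<close>
        and \<open>1 + lam2 * H2\<close>, written out: the slope at \<open>r = 0\<close>, which is
        positive.\<close>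
      also have "\<dots> = c * of_real (1 + lam1 * H1 + lam2 * (1 + lam1 * H1) * H2)"
        using rep R1.solves_integrable(1)[OF e(1)] R2.solves_integrable(1)[OF e(2)] H
        by (simp add: E_def scaleC_state_def scaleC_scaleC algebra_simps)
      finally have "c = 0 \<or> 1 + lam1 * H1 + lam2 * (1 + lam1 * H1) * H2 = 0"
        by (metis mult_eq_0_iff of_real_eq_0_iff)
      moreover have "0 < 1 + lam1 * H1 + lam2 * (1 + lam1 * H1) * H2"
        using H lam1_pos lam2_pos by (intro add_pos_pos mult_pos_pos) auto
      ultimately have "c = 0" by auto
      then have "0 *\<^sub>C p - A p = 0" using c zero by simp
      then show "p \<in> range (\<lambda>c. c *\<^sub>C E)" using ker p(1) by blast
    qed
  qed
  moreover have "range (\<lambda>c. c *\<^sub>C E) \<subseteq> ker_power D A 0 (Suc 0)"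
    using kerE by auto
  ultimately have "(\<Union>n. ker_power D A 0 n) = range (\<lambda>c. c *\<^sub>C E)"
    by blast
  moreover have "is_eigenvalue D A 0"
    unfolding is_eigenvalue_def using \<open>E \<in> D\<close> \<open>A E = 0\<close> \<open>E \<noteq> 0\<close> zero by metis
  ultimately show ?thesis
    unfolding is_simple_eigenvalue_def using \<open>E \<noteq> 0\<close> by blast
qed

end

text \<open>Nonnegativity turns the infinite integral into a failure of integrability.\<close>

lemma repair_rateI:
  assumes "0 < L" "\<forall>x\<in>{0..L}. 0 \<le> \<mu> x"
    and "\<forall>l. 0 < l \<and> l < L \<longrightarrow> set_integrable lebesgue {0..l} \<mu>"
    and inf: "(\<integral>\<^sup>+ x\<in>{0..L}. ennreal (\<mu> x) \<partial>lebesgue) = \<infinity>"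
  shows "repair_rate L \<mu>"
proof
  show "\<not> set_integrable lebesgue {0..L} \<mu>"
  proof
    assume "set_integrable lebesgue {0..L} \<mu>"
    then have "(\<integral>\<^sup>+ x. ennreal (norm (indicator {0..L} x *\<^sub>R \<mu> x)) \<partial>lebesgue) < \<infinity>"
      by (simp add: set_integrable_def integrable_iff_bounded)
    moreover have "(\<integral>\<^sup>+ x. ennreal (norm (indicator {0..L} x *\<^sub>R \<mu> x)) \<partial>lebesgue) = (\<integral>\<^sup>+ x\<in>{0..L}. ennreal (\<mu> x) \<partial>lebesgue)"
      by (intro nn_integral_cong) (use assms(2) in \<open>auto split: split_indicator\<close>)
    ultimately show False using inf by simp
  qed
qed (use assms in auto)

theorem proposition2p1:
  fixes L lam1 lam2 :: real and \<mu>1 \<mu>2 :: "real \<Rightarrow> real"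
  assumes "0 < L" and "0 < lam1" and "0 < lam2"
    and "\<forall>x\<in>{0..L}. 0 \<le> \<mu>1 x" and "\<forall>x\<in>{0..L}. 0 \<le> \<mu>2 x"
    and "\<forall>l. 0 < l \<and> l < L \<longrightarrow> set_integrable lebesgue {0..l} \<mu>1"
    and "\<forall>l. 0 < l \<and> l < L \<longrightarrow> set_integrable lebesgue {0..l} \<mu>2"
    and "(\<integral>\<^sup>+ x\<in>{0..L}. ennreal (\<mu>1 x) \<partial>lebesgue) = \<infinity>"
    and "(\<integral>\<^sup>+ x\<in>{0..L}. ennreal (\<mu>2 x) \<partial>lebesgue) = \<infinity>"
    and "\<exists>N::nat. 0 < N \<and>
           (\<exists>l. ((\<lambda>x. \<mu>1 x * (L - x) ^ N) \<longlongrightarrow> l) (at_left L)) \<and>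
           (\<exists>l. ((\<lambda>x. \<mu>2 x * (L - x) ^ N) \<longlongrightarrow> l) (at_left L))"
  shows
    "{r. Re r > 0} \<union> {r. \<exists>a::real. a \<noteq> 0 \<and> r = \<i> * of_real a}
       \<subseteq> resolvent_set (X_space L) (A_dom L lam1 lam2 \<mu>1 \<mu>2) (A_op L lam1 lam2 \<mu>1 \<mu>2)
     \<and> (\<forall>r\<in>resolvent_set (X_space L) (A_dom L lam1 lam2 \<mu>1 \<mu>2) (A_op L lam1 lam2 \<mu>1 \<mu>2).
          compact_operator_on (X_space L) (resolvent (A_dom L lam1 lam2 \<mu>1 \<mu>2) (A_op L lam1 lam2 \<mu>1 \<mu>2) r))
     \<and> is_simple_eigenvalue (A_dom L lam1 lam2 \<mu>1 \<mu>2) (A_op L lam1 lam2 \<mu>1 \<mu>2) 0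
     \<and> (\<forall>r::real. is_eigenvalue (A_dom L lam1 lam2 \<mu>1 \<mu>2) (A_op L lam1 lam2 \<mu>1 \<mu>2) (of_real r) \<longrightarrow> r = 0)"
proof -
  interpret R1: repair_rate L \<mu>1 by (rule repair_rateI) (use assms in blast)+
  interpret R2: repair_rate L \<mu>2 by (rule repair_rateI) (use assms in blast)+
  interpret repairable_system L \<mu>1 \<mu>2 lam1 lam2 by unfold_locales (use assms in blast)+
  have "{r. Re r > 0} \<union> {r. \<exists>a::real. a \<noteq> 0 \<and> r = \<i> * of_real a} \<subseteq> resolvent_set (X_space L) D A"
  proof
    fix r assume "r \<in> {r. Re r > 0} \<union> {r. \<exists>a::real. a \<noteq> 0 \<and> r = \<i> * of_real a}"
    then have "0 \<le> Re r" "r \<noteq> 0" by auto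
    then show "r \<in> resolvent_set (X_space L) D A" by (rule closed_right_half_plane_resolvent)
  qed
  then show ?thesis
    using compact_resolvent zero_simple_eigenvalue real_eigenvalue_zero by blast
qed

end
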